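(* Let $\mathbb F=\mathbb C$ and $\mu>\rho-1$, and let $\tau:\Pi_q\to\Pi_q$, $\tau(x)=x^t$ (transposition, equivalently entrywise complex conjugation on Hermitian matrices). Then the group of all hypergroup automorphisms of $X_{q,\mu}$ is $\mathrm{Aut}(X_{q,\mu})=\{\sigma\circ T_a:\ a\in GL(q,\mathbb C),\ \sigma\in\{\mathrm{Id},\tau\}\}.$
   Context: Let $\mathbb F\in\{\mathbb R,\mathbb C,\mathbb H\}$ with real dimension $d\in\{1,2,4\}$ and fix $q\in\mathbb N$. $M_q$ denotes the $q\times q$ matrices over $\mathbb F$, $x^*=\bar x^t$, $H_q=\{x\in M_q:x=x^*\}$ with the real scalar product $(x|y)=\mathrm{Re}\,\mathrm{tr}(x^*y)$ and norm $\|x\|=(x|x)^{1/2}$; $\Pi_q\subset H_q$ is the cone of positive semidefinite matrices, $\Omega_q$ its interior, $U_q$ the unitary group, $GL(q)=GL(q,\mathbb F)$. For $r\in\Pi_q$, $\sqrt r$ is its unique positive semidefinite square root. $\Delta$ is the determinant function of the symmetric cone $\Omega_q$ (the usual determinant for $\mathbb F=\mathbb R,\mathbb C$). Put $\rho=d(q-\frac12)+1$. For $\mu>\rho-1$ let $D=\{v\in M_q: v^*v<I\}$, $\kappa_\mu=\int_D\Delta(I-v^*v)^{\mu-\rho}dv$ (Lebesgue measure on $M_q\cong\mathbb R^{dq^2}$). The matrix Bessel hypergroup $X_{q,\mu}=(\Pi_q,*_\mu)$ is $\Pi_q$ with the convolution of bounded Borel measures obtained by bilinear, weakly continuous extension of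 $(\delta_r*_\mu\delta_s)(f)=\kappa_\mu^{-1}\int_D f\big(\sqrt{r^2+s^2+svr+rv^*s}\big)\Delta(I-vv^* )^{\mu-\rho}dv$ ($f\in C_c(\Pi_q)$). It is a commutative hypergroup with neutral element $0$ and identity involution. A hypergroup automorphism of $X_{q,\mu}$ is a homeomorphism $T:\Pi_q\to\Pi_q$ with $T(\delta_x*_\mu\delta_y)=\delta_{T(x)}*_\mu\delta_{T(y)}$ for all $x,y$ (image measures). For $a\in M_q$ define $T_a:\Pi_q\to\Pi_q$, $T_a(r)=\sqrt{ar^2a^*}$. *)

theory Defs
  imports "HOL-Analysis.Analysis"
begin

type_synonym 'q cmat = "complex ^ 'q ^ 'q"

definition madj :: "'q::finite cmat \<Rightarrow> 'q cmat" where
  "madj A = (\<chi> i j. cnj (A $ j $ i))"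

definition mtransp :: "'q::finite cmat \<Rightarrow> 'q cmat" where
  "mtransp A = transpose A"

definition hermitian :: "'q::finite cmat \<Rightarrow> bool" where
  "hermitian A \<longleftrightarrow> madj A = A"

definition cquad :: "'q::finite cmat \<Rightarrow> complex ^ 'q \<Rightarrow> complex" where
  "cquad A x = (\<Sum>i\<in>UNIV. cnj (x $ i) * (A *v x) $ i)"

definition psd :: "'q::finite cmat \<Rightarrow> bool" where
  "psd A \<longleftrightarrow> hermitian A \<and> (\<forall>x. 0 \<le> Re (cquad A x))"

definition posdef :: "'q::finite cmat \<Rightarrow> bool" where
  "posdef A \<longleftrightarrow> hermitian A \<and> (\<forall>x. x \<noteq> 0 \<longrightarrow> 0 < Re (cquad A x))"

definition PiCone :: "'q::finite cmat set" where
  "PiCone = {A. psd A}"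

definition psd_sqrt :: "'q::finite cmat \<Rightarrow> 'q cmat" where
  "psd_sqrt r = (THE s. psd s \<and> s ** s = r)"

definition Dball :: "'q::finite cmat set" where
  "Dball = {v. posdef (mat 1 - madj v ** v)}"

text \<open>rho = d(q - 1/2) + 1 with d = 2 (complex case).\<close>
definition rho_C :: "'q::finite itself \<Rightarrow> real" where
  "rho_C _ = 2 * (real CARD('q) - 1/2) + 1"

definition kappa :: "'q::finite itself \<Rightarrow> real \<Rightarrow> real" where
  "kappa Q \<mu> = (LINT v:(Dball::'q cmat set)|lborel.
        Re (det (mat 1 - madj v ** v)) powr (\<mu> - rho_C Q))"

text \<open>(delta_r *_mu delta_s)(f) for f in C_c(Pi_q), as in the paper.\<close>
definition conv_pt :: "real \<Rightarrow> 'q::finite cmat \<Rightarrow> 'q cmat \<Rightarrow> ('q cmat \<Rightarrow> real) \<Rightarrow> real" where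
  "conv_pt \<mu> r s f = (LINT v:(Dball::'q cmat set)|lborel.
        f (psd_sqrt (r ** r + s ** s + s ** v ** r + r ** madj v ** s))
        * Re (det (mat 1 - v ** madj v)) powr (\<mu> - rho_C TYPE('q))) / kappa TYPE('q) \<mu>"

definition Cc_Pi :: "('q::finite cmat \<Rightarrow> real) set" where
  "Cc_Pi = {f. continuous_on PiCone f \<and>
       (\<exists>K. compact K \<and> K \<subseteq> PiCone \<and> (\<forall>x\<in>PiCone - K. f x = 0))}"

text \<open>Hypergroup automorphism: homeomorphism of Pi_q such that the image measure of
  delta_x * delta_y under T equals delta_{T x} * delta_{T y}; image measures are tested on
  C_c(Pi_q) (which determines the Radon measures involved).\<close>
definition hypergroup_aut :: "real \<Rightarrow> ('q::finite cmat \<Rightarrow> 'q cmat) \<Rightarrow> bool" where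
  "hypergroup_aut \<mu> T \<longleftrightarrow>
     (\<exists>T'. homeomorphism PiCone PiCone T T') \<and>
     (\<forall>x\<in>PiCone. \<forall>y\<in>PiCone. \<forall>f\<in>Cc_Pi.
        conv_pt \<mu> x y (f \<circ> T) = conv_pt \<mu> (T x) (T y) f)"

definition T_mat :: "'q::finite cmat \<Rightarrow> 'q cmat \<Rightarrow> 'q cmat" where
  "T_mat a r = psd_sqrt (a ** r ** r ** madj a)"

end

theory Submission
  imports Defs
begin

text \<open>
  Since \<open>\<Delta>(I - v v\<^sup>*)\<^bsup>\<mu>-\<rho>\<^esup>\<close> is positive and integrable on \<open>D\<close>, an automorphism \<open>T\<close> maps the support of
  \<open>\<delta>\<^sub>r * \<delta>\<^sub>s\<close> onto that of \<open>\<delta>\<^bsub>T r\<^esub> * \<delta>\<^bsub>T s\<^esub>\<close>. Pass to \<open>\<tau>(A) = T(\<surd>A)\<^sup>2\<close>. The support of \<open>A * A\<close> is the order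
  interval \<open>[0, 4A]\<close>, hence \<open>\<tau>\<close> is an order automorphism of the cone and permutes the rank-one matrices
  \<open>x x\<^sup>*\<close>. The rank-one matrices in the support of \<open>x x\<^sup>* * y y\<^sup>*\<close> are the \<open>(x + c y)(x + c y)\<^sup>*\<close> with
  \<open>|c| = 1\<close> (\<open>x\<close>, \<open>y\<close> independent), so in affine coordinates \<open>\<tau>\<close> acts on every complex line by an
  isometry of the plane, which is \<open>\<complex>\<close>-linear or conjugate-linear. This yields \<open>\<tau>(x x\<^sup>*) = a x x\<^sup>* a\<^sup>*\<close>
  or the same with \<open>x\<close> conjugated, and a positive semidefinite matrix is determined by the rank-one
  matrices below it. Conversely, the polar decomposition \<open>r a\<^sup>* = U T\<^sub>a(r)\<close> turns \<open>T\<^sub>a\<close> into the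
  substitution \<open>v \<mapsto> U\<^sub>s\<^sup>* v U\<^sub>r\<close>, under which \<open>D\<close>, the weight and Lebesgue measure are invariant.
\<close>

section \<open>Hermitian matrices\<close>

text \<open>A support can be read off from integrals against test functions only if the weight is
  integrable. The hypothesis says just that the exponent \<open>\<mu> - rho_C\<close> exceeds -1;
  for a negative exponent the weight blows up at the boundary of the ball, and a divergent Bochner
  integral has the value 0, which would carry no information. This is the reason for the estimates
  of column integrals. The squared support points are affine in \<open>v\<close>: with
  \<open>A = s ** s\<close> and equal arguments they are \<open>2 A + s (v + madj v) s\<close>,
  where \<open>v + madj v\<close> runs through the Hermitian matrices between -2 and 2; hence the 4
  in the order interval. Rank at most one is visible in the order, because exactly then the interval
  below a matrix is a chain. The phase ambiguity of \<open>x\<close> is fixed by normalising on an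
  affine hyperplane \<open>e + W\<close>; then only the choice between linear and conjugate-linear
  could vary from line to line, and the vector \<open>\<i> *s (y1 + y2)\<close> excludes this.
  Conjugating \<open>x\<close> transposes \<open>outer x x\<close>, which is where the second class
  of automorphisms comes from.\<close>

definition cinner :: "complex ^ 'n::finite \<Rightarrow> complex ^ 'n \<Rightarrow> complex" where
  "cinner x y = (\<Sum>i\<in>UNIV. cnj (x $ i) * y $ i)"

definition outer :: "complex ^ 'n::finite \<Rightarrow> complex ^ 'n \<Rightarrow> 'n cmat" where
  "outer x y = (\<chi> i j. x $ i * cnj (y $ j))"

lemma cinner_add_left: "cinner (x + y) z = cinner x z + cinner y z"
  and cinner_add_right: "cinner x (y + z) = cinner x y + cinner x z"
  and cinner_diff_left: "cinner (x - y) z = cinner x z - cinner y z"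
  and cinner_diff_right: "cinner x (y - z) = cinner x y - cinner x z"
  and cinner_minus_left: "cinner (- x) y = - cinner x y"
  and cinner_minus_right: "cinner x (- y) = - cinner x y"
  by (simp_all add: cinner_def algebra_simps sum.distrib sum_subtractf sum_negf)

lemma cinner_scale_left: "cinner (c *s x) y = cnj c * cinner x y"
  and cinner_scale_right: "cinner x (c *s y) = c * cinner x y"
  and cinner_scaleR_left: "cinner (r *\<^sub>R x) y = of_real r * cinner x y"
  and cinner_scaleR_right: "cinner x (r *\<^sub>R y) = of_real r * cinner x y"
  by (simp_all add: cinner_def sum_distrib_left algebra_simps scaleR_conv_of_real[where 'a=complex])

lemma cinner_zero [simp]: "cinner 0 x = 0" "cinner x 0 = 0"
  by (simp_all add: cinner_def)

lemmas cinner_simps = cinner_add_left cinner_add_right cinner_diff_left cinner_diff_right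
  cinner_minus_left cinner_minus_right cinner_scale_left cinner_scale_right
  cinner_scaleR_left cinner_scaleR_right

lemma cnj_cinner: "cnj (cinner x y) = cinner y x"
  by (simp add: cinner_def algebra_simps)

lemma Re_cinner_commute: "Re (cinner x y) = Re (cinner y x)"
  using cnj_cinner[of x y] by (simp add: complex_eq_iff)

lemma Re_cinner: "Re (cinner x y) = x \<bullet> y"
  by (simp add: cinner_def inner_vec_def inner_complex_def)

lemma cinner_self: "cinner x x = of_real ((norm x)\<^sup>2)"
proof -
  have "Im (cinner x x) = 0"
    using cnj_cinner[of x x] by (metis Reals_cnj_iff complex_is_Real_iff)
  moreover have "Re (cinner x x) = (norm x)\<^sup>2"
    by (simp add: Re_cinner power2_norm_eq_inner)
  ultimately show ?thesis
    by (simp add: complex_eq_iff)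
qed

lemma cinner_eq_zero_iff [simp]: "cinner x x = 0 \<longleftrightarrow> x = 0"
  by (simp add: cinner_self)

lemma cinner_extensional:
  assumes "\<And>z. cinner z x = cinner z y" shows "x = y"
proof -
  have "cinner (x - y) (x - y) = 0"
    using assms by (simp add: cinner_diff_right)
  then show ?thesis by simp
qed

lemma norm_scale_vec: "norm (c *s x) = cmod c * norm (x :: complex ^ 'n::finite)"
proof -
  have "of_real ((norm (c *s x))\<^sup>2) = (of_real ((cmod c * norm x)\<^sup>2) :: complex)"
    unfolding cinner_self[symmetric] power_mult_distrib of_real_mult complex_norm_square
    by (simp only: cinner_simps mult_ac)
  then have "(norm (c *s x))\<^sup>2 = (cmod c * norm x)\<^sup>2"
    using of_real_eq_iff by blast
  then show ?thesis by (simp add: power2_eq_iff_nonneg)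
qed

text \<open>Rotating by the conjugate of the sign of the pairing makes it real and nonnegative. This
  reduces complex estimates to the real inner product.\<close>

lemma cinner_phase_exists:
  obtains c where "cmod c = 1" "Re (cinner x (c *s y)) = cmod (cinner x y)"
proof (cases "cinner x y = 0")
  case True
  then show ?thesis using that[of 1] by (simp add: cinner_simps)
next
  case False
  define c where "c = cnj (sgn (cinner x y))"
  have "c * cinner x y = of_real (cmod (cinner x y))"
    using False unfolding c_def sgn_eq
    by (simp add: field_simps complex_norm_square[symmetric] power2_eq_square[symmetric])
  moreover have "cmod c = 1"
    using False by (simp add: c_def norm_sgn)
  ultimately show ?thesis
    using that[of c] by (simp add: cinner_simps)
qed

lemma cinner_Cauchy_Schwarz: "cmod (cinner x y) \<le> norm x * norm y"
proof -
  obtain c where c: "cmod c = 1" "Re (cinner x (c *s y)) = cmod (cinner x y)"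
    by (rule cinner_phase_exists)
  have "cmod (cinner x y) = x \<bullet> (c *s y)"
    using c by (simp add: Re_cinner)
  also have "\<dots> \<le> norm x * norm (c *s y)"
    by (rule norm_cauchy_schwarz)
  finally show ?thesis using c by (simp add: norm_scale_vec)
qed

section \<open>Algebra of complex matrices and adjoints\<close>

lemma matrix_add_rdistrib: "(B + C) ** D = B ** D + C ** D"
  and matrix_diff_ldistrib: "A ** (B - C) = A ** B - A ** C"
  and matrix_diff_rdistrib: "(B - C) ** D = B ** D - C ** D"
  and matrix_minus_left: "(- B) ** D = - (B ** D)"
  and matrix_minus_right: "A ** (- C) = - (A ** C)"
  for A B C D :: "complex ^ 'n ^ 'n"
  by (simp_all add: matrix_matrix_mult_def vec_eq_iff algebra_simps sum.distrib sum_subtractf sum_negf)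

lemma matrix_scaleR_left: "(r *\<^sub>R A) ** B = r *\<^sub>R (A ** (B :: complex ^ 'n ^ 'm))"
  and matrix_scaleR_right: "A ** (r *\<^sub>R B) = r *\<^sub>R (A ** B)"
  by (simp_all add: matrix_matrix_mult_def vec_eq_iff scaleR_sum_right)

lemmas matrix_distribs = matrix_add_ldistrib matrix_add_rdistrib matrix_diff_ldistrib
  matrix_diff_rdistrib matrix_scaleR_left matrix_scaleR_right matrix_minus_left matrix_minus_right
  matrix_mul_assoc

lemma matrix_vector_scale: "A *v (c *s x) = c *s (A *v (x :: complex ^ 'n::finite))"
  by (simp add: matrix_vector_mult_def vec_eq_iff sum_distrib_left algebra_simps)

lemma matrix_vector_scaleR: "A *v (r *\<^sub>R x) = r *\<^sub>R (A *v (x :: complex ^ 'n::finite))"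
  by (simp add: matrix_vector_mult_def vec_eq_iff scaleR_sum_right)

lemma matrix_scaleR_vector: "(r *\<^sub>R A) *v x = r *\<^sub>R (A *v (x :: complex ^ 'n::finite))"
  by (simp add: matrix_vector_mult_def vec_eq_iff scaleR_sum_right)

lemma madj_madj [simp]: "madj (madj A) = A"
  by (simp add: madj_def vec_eq_iff)

lemma madj_mult: "madj (A ** B) = madj B ** madj A"
  by (simp add: madj_def vec_eq_iff matrix_matrix_mult_def algebra_simps)

lemma madj_add: "madj (A + B) = madj A + madj B"
  and madj_diff: "madj (A - B) = madj A - madj B"
  and madj_minus: "madj (- A) = - madj A"
  and madj_scaleR: "madj (r *\<^sub>R A) = r *\<^sub>R madj A"
  and madj_mat_1 [simp]: "madj (mat 1) = mat 1"
  and madj_zero [simp]: "madj 0 = 0"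
  by (auto simp: madj_def vec_eq_iff mat_def)

lemmas madj_simps = madj_mult madj_add madj_diff madj_minus madj_scaleR

lemma cinner_adjoint: "cinner (A *v x) y = cinner x (madj A *v y)"
proof -
  have "cinner (A *v x) y = (\<Sum>i\<in>UNIV. \<Sum>j\<in>UNIV. cnj (A $ i $ j) * cnj (x $ j) * y $ i)"
    by (simp add: cinner_def matrix_vector_mult_def sum_distrib_right)
  also have "\<dots> = (\<Sum>j\<in>UNIV. \<Sum>i\<in>UNIV. cnj (A $ i $ j) * cnj (x $ j) * y $ i)"
    by (rule sum.swap)
  also have "\<dots> = cinner x (madj A *v y)"
    by (simp add: cinner_def matrix_vector_mult_def madj_def sum_distrib_left algebra_simps)
  finally show ?thesis .
qed

lemma cinner_axis: "cinner (axis i 1) x = x $ i"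
proof -
  have "cinner (axis i 1) x = (\<Sum>j\<in>UNIV. if j = i then x $ i else 0)"
    unfolding cinner_def by (rule sum.cong) (auto simp: axis_def)
  then show ?thesis by simp
qed

lemma cquad_eq: "cquad A x = cinner x (A *v x)"
  by (simp add: cquad_def cinner_def)

lemma hermitian_cinner: "hermitian A \<Longrightarrow> cinner (A *v x) y = cinner x (A *v y)"
  by (simp add: cinner_adjoint hermitian_def)

lemma cquad_hermitian_real:
  assumes "hermitian A" shows "cinner x (A *v x) = of_real (Re (cinner x (A *v x)))"
proof -
  have "cnj (cinner x (A *v x)) = cinner x (A *v x)"
    by (simp add: cnj_cinner hermitian_cinner[OF assms])
  then show ?thesis by (metis Reals_cnj_iff of_real_Re)
qed

section \<open>The positive semidefinite cone and its order\<close>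

lemma psdD: "psd A \<Longrightarrow> 0 \<le> Re (cinner x (A *v x))"
  and psd_hermitian: "psd A \<Longrightarrow> hermitian A"
  by (simp_all add: psd_def cquad_eq)

lemma psd_madj: "psd A \<Longrightarrow> madj A = A"
  by (simp add: psd_def hermitian_def)

lemma psdI: "hermitian A \<Longrightarrow> (\<And>x. 0 \<le> Re (cinner x (A *v x))) \<Longrightarrow> psd A"
  by (simp add: psd_def cquad_eq)

lemma psd_zero [simp]: "psd 0"
  by (rule psdI) (auto simp: hermitian_def)

lemma psd_mat_1 [simp]: "psd (mat 1)"
  by (rule psdI) (auto simp: hermitian_def cinner_self)

lemma psd_add: "psd A \<Longrightarrow> psd B \<Longrightarrow> psd (A + B)"
  by (simp add: psd_def hermitian_def cquad_eq madj_add matrix_vector_mult_add_rdistrib cinner_simps)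

lemma psd_scaleR: "psd A \<Longrightarrow> 0 \<le> r \<Longrightarrow> psd (r *\<^sub>R A)"
  by (simp add: psd_def hermitian_def cquad_eq madj_scaleR matrix_scaleR_vector cinner_simps)

lemma psd_congruence:
  assumes "psd A" shows "psd (B ** A ** madj B)"
proof (rule psdI)
  show "hermitian (B ** A ** madj B)"
    using psd_madj[OF assms] by (simp add: hermitian_def madj_mult matrix_mul_assoc)
  fix x
  have "cinner x ((B ** A ** madj B) *v x) = cinner (madj B *v x) (A *v (madj B *v x))"
    by (simp only: matrix_vector_mul_assoc[symmetric] cinner_adjoint madj_madj)
  then show "0 \<le> Re (cinner x ((B ** A ** madj B) *v x))"
    using psdD[OF assms] by simp
qed

lemma psd_square: "psd (A ** madj A)" "psd (madj A ** A)"
  using psd_congruence[OF psd_mat_1, of A] psd_congruence[OF psd_mat_1, of "madj A"] by simp_all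

lemma psd_square_self: "psd A \<Longrightarrow> psd (A ** A)"
  using psd_square(1)[of A] by (simp add: psd_madj)

text \<open>The quadratic polynomial
  \<open>t \<mapsto> \<langle>x - t z, A (x - t z)\<rangle>\<close> is nonnegative, where
  \<open>z\<close> is \<open>y\<close> rotated so that the mixed term is real. The form may be
  degenerate, so a vanishing leading coefficient is a separate case.\<close>

lemma psd_Cauchy_Schwarz:
  assumes "psd A"
  shows "(cmod (cinner x (A *v y)))\<^sup>2 \<le> Re (cinner x (A *v x)) * Re (cinner y (A *v y))"
proof -
  obtain c where c: "cmod c = 1" "Re (cinner x (c *s (A *v y))) = cmod (cinner x (A *v y))"
    by (rule cinner_phase_exists)
  define z where "z = c *s y"
  have cc: "cnj c * c = 1"
    using c(1) by (metis complex_norm_square mult.commute of_real_1 power_one)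
  have zz: "cinner z (A *v z) = cinner y (A *v y)"
    using cc by (simp add: z_def matrix_vector_scale cinner_simps mult.assoc[symmetric] mult.commute)
  have xz: "Re (cinner x (A *v z)) = cmod (cinner x (A *v y))"
    using c by (simp add: z_def matrix_vector_scale)
  have zx: "Re (cinner z (A *v x)) = cmod (cinner x (A *v y))"
    using xz Re_cinner_commute hermitian_cinner[OF psd_hermitian[OF assms]] by metis
  let ?a = "Re (cinner x (A *v x))" and ?b = "cmod (cinner x (A *v y))" and ?d = "Re (cinner y (A *v y))"
  have q: "0 \<le> ?a - 2 * t * ?b + t\<^sup>2 * ?d" for t :: real
  proof -
    have "0 \<le> Re (cinner (x - t *\<^sub>R z) (A *v (x - t *\<^sub>R z)))"
      by (rule psdD[OF assms])
    also have "\<dots> = ?a - 2 * t * ?b + t\<^sup>2 * ?d"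
      using zz xz zx
      by (simp add: cinner_simps matrix_vector_mult_diff_distrib matrix_vector_scaleR power2_eq_square algebra_simps)
    finally show ?thesis .
  qed
  have d: "0 \<le> ?d" by (rule psdD[OF assms])
  show ?thesis
  proof (cases "?d = 0")
    case True
    have "?b = 0"
    proof (rule ccontr)
      assume b: "?b \<noteq> 0"
      \<comment> \<open>With leading coefficient 0 the polynomial is linear; at this
        \<open>t\<close> its value is \<open>- ?a - 2\<close>, which is negative.\<close>
      have "0 \<le> ?a - 2 * ((?a + 1) / ?b) * ?b"
        using q[of "(?a + 1) / ?b"] True by simp
      then have "?a \<le> -2" using b by simp
      then show False using psdD[OF assms, of x] by linarith
    qed
    then show ?thesis by (simp add: True)
  next
    case False
    then have d': "0 < ?d" using d by simp
    \<comment> \<open>Evaluation at the minimum \<open>t = ?b / ?d\<close>, multiplied by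
      \<open>?d\<close>.\<close>
    have "0 \<le> (?a - 2 * (?b / ?d) * ?b + (?b / ?d)\<^sup>2 * ?d) * ?d"
      using q[of "?b / ?d"] d by simp
    also have "\<dots> = ?a * ?d - ?b\<^sup>2"
      using d' by (simp add: field_simps power2_eq_square)
    finally show ?thesis by simp
  qed
qed

text \<open>By the Cauchy-Schwarz inequality of the form, \<open>A *v x\<close> is orthogonal to
  every \<open>z\<close>.\<close>

lemma psd_kernel:
  assumes "psd A" "Re (cinner x (A *v x)) = 0" shows "A *v x = 0"
proof (rule cinner_extensional)
  fix z
  have "(cmod (cinner z (A *v x)))\<^sup>2 \<le> 0"
    using psd_Cauchy_Schwarz[OF assms(1), of z x] assms(2) by simp
  then show "cinner z (A *v x) = cinner z 0" by simp
qed

lemma hermitian_eq_zero: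
  assumes "hermitian A" "\<And>x. Re (cinner x (A *v x)) = 0" shows "A = 0"
proof -
  have "psd A" using assms by (simp add: psdI)
  then have "\<forall>x. A *v x = 0 *v x"
    by (simp add: psd_kernel assms(2))
  then show ?thesis by (subst matrix_eq)
qed

lemma psd_antisym:
  assumes "psd (A - B)" "psd (B - A)" shows "A = B"
proof -
  have "A - B = 0"
  proof (rule hermitian_eq_zero)
    fix x
    have "Re (cinner x ((B - A) *v x)) = - Re (cinner x ((A - B) *v x))"
      by (simp add: matrix_vector_mult_diff_rdistrib cinner_simps)
    then show "Re (cinner x ((A - B) *v x)) = 0"
      using psdD[OF assms(1), of x] psdD[OF assms(2), of x] by simp
  qed (rule psd_hermitian[OF assms(1)])
  then show ?thesis by simp
qed

lemma psd_trans: "psd (A - B) \<Longrightarrow> psd (B - C) \<Longrightarrow> psd (A - C)"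
  using psd_add[of "A - B" "B - C"] by simp

section \<open>Rank-one matrices\<close>

lemma outer_mult_vec: "outer x y *v z = cinner y z *s x"
  by (simp add: outer_def matrix_vector_mult_def vec_eq_iff cinner_def sum_distrib_left sum_distrib_right mult_ac)

lemma madj_outer: "madj (outer x y) = outer y x"
  by (simp add: outer_def madj_def vec_eq_iff)

lemma outer_congruence: "A ** outer x y ** madj B = outer (A *v x) (B *v y)"
  unfolding matrix_eq
  by (simp only: matrix_vector_mul_assoc[symmetric] outer_mult_vec cinner_adjoint matrix_vector_scale simp_thms)

lemma outer_scaleR: "outer (r *\<^sub>R x) y = r *\<^sub>R outer x y" "outer x (r *\<^sub>R y) = r *\<^sub>R outer x y"
  by (simp_all add: outer_def vec_eq_iff)

lemma outer_add: "outer (x + x') y = outer x y + outer x' y" "outer x (y + y') = outer x y + outer x y'"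
  by (simp_all add: outer_def vec_eq_iff algebra_simps)

lemma outer_zero [simp]: "outer 0 x = 0" "outer x 0 = 0"
  by (simp_all add: outer_def vec_eq_iff)

lemma outer_quadratic: "Re (cinner z (outer x x *v z)) = (cmod (cinner x z))\<^sup>2"
proof -
  have "cinner z (outer x x *v z) = cinner x z * cnj (cinner x z)"
    by (simp add: outer_mult_vec cinner_simps cnj_cinner)
  also have "\<dots> = of_real ((cmod (cinner x z))\<^sup>2)"
    by (metis complex_norm_square)
  finally show ?thesis by simp
qed

lemma psd_outer [simp]: "psd (outer x x)"
  by (rule psdI) (auto simp: hermitian_def madj_outer outer_quadratic)

lemma outer_eq_zero_iff [simp]: "outer x x = 0 \<longleftrightarrow> x = 0"
proof
  assume "outer x x = 0"
  then have "outer x x *v x = 0" by simp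
  then show "x = 0" by (simp add: outer_mult_vec vec.scale_eq_0_iff)
qed simp

lemma invertible_iff_kernel:
  fixes A :: "'n::finite cmat"
  shows "invertible A \<longleftrightarrow> (\<forall>x. A *v x = 0 \<longrightarrow> x = 0)"
  unfolding invertible_left_inverse matrix_left_invertible_ker ..

lemma invertibleE:
  assumes "invertible (A :: 'n::finite cmat)"
  obtains B where "A ** B = mat 1" "B ** A = mat 1"
  using assms unfolding invertible_def by blast

section \<open>Continuity of the matrix operations and closedness of the cone\<close>

lemma matrix_mult_continuous [continuous_intros]:
  fixes f g :: "'a::topological_space \<Rightarrow> 'n::finite cmat"
  assumes "continuous_on S f" "continuous_on S g"
  shows "continuous_on S (\<lambda>x. f x ** g x)"
  unfolding matrix_matrix_mult_def
  by (intro continuous_intros assms)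

lemma madj_continuous [continuous_intros]:
  fixes f :: "'a::topological_space \<Rightarrow> 'n::finite cmat"
  assumes "continuous_on S f"
  shows "continuous_on S (\<lambda>x. madj (f x))"
  unfolding madj_def
  by (intro continuous_intros assms)

lemma matrix_vector_continuous [continuous_intros]:
  fixes f :: "'a::topological_space \<Rightarrow> 'n::finite cmat"
  assumes "continuous_on S f" "continuous_on S g"
  shows "continuous_on S (\<lambda>x. f x *v g x)"
  unfolding matrix_vector_mult_def
  by (intro continuous_intros assms)

lemma det_continuous [continuous_intros]:
  fixes f :: "'a::topological_space \<Rightarrow> 'n::finite cmat"
  assumes "continuous_on S f"
  shows "continuous_on S (\<lambda>x. det (f x))"
  unfolding det_def
  by (intro continuous_intros assms)

lemma cinner_continuous [continuous_intros]:
  assumes "continuous_on S f" "continuous_on S g"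
  shows "continuous_on S (\<lambda>x. cinner (f x) (g x))"
  unfolding cinner_def
  by (intro continuous_intros assms)

lemma outer_continuous [continuous_intros]:
  assumes "continuous_on S f" "continuous_on S g"
  shows "continuous_on S (\<lambda>x. outer (f x) (g x))"
  unfolding outer_def
  by (intro continuous_intros assms)

lemma tendsto_matrix_mult [tendsto_intros]:
  fixes f g :: "'a \<Rightarrow> 'n::finite cmat"
  assumes "(f \<longlongrightarrow> A) F" "(g \<longlongrightarrow> B) F" shows "((\<lambda>x. f x ** g x) \<longlongrightarrow> A ** B) F"
  using assms unfolding matrix_matrix_mult_def by (intro tendsto_intros)

lemma tendsto_madj [tendsto_intros]:
  fixes f :: "'a \<Rightarrow> 'n::finite cmat"
  assumes "(f \<longlongrightarrow> A) F" shows "((\<lambda>x. madj (f x)) \<longlongrightarrow> madj A) F"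
  using assms unfolding madj_def by (intro tendsto_intros)

text \<open>Statements whose proof needs an inverse are shown for these positive definite
  approximations of a positive semidefinite \<open>A\<close> and then passed to the limit by
  compactness.\<close>

lemma tendsto_add_inverse_mat_1:
  fixes A :: "'n::finite cmat"
  shows "(\<lambda>n. A + inverse (real (Suc n)) *\<^sub>R mat 1) \<longlonglongrightarrow> A"
proof -
  have "(\<lambda>n. A + inverse (real (Suc n)) *\<^sub>R mat 1) \<longlonglongrightarrow> A + 0 *\<^sub>R mat 1"
    by (intro tendsto_intros LIMSEQ_inverse_real_of_nat)
  then show ?thesis by simp
qed

lemma closed_PiCone: "closed (PiCone :: 'n::finite cmat set)"
proof -
  have *: "PiCone = {A :: 'n cmat. madj A = A} \<inter> (\<Inter>x. {A. 0 \<le> Re (cinner x (A *v x))})"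
    by (auto simp: PiCone_def psd_def hermitian_def cquad_eq)
  have "closed {A :: 'n cmat. madj A = A}"
    by (intro closed_Collect_eq continuous_intros)
  moreover have "closed {A :: 'n cmat. 0 \<le> Re (cinner x (A *v x))}" for x
    by (intro closed_Collect_le continuous_intros)
  ultimately show ?thesis unfolding * by (intro closed_INT closed_Int) auto
qed

section \<open>Diagonalization\<close>

definition unitary :: "'n::finite cmat \<Rightarrow> bool" where
  "unitary U \<longleftrightarrow> madj U ** U = mat 1"

definition cdiag :: "('n::finite \<Rightarrow> real) \<Rightarrow> 'n cmat" where
  "cdiag d = (\<chi> i j. if i = j then of_real (d i) else 0)"

lemma unitaryD:
  assumes "unitary U" shows "madj U ** U = mat 1" "U ** madj U = mat 1"
  using assms matrix_left_right_inverse[of U "madj U"] by (simp_all add: unitary_def)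

lemma unitary_madj: "unitary U \<Longrightarrow> unitary (madj U)"
  by (simp add: unitary_def unitaryD(2))

lemma unitary_cancel:
  assumes "unitary U" shows "madj U *v (U *v x) = x" "U *v (madj U *v x) = x"
  by (simp_all add: matrix_vector_mul_assoc unitaryD[OF assms])

lemma unitary_cinner: "unitary U \<Longrightarrow> cinner (U *v x) (U *v y) = cinner x y"
  by (simp add: cinner_adjoint unitary_cancel)

lemma norm_eq_sqrt_cinner: "norm x = sqrt (Re (cinner x x))"
  by (simp add: cinner_self)

lemma unitary_norm: "unitary U \<Longrightarrow> norm (U *v x) = norm x"
  by (simp add: norm_eq_sqrt_cinner unitary_cinner)

lemma cdiag_mult: "cdiag c ** cdiag d = cdiag (\<lambda>i. c i * d i)"
proof -
  have "(\<Sum>k\<in>UNIV. (if i = k then complex_of_real (c i) else 0) * (if k = j then complex_of_real (d k) else 0))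
      = (\<Sum>k\<in>UNIV. if k = i then (if i = j then complex_of_real (c i * d i) else 0) else 0)" for i j
    by (rule sum.cong) auto
  then show ?thesis
    by (simp add: cdiag_def matrix_matrix_mult_def vec_eq_iff)
qed

lemma cdiag_vec: "(cdiag d *v x) $ i = of_real (d i) * x $ i"
proof -
  have "(cdiag d *v x) $ i = (\<Sum>j\<in>UNIV. if j = i then of_real (d i) * x $ i else 0)"
    unfolding cdiag_def matrix_vector_mult_def vec_lambda_beta by (rule sum.cong) auto
  then show ?thesis by simp
qed

lemma cdiag_quadratic: "cinner x (cdiag d *v x) = of_real (\<Sum>i\<in>UNIV. d i * (cmod (x $ i))\<^sup>2)"
  by (simp add: cinner_def cdiag_vec complex_norm_square mult_ac del: of_real_power)

lemma madj_cdiag: "madj (cdiag d) = cdiag d"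
  by (simp add: madj_def cdiag_def vec_eq_iff)

lemma psd_cdiag: "(\<And>i. 0 \<le> d i) \<Longrightarrow> psd (cdiag d)"
  by (rule psdI) (auto simp: hermitian_def madj_cdiag cdiag_quadratic intro!: sum_nonneg)

lemma det_cdiag: "det (cdiag d) = of_real (\<Prod>i\<in>UNIV. d i)"
  by (subst det_diagonal) (auto simp: cdiag_def)

text \<open>The matrix with rows \<open>cnj (u i)\<close> for \<open>i \<in> I\<close> and zero rows
  elsewhere has a zero row at \<open>k\<close>, so it is not surjective and therefore has a
  kernel.\<close>

lemma exists_orthogonal_vector:
  fixes u :: "'n::finite \<Rightarrow> complex ^ 'n"
  assumes "k \<notin> I"
  obtains x where "x \<noteq> 0" "\<And>i. i \<in> I \<Longrightarrow> cinner (u i) x = 0"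
proof -
  define B :: "'n cmat" where "B = (\<chi> i j. if i \<in> I then cnj (u i $ j) else 0)"
  have Bi: "(B *v x) $ i = (if i \<in> I then cinner (u i) x else 0)" for x i
    by (simp add: B_def matrix_vector_mult_def cinner_def)
  have "\<not> invertible B"
  proof
    assume "invertible B"
    then have "surj ((*v) B)"
      by (simp add: invertible_right_inverse matrix_right_invertible_surjective)
    then obtain x where "B *v x = axis k 1" by (metis surjD)
    then have "(B *v x) $ k = 1" by (simp add: axis_def)
    then show False using Bi assms by simp
  qed
  then obtain x where x: "B *v x = 0" "x \<noteq> 0"
    by (auto simp: invertible_iff_kernel)
  show ?thesis
  proof (rule that[OF x(2)])
    fix i assume "i \<in> I"
    then show "cinner (u i) x = 0" using Bi[of x i] x(1) by simp
  qed
qed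

text \<open>The maximiser of the Rayleigh quotient on the orthogonal complement of the eigenvectors found
  so far is a further eigenvector.\<close>

lemma orthonormal_eigenvectors:
  fixes A :: "'n::finite cmat" and I :: "'n set"
  assumes A: "hermitian A"
  shows "\<exists>u d. (\<forall>i\<in>I. \<forall>j\<in>I. cinner (u i) (u j) = (if i = j then 1 else 0)) \<and>
    (\<forall>i\<in>I. A *v u i = (d i :: real) *\<^sub>R u i)"
using finite[of I] proof (induction I rule: finite_induct)
  case empty
  then show ?case by simp
next
  case (insert k I)
  then obtain u d where on: "\<And>i j. i \<in> I \<Longrightarrow> j \<in> I \<Longrightarrow> cinner (u i) (u j) = (if i = j then 1 else 0)"
    and ev: "\<And>i. i \<in> I \<Longrightarrow> A *v u i = (d i :: real) *\<^sub>R u i"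
    by blast
  define V where "V = {x. \<forall>i\<in>I. cinner (u i) x = 0}"
  have V: "x + y \<in> V" "r *\<^sub>R x \<in> V" if "x \<in> V" "y \<in> V" for x y and r :: real
    using that by (auto simp: V_def cinner_simps)
  have AV: "A *v x \<in> V" if "x \<in> V" for x
    using that ev by (auto simp: V_def hermitian_cinner[OF A, symmetric] cinner_simps)
  define q where "q y = Re (cinner y (A *v y))" for y
  have V_eq: "V = (\<Inter>i\<in>I. {x. cinner (u i) x = 0})"
    by (auto simp: V_def)
  have "closed V"
    unfolding V_eq by (intro closed_INT ballI closed_Collect_eq continuous_intros)
  then have comp: "compact (V \<inter> sphere 0 1)"
    by (intro closed_Int_compact compact_sphere)
  obtain x0 where x0: "x0 \<noteq> 0" "x0 \<in> V"
    by (rule exists_orthogonal_vector[OF \<open>k \<notin> I\<close>, of u]) (simp add: V_def)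
  have "(1 / norm x0) *\<^sub>R x0 \<in> V \<inter> sphere 0 1"
    using x0 V(2) by simp
  then have ne: "V \<inter> sphere 0 1 \<noteq> {}" by blast
  have cont: "continuous_on (V \<inter> sphere 0 1) q"
    unfolding q_def by (intro continuous_intros)
  obtain x where x: "x \<in> V" "norm x = 1" and max: "\<And>y. y \<in> V \<Longrightarrow> norm y = 1 \<Longrightarrow> q y \<le> q x"
    using continuous_attains_sup[OF comp ne cont] by auto
  define m where "m = q x"
  have qm: "q y \<le> m * (norm y)\<^sup>2" if "y \<in> V" for y
  proof (cases "y = 0")
    case True
    then show ?thesis by (simp add: q_def)
  next
    case False
    have "q ((1 / norm y) *\<^sub>R y) \<le> m"
      unfolding m_def using max[of "(1 / norm y) *\<^sub>R y"] V(2)[OF that] that False by simp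
    then show ?thesis
      using False by (simp add: q_def matrix_vector_scaleR cinner_simps field_simps power2_eq_square)
  qed
  define z where "z = A *v x - m *\<^sub>R x"
  have zV: "z \<in> V"
    using V(1)[OF AV[OF x(1)] V(2)[OF x(1) x(1), of "- m"]] by (simp add: z_def)
  define Q where "Q = m * (norm z)\<^sup>2 - q z"
  have Q: "0 \<le> Q" using qm[OF zV] by (simp add: Q_def)
  \<comment> \<open>The variation of the maximised quotient in the direction of the residual
    \<open>z\<close>: its first-order coefficient is \<open>- 2 * (norm z)\<^sup>2\<close>, so a
    maximum forces \<open>z = 0\<close>.\<close>
  have key: "0 \<le> - 2 * t * (norm z)\<^sup>2 + t\<^sup>2 * Q" for t :: real
  proof -
    have "x + t *\<^sub>R z \<in> V" using x zV V by auto
    then have "q (x + t *\<^sub>R z) \<le> m * (norm (x + t *\<^sub>R z))\<^sup>2" by (rule qm)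
    moreover have "q (x + t *\<^sub>R z) = m + 2 * t * (z \<bullet> (A *v x)) + t\<^sup>2 * q z"
    proof -
      have "Re (cinner x (A *v z)) = z \<bullet> (A *v x)"
        by (metis A Re_cinner Re_cinner_commute hermitian_cinner)
      then show ?thesis
        by (simp add: q_def m_def cinner_simps matrix_vector_right_distrib matrix_vector_scaleR
            power2_eq_square Re_cinner[of z] algebra_simps)
    qed
    moreover have "(norm (x + t *\<^sub>R z))\<^sup>2 = 1 + 2 * t * (z \<bullet> x) + t\<^sup>2 * (norm z)\<^sup>2"
      using x(2) unfolding power2_norm_eq_inner norm_eq_1
      by (simp add: inner_simps power2_eq_square inner_commute algebra_simps)
    moreover have "z \<bullet> (A *v x) = (norm z)\<^sup>2 + m * (z \<bullet> x)"
      unfolding power2_norm_eq_inner by (simp add: z_def inner_simps)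
    ultimately show ?thesis by (simp add: Q_def algebra_simps)
  qed
  have "z = 0"
  proof (rule ccontr)
    assume "z \<noteq> 0"
    \<comment> \<open>Small enough for the linear term to dominate; the summand 1 keeps the
      denominator positive when \<open>Q = 0\<close>.\<close>
    define t where "t = (norm z)\<^sup>2 / (Q + 1)"
    have t: "0 < t" "t * Q \<le> (norm z)\<^sup>2"
      using \<open>z \<noteq> 0\<close> Q by (simp_all add: t_def field_simps)
    have "0 \<le> t * (t * Q - 2 * (norm z)\<^sup>2)"
      using key[of t] by (simp add: power2_eq_square algebra_simps)
    then have "2 * (norm z)\<^sup>2 \<le> t * Q"
      using t(1) by (simp add: zero_le_mult_iff)
    moreover have "0 < (norm z)\<^sup>2" using \<open>z \<noteq> 0\<close> by simp
    ultimately show False using t(2) by linarith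
  qed
  then have eig: "A *v x = m *\<^sub>R x" by (simp add: z_def)
  have xx: "cinner x x = 1" using x(2) by (simp add: cinner_self)
  have xu: "cinner (u i) x = 0" "cinner x (u i) = 0" if "i \<in> I" for i
    using x(1) that cnj_cinner[of "u i" x] by (auto simp: V_def)
  show ?case
    by (intro exI[of _ "u(k := x)"] exI[of _ "d(k := m)"])
       (use \<open>k \<notin> I\<close> on ev eig xx xu in auto)
qed

theorem hermitian_diagonalization:
  fixes A :: "'n::finite cmat"
  assumes "hermitian A"
  obtains U d where "unitary U" "A = U ** cdiag d ** madj U"
proof -
  obtain u d where on: "\<And>i j. cinner (u i) (u j) = (if i = j then 1 else 0)"
    and ev: "\<And>i :: 'n. A *v u i = (d i :: real) *\<^sub>R u i"
    using orthonormal_eigenvectors[OF assms, of UNIV] by auto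
  define U :: "'n cmat" where "U = (\<chi> i j. u j $ i)"
  have U: "unitary U"
    unfolding unitary_def vec_eq_iff
    using on by (simp add: matrix_matrix_mult_def madj_def U_def mat_def cinner_def)
  have "A ** U = U ** cdiag d"
  proof -
    have "(A ** U) $ i $ j = (A *v u j) $ i" for i j
      by (simp add: matrix_matrix_mult_def matrix_vector_mult_def U_def)
    moreover have "(U ** cdiag d) $ i $ j = (d j *\<^sub>R u j) $ i" for i j
    proof -
      have "(U ** cdiag d) $ i $ j = (\<Sum>k\<in>UNIV. if k = j then u j $ i * of_real (d j) else 0)"
        unfolding matrix_matrix_mult_def U_def cdiag_def vec_lambda_beta by (rule sum.cong) auto
      then show ?thesis by (simp add: scaleR_conv_of_real[where 'a=complex])
    qed
    ultimately show ?thesis by (simp add: vec_eq_iff ev)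
  qed
  then have "A = U ** cdiag d ** madj U"
    using unitaryD(2)[OF U] by (metis matrix_mul_assoc matrix_mul_rid)
  with U show ?thesis by (rule that)
qed

lemma diagonalization_eigenvalue:
  assumes "unitary U" "A = U ** cdiag d ** madj U"
  shows "A *v (U *v axis i 1) = d i *\<^sub>R (U *v axis i 1)" "norm (U *v axis i 1) = 1"
proof -
  have "cdiag d *v axis i 1 = d i *\<^sub>R axis i 1"
    by (auto simp: vec_eq_iff cdiag_vec axis_def scaleR_conv_of_real[where 'a=complex])
  then show "A *v (U *v axis i 1) = d i *\<^sub>R (U *v axis i 1)"
    unfolding assms(2)
    by (simp add: matrix_vector_mul_assoc[symmetric] unitary_cancel[OF assms(1)] matrix_vector_scaleR)
  show "norm (U *v axis i 1) = 1"
    by (simp add: unitary_norm[OF assms(1)] norm_eq_sqrt_cinner[of "axis i 1"] cinner_axis)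
qed

lemma det_diagonalization:
  assumes "unitary U" shows "det (U ** cdiag d ** madj U) = of_real (\<Prod>i\<in>UNIV. d i)"
proof -
  have "det U * det (madj U) = 1"
    using unitaryD(2)[OF assms] by (metis det_I det_mul)
  then show ?thesis
    by (simp add: det_mul det_cdiag mult_ac)
qed

lemma psd_eigenvalue_nonneg:
  assumes "psd A" "unitary U" "A = U ** cdiag d ** madj U" shows "0 \<le> d i"
  using psdD[OF assms(1), of "U *v axis i 1"] diagonalization_eigenvalue[OF assms(2,3), of i]
  by (simp add: cinner_simps cinner_self)

lemma posdefD: "posdef A \<Longrightarrow> x \<noteq> 0 \<Longrightarrow> 0 < Re (cinner x (A *v x))"
  by (simp add: posdef_def cquad_eq)

lemma posdef_psd: "posdef A \<Longrightarrow> psd A"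
  unfolding posdef_def psd_def cquad_eq using less_imp_le by (metis cinner_zero(1) order.refl zero_complex.sel(1))

lemma posdef_eigenvalue_pos:
  assumes "posdef A" "unitary U" "A = U ** cdiag d ** madj U" shows "0 < d i"
proof -
  have "U *v axis i 1 \<noteq> 0"
    using diagonalization_eigenvalue(2)[OF assms(2,3), of i] by auto
  then show ?thesis
  using posdefD[OF assms(1), of "U *v axis i 1"] diagonalization_eigenvalue[OF assms(2,3), of i]
  by (simp add: cinner_simps cinner_self)
qed

lemma posdef_det_pos: "posdef A \<Longrightarrow> 0 < Re (det A)"
proof -
  assume A: "posdef A"
  then obtain U d where U: "unitary U" "A = U ** cdiag d ** madj U"
    using hermitian_diagonalization unfolding posdef_def by metis
  then show ?thesis
    using posdef_eigenvalue_pos[OF A U] by (simp add: det_diagonalization prod_pos del: of_real_prod)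
qed

lemma posdef_invertible: "posdef A \<Longrightarrow> invertible A"
  using posdefD[of A] unfolding invertible_iff_kernel by fastforce

section \<open>Square roots\<close>

lemma psd_sqrt_exists:
  assumes "psd A" obtains s where "psd s" "s ** s = A"
proof -
  obtain U d where U: "unitary U" "A = U ** cdiag d ** madj U"
    using hermitian_diagonalization[OF psd_hermitian[OF assms]] by metis
  have d: "0 \<le> d i" for i by (rule psd_eigenvalue_nonneg[OF assms U])
  define s where "s = U ** cdiag (\<lambda>i. sqrt (d i)) ** madj U"
  have "psd s"
    unfolding s_def by (intro psd_congruence psd_cdiag) (simp add: d)
  moreover have "s ** s = A"
  proof -
    have "s ** s = U ** cdiag (\<lambda>i. sqrt (d i)) ** (madj U ** U) ** cdiag (\<lambda>i. sqrt (d i)) ** madj U"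
      by (simp add: s_def matrix_mul_assoc)
    also have "\<dots> = U ** (cdiag (\<lambda>i. sqrt (d i)) ** cdiag (\<lambda>i. sqrt (d i))) ** madj U"
      by (simp only: unitaryD[OF U(1)] matrix_mul_rid matrix_mul_assoc)
    also have "\<dots> = A" using d by (simp add: cdiag_mult U(2))
    finally show ?thesis .
  qed
  ultimately show ?thesis by (rule that)
qed

text \<open>An eigenvector \<open>x\<close> of \<open>s - t\<close> with eigenvalue \<open>\<mu> \<noteq> 0\<close> would satisfy
  \<open>0 = \<langle>x, (s\<^sup>2 - t\<^sup>2) x\<rangle> = \<mu> \<langle>x, (s + t) x\<rangle>\<close>, hence \<open>s x = t x = 0\<close>.\<close>

lemma psd_sqrt_unique:
  assumes s: "psd s" and t: "psd t" and eq: "s ** s = t ** t"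
  shows "s = t"
proof -
  have h: "hermitian (s - t)"
    using s t by (simp add: hermitian_def madj_diff psd_madj)
  obtain U d where U: "unitary U" "s - t = U ** cdiag d ** madj U"
    using hermitian_diagonalization[OF h] by metis
  have "d i = 0" for i
  proof (rule ccontr)
    assume nz: "d i \<noteq> 0"
    define x where "x = U *v axis i 1"
    have x: "s *v x - t *v x = d i *\<^sub>R x" "norm x = 1"
      using diagonalization_eigenvalue[OF U, of i] by (simp_all add: x_def matrix_vector_mult_diff_rdistrib)
    have "s ** (s - t) + (s - t) ** t = 0"
      by (simp add: matrix_distribs eq)
    then have "cinner x ((s ** (s - t) + (s - t) ** t) *v x) = 0" by simp
    then have "cinner (s *v x) ((s - t) *v x) + cinner ((s - t) *v x) (t *v x) = 0"
      by (simp add: matrix_vector_mult_add_rdistrib cinner_simps hermitian_cinner[OF h]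
           hermitian_cinner[OF psd_hermitian[OF s]] matrix_vector_mul_assoc)
    then have "of_real (d i) * (cinner (s *v x) x + cinner x (t *v x)) = 0"
      by (simp add: matrix_vector_mult_diff_rdistrib x cinner_simps algebra_simps)
    then have "Re (cinner (s *v x) x + cinner x (t *v x)) = 0" using nz by simp
    then have "Re (cinner x (s *v x)) + Re (cinner x (t *v x)) = 0"
      by (simp add: Re_cinner_commute)
    then have "Re (cinner x (s *v x)) = 0" "Re (cinner x (t *v x)) = 0"
      using psdD[OF s, of x] psdD[OF t, of x] by linarith+
    then have "s *v x = 0" "t *v x = 0"
      using psd_kernel s t by blast+
    then show False using x nz by auto
  qed
  then have "d = (\<lambda>i. 0)" by auto
  then have "cdiag d = 0" by (simp add: cdiag_def vec_eq_iff)
  then have "s - t = 0" using U(2) by (simp add: matrix_matrix_mult_def vec_eq_iff)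
  then show ?thesis by simp
qed

lemma psd_sqrt_eqI: "psd s \<Longrightarrow> s ** s = A \<Longrightarrow> psd_sqrt A = s"
  unfolding psd_sqrt_def using psd_sqrt_unique by (intro the_equality) auto

lemma psd_psd_sqrt: "psd A \<Longrightarrow> psd (psd_sqrt A)"
  and psd_sqrt_square: "psd A \<Longrightarrow> psd_sqrt A ** psd_sqrt A = A"
  using psd_sqrt_exists psd_sqrt_eqI by metis+

lemma psd_sqrt_of_square: "psd s \<Longrightarrow> psd_sqrt (s ** s) = s"
  by (simp add: psd_sqrt_eqI)

section \<open>Continuity of the square root\<close>

lemma norm_matrix_square: "(norm A)\<^sup>2 = Re (trace (madj A ** A))" for A :: "'n::finite cmat"
proof -
  have "(norm A)\<^sup>2 = (\<Sum>i\<in>UNIV. \<Sum>j\<in>UNIV. (cmod (A $ i $ j))\<^sup>2)"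
    by (simp add: norm_vec_def L2_set_def sum_nonneg)
  also have "\<dots> = (\<Sum>j\<in>UNIV. \<Sum>i\<in>UNIV. (cmod (A $ i $ j))\<^sup>2)"
    by (rule sum.swap)
  also have "\<dots> = Re (\<Sum>j\<in>UNIV. \<Sum>i\<in>UNIV. of_real ((cmod (A $ i $ j))\<^sup>2))"
    by simp
  also have "\<dots> = Re (trace (madj A ** A))"
    by (simp only: complex_norm_square trace_def matrix_matrix_mult_def madj_def vec_lambda_beta mult.commute)
  finally show ?thesis .
qed

text \<open>The squared norm of the root is the trace of \<open>A\<close>, a sum of
  \<open>CARD('n)\<close> diagonal entries. The bound keeps the roots of a bounded set in a compact
  set.\<close>

lemma psd_sqrt_norm_le:
  assumes "psd A" shows "(norm (psd_sqrt A))\<^sup>2 \<le> real CARD('n) * norm (A :: 'n::finite cmat)"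
proof -
  have "(norm (psd_sqrt A))\<^sup>2 = Re (trace A)"
    using assms by (simp add: norm_matrix_square psd_madj psd_psd_sqrt psd_sqrt_square)
  also have "\<dots> = (\<Sum>i\<in>UNIV. Re (A $ i $ i))" by (simp add: trace_def)
  also have "\<dots> \<le> (\<Sum>i\<in>(UNIV :: 'n set). norm A)"
  proof (rule sum_mono)
    fix i
    have "Re (A $ i $ i) \<le> cmod (A $ i $ i)" by (rule complex_Re_le_cmod)
    also have "\<dots> \<le> norm (A $ i)" by (rule Finite_Cartesian_Product.norm_nth_le)
    also have "\<dots> \<le> norm A" by (rule Finite_Cartesian_Product.norm_nth_le)
    finally show "Re (A $ i $ i) \<le> norm A" .
  qed
  finally show ?thesis by simp
qed

text \<open>On a compact part \<open>K\<close> of the cone, squaring is a continuous injection, so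
  its inverse is continuous on the image. A convergent sequence and its limit are bounded and hence
  lie in one such image.\<close>

lemma psd_sqrt_continuous: "continuous_on (PiCone :: 'n::finite cmat set) psd_sqrt"
  unfolding continuous_on_sequentially
proof (intro allI ballI impI, elim conjE)
  fix X :: "nat \<Rightarrow> 'n cmat" and a
  assume a: "a \<in> PiCone" and XP: "\<forall>n. X n \<in> PiCone" and lim: "X \<longlonglongrightarrow> a"
  obtain B where B: "\<And>n. norm (X n) \<le> B"
    using convergent_imp_Bseq[OF convergentI[OF lim]] unfolding Bseq_def by blast
  have aB: "norm a \<le> B"
    using tendsto_norm[OF lim] B by (intro LIMSEQ_le_const2[of "\<lambda>n. norm (X n)"]) auto
  define R where "R = sqrt (real CARD('n) * B)"
  define K where "K = (PiCone :: 'n cmat set) \<inter> cball 0 R"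
  have "compact K"
    unfolding K_def by (intro closed_Int_compact closed_PiCone compact_cball)
  then have cont: "continuous_on ((\<lambda>s. s ** s) ` K) psd_sqrt"
    by (intro continuous_on_inv ballI) (auto intro!: continuous_intros simp: K_def PiCone_def psd_sqrt_of_square)
  have mem: "y \<in> (\<lambda>s. s ** s) ` K" if "y \<in> PiCone" "norm y \<le> B" for y
  proof
    have y: "psd y" using that by (simp add: PiCone_def)
    show "y = psd_sqrt y ** psd_sqrt y" by (simp add: psd_sqrt_square y)
    have "(norm (psd_sqrt y))\<^sup>2 \<le> real CARD('n) * B"
      using psd_sqrt_norm_le[OF y] mult_left_mono[OF that(2), of "real CARD('n)"] by linarith
    then have "norm (psd_sqrt y) \<le> R"
      unfolding R_def by (rule real_le_rsqrt)
    then show "psd_sqrt y \<in> K" by (simp add: K_def PiCone_def psd_psd_sqrt y)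
  qed
  show "(psd_sqrt \<circ> X) \<longlonglongrightarrow> psd_sqrt a"
    using cont[unfolded continuous_on_sequentially, rule_format, of a X] mem a XP aB B lim by auto
qed

section \<open>Invariance of Lebesgue measure\<close>

lemma nn_integral_lborel_translate:
  fixes h :: "'a::euclidean_space \<Rightarrow> ennreal"
  assumes [measurable]: "h \<in> borel_measurable borel"
  shows "(\<integral>\<^sup>+x. h (x + c) \<partial>lborel) = (\<integral>\<^sup>+x. h x \<partial>lborel)"
proof -
  have "(\<integral>\<^sup>+x. h x \<partial>lborel) = (\<integral>\<^sup>+x. h x \<partial>distr lborel borel ((+) c))"
    by (simp add: lborel_distr_plus)
  also have "\<dots> = (\<integral>\<^sup>+x. h (c + x) \<partial>lborel)"
    by (subst nn_integral_distr) auto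
  finally show ?thesis by (simp add: add.commute)
qed

lemma nn_integral_lborel_scale:
  fixes h :: "'a::euclidean_space \<Rightarrow> ennreal"
  assumes [measurable]: "h \<in> borel_measurable borel" and "0 < c"
  shows "(\<integral>\<^sup>+x. h x \<partial>lborel) = ennreal (c ^ DIM('a)) * (\<integral>\<^sup>+x. h (c *\<^sub>R x) \<partial>lborel)"
  using assms(2)
  by (subst lborel_affine[of c 0])
     (simp_all add: nn_integral_density nn_integral_distr nn_integral_cmult)

lemma emeasure_lborel_cball_nonzero: "0 < r \<Longrightarrow> emeasure lborel (cball (c :: 'a::euclidean_space) r) \<noteq> 0"
  by (simp add: emeasure_cball unit_ball_vol_pos less_imp_neq[symmetric])

text \<open>Uniqueness of Haar measure: evaluating \<open>\<integral>\<integral> 1\<^sub>A(f y) 1\<^sub>B(x - f y) dy dx\<close> in both orders, with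
  \<open>B\<close> the unit ball, which is invariant under \<open>f\<close>.\<close>

lemma orthogonal_transformation_lborel:
  fixes f :: "'a::euclidean_space \<Rightarrow> 'a"
  assumes f: "orthogonal_transformation f"
  shows "distr lborel borel f = lborel"
proof (rule measure_eqI)
  have lin: "linear f" using f by (rule orthogonal_transformation_linear)
  have [measurable]: "f \<in> borel_measurable borel"
    using linear_continuous_on[OF linear_conv_bounded_linear[THEN iffD1, OF lin]]
    by (rule borel_measurable_continuous_onI)
  obtain g where g: "\<And>x. f (g x) = x"
    using orthogonal_transformation_surj[OF f] by (metis surj_f_inv_f)
  define B where "B = cball (0::'a) 1"
  have [measurable]: "B \<in> sets borel" by (simp add: B_def)
  have Bf: "(\<integral>\<^sup>+x. indicator B x \<partial>lborel) = emeasure lborel B" by simp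
  have finB: "emeasure lborel B \<noteq> \<infinity>" 
    using emeasure_lborel_cball_finite[of "0::'a" 1] by (simp add: B_def)
  have posB: "emeasure lborel B \<noteq> 0"
    unfolding B_def by (rule emeasure_lborel_cball_nonzero) simp
  fix A assume "A \<in> sets (distr lborel borel f)"
  then have [measurable]: "A \<in> sets borel" by simp
  have "emeasure (distr lborel borel f) A * emeasure lborel B
      = (\<integral>\<^sup>+y. indicator A (f y) * (\<integral>\<^sup>+x. indicator B x \<partial>lborel) \<partial>lborel)"
  proof -
    have "emeasure (distr lborel borel f) A = (\<integral>\<^sup>+y. indicator A y \<partial>distr lborel borel f)" by simp
    also have "\<dots> = (\<integral>\<^sup>+y. indicator A (f y) \<partial>lborel)" by (rule nn_integral_distr) auto
    finally show ?thesis by (simp add: nn_integral_multc)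
  qed
  also have "\<dots> = (\<integral>\<^sup>+y. indicator A (f y) * (\<integral>\<^sup>+x. indicator B (x - f y) \<partial>lborel) \<partial>lborel)"
    using nn_integral_lborel_translate[of "indicator B" "- f _"] by simp
  also have "\<dots> = (\<integral>\<^sup>+y. \<integral>\<^sup>+x. indicator A (f y) * indicator B (x - f y) \<partial>lborel \<partial>lborel)"
    by (simp add: nn_integral_cmult)
  also have "\<dots> = (\<integral>\<^sup>+x. \<integral>\<^sup>+y. indicator A (f y) * indicator B (x - f y) \<partial>lborel \<partial>lborel)"
    by (rule lborel_pair.Fubini') measurable
  \<comment> \<open>Replacing \<open>y\<close> by \<open>y + g x\<close>, where
    \<open>f (g x) = x\<close>, frees the second factor from \<open>x\<close>; the integral over
    \<open>x\<close> is then a translate of the volume of \<open>A\<close>.\<close>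
  also have "\<dots> = (\<integral>\<^sup>+x. \<integral>\<^sup>+y. indicator A (f y + x) * indicator B (- f y) \<partial>lborel \<partial>lborel)"
  proof (rule nn_integral_cong)
    fix x
    have "(\<integral>\<^sup>+y. indicator A (f y) * indicator B (x - f y) \<partial>lborel)
      = (\<integral>\<^sup>+y. indicator A (f (y + g x)) * indicator B (x - f (y + g x)) \<partial>lborel)"
      by (rule nn_integral_lborel_translate[symmetric]) measurable
    then show "(\<integral>\<^sup>+y. indicator A (f y) * indicator B (x - f y) \<partial>lborel)
      = (\<integral>\<^sup>+y. indicator A (f y + x) * indicator B (- f y) \<partial>lborel)"
      by (simp add: linear_add[OF lin] g)
  qed
  also have "\<dots> = (\<integral>\<^sup>+y. \<integral>\<^sup>+x. indicator A (f y + x) * indicator B (- f y) \<partial>lborel \<partial>lborel)"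
    by (rule lborel_pair.Fubini') measurable
  also have "\<dots> = (\<integral>\<^sup>+y. (\<integral>\<^sup>+x. indicator A (x + f y) \<partial>lborel) * indicator B (- f y) \<partial>lborel)"
    by (simp add: nn_integral_multc add.commute)
  also have "\<dots> = (\<integral>\<^sup>+y. emeasure lborel A * indicator B y \<partial>lborel)"
    by (subst nn_integral_lborel_translate)
       (auto simp: B_def orthogonal_transformation_norm[OF f] indicator_def)
  also have "\<dots> = emeasure lborel A * emeasure lborel B"
    by (simp add: nn_integral_cmult)
  finally show "emeasure (distr lborel borel f) A = emeasure lborel A"
    using finB posB by (simp add: mult.commute[of _ "emeasure lborel B"] ennreal_mult_cancel_left)
qed simp

lemma orthogonal_transformation_unitary_mult:
  fixes U V :: "'n::finite cmat"
  assumes "unitary U" "unitary V"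
  shows "orthogonal_transformation (\<lambda>v. U ** v ** V)"
  unfolding orthogonal_transformation
proof (intro conjI allI)
  show "linear (\<lambda>v. U ** v ** V)"
    by (rule linearI) (simp_all only: matrix_distribs)
  fix v
  have "trace (madj (U ** v ** V) ** (U ** v ** V)) = trace (madj V ** (madj v ** (madj U ** U) ** v ** V))"
    by (simp add: madj_simps matrix_mul_assoc)
  also have "\<dots> = trace (madj v ** v ** (V ** madj V))"
    by (subst trace_mul_sym) (simp add: unitaryD[OF assms(1)] matrix_mul_assoc)
  also have "\<dots> = trace (madj v ** v)" by (simp add: unitaryD[OF assms(2)])
  finally have "(norm (U ** v ** V))\<^sup>2 = (norm v)\<^sup>2" by (simp add: norm_matrix_square)
  then show "norm (U ** v ** V) = norm v" by (simp add: power2_eq_iff_nonneg)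
qed

lemma orthogonal_transformation_unitary_vec:
  "unitary U \<Longrightarrow> orthogonal_transformation (\<lambda>x. U *v x)"
  unfolding orthogonal_transformation
  by (auto simp: unitary_norm intro!: linearI simp: matrix_vector_right_distrib matrix_vector_scaleR)

lemma orthogonal_transformation_madj: "orthogonal_transformation (madj :: 'n::finite cmat \<Rightarrow> 'n cmat)"
  unfolding orthogonal_transformation
proof (intro conjI allI)
  fix v :: "'n cmat"
  have "(norm (madj v))\<^sup>2 = (norm v)\<^sup>2" 
    unfolding norm_matrix_square madj_madj by (metis trace_mul_sym)
  then show "norm (madj v) = norm v" by (simp add: power2_eq_iff_nonneg)
qed (rule linearI; simp add: madj_simps)

section \<open>The unit ball\<close>

lemma quadratic_1_minus: "cinner x ((mat 1 - madj v ** v) *v x) = of_real ((norm x)\<^sup>2 - (norm (v *v x))\<^sup>2)"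
proof -
  have "cinner x ((mat 1 - madj v ** v) *v x) = cinner x x - cinner (v *v x) (v *v x)"
    by (simp add: matrix_vector_mult_diff_rdistrib cinner_simps cinner_adjoint flip: matrix_vector_mul_assoc)
  then show ?thesis by (simp add: cinner_self)
qed

lemma Dball_iff: "v \<in> Dball \<longleftrightarrow> (\<forall>x. x \<noteq> 0 \<longrightarrow> norm (v *v x) < norm x)"
proof -
  have "hermitian (mat 1 - madj v ** v)" by (simp add: hermitian_def madj_simps)
  moreover have "0 < (norm x)\<^sup>2 - (norm (v *v x))\<^sup>2 \<longleftrightarrow> norm (v *v x) < norm x" for x
    by (metis diff_gt_0_iff_gt norm_ge_zero power2_less_imp_less power_strict_mono pos2)
  ultimately show ?thesis
    by (simp only: Dball_def posdef_def cquad_eq quadratic_1_minus Re_complex_of_real mem_Collect_eq simp_thms)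
qed

text \<open>For \<open>y = madj v *v x\<close> the identity
  \<open>(norm y)\<^sup>2 = \<langle>x, v y\<rangle>\<close> carries the strict bound on
  \<open>v\<close> over to its adjoint. It reconciles \<open>madj v ** v\<close> in the ball with
  \<open>v ** madj v\<close> in the weight.\<close>

lemma Dball_madj: "v \<in> Dball \<Longrightarrow> madj v \<in> Dball"
  unfolding Dball_iff
proof (intro allI impI)
  fix x :: "complex ^ 'a" assume v: "\<forall>x. x \<noteq> 0 \<longrightarrow> norm (v *v x) < norm x" and x: "x \<noteq> 0"
  define y where "y = madj v *v x"
  show "norm (madj v *v x) < norm x"
  proof (cases "y = 0")
    case True then show ?thesis using x by (simp add: y_def)
  next
    case False
    have "(norm y)\<^sup>2 = Re (cinner y y)" by (simp add: cinner_self)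
    also have "\<dots> = Re (cinner x (v *v y))" by (simp add: y_def cinner_adjoint)
    also have "\<dots> \<le> norm x * norm (v *v y)"
      using cinner_Cauchy_Schwarz[of x "v *v y"] complex_Re_le_cmod order_trans by blast
    also have "\<dots> < norm x * norm y" using v x False by simp
    finally show ?thesis using False by (simp add: y_def power2_eq_square)
  qed
qed

lemma Dball_madj_iff [simp]: "madj v \<in> Dball \<longleftrightarrow> v \<in> Dball"
  using Dball_madj[of v] Dball_madj[of "madj v"] by auto

lemma Dball_iff_posdef: "v \<in> Dball \<longleftrightarrow> posdef (mat 1 - v ** madj v)"
  using Dball_madj_iff[of v] by (simp add: Dball_def)

definition weight :: "'n::finite cmat \<Rightarrow> real" where
  "weight v = Re (det (mat 1 - v ** madj v))"

lemma weight_pos: "v \<in> Dball \<Longrightarrow> 0 < weight v"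
  by (simp add: weight_def Dball_iff_posdef posdef_det_pos)

lemma continuous_on_weight: "continuous_on S weight"
  unfolding weight_def by (intro continuous_intros)

text \<open>Failure of strict contraction is witnessed by a unit vector, and along a convergent
  sequence of matrices the witnesses accumulate on the compact sphere.\<close>

lemma open_Dball: "open (Dball :: 'n::finite cmat set)"
proof -
  have "closed (- Dball :: 'n cmat set)"
    unfolding closed_sequential_limits
  proof (intro allI impI, elim conjE)
    fix V :: "nat \<Rightarrow> 'n cmat" and l
    assume V: "\<forall>n. V n \<in> - Dball" and lim: "V \<longlonglongrightarrow> l"
    have "\<exists>x. norm x = 1 \<and> 1 \<le> norm (V n *v x)" for n
    proof -
      obtain x where x: "x \<noteq> 0" "norm x \<le> norm (V n *v x)"
        using V unfolding Compl_iff Dball_iff by (auto simp: not_less)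
      then show ?thesis
        by (intro exI[of _ "(1 / norm x) *\<^sub>R x"]) (simp add: matrix_vector_scaleR field_simps)
    qed
    then obtain X where X: "\<And>n. norm (X n) = 1" "\<And>n. 1 \<le> norm (V n *v X n)" by metis
    have "\<forall>n. X n \<in> sphere 0 1" using X by simp
    then obtain x r where x: "x \<in> sphere 0 1" "strict_mono r" "(X \<circ> r) \<longlonglongrightarrow> x"
      using compact_sphere[of "0 :: complex ^ 'n" 1] unfolding compact_def by metis
    have "(\<lambda>n. norm (V (r n) *v X (r n))) \<longlonglongrightarrow> norm (l *v x)"
      using x(3) LIMSEQ_subseq_LIMSEQ[OF lim x(2)] unfolding o_def matrix_vector_mult_def
      by (intro tendsto_intros)
    then have "1 \<le> norm (l *v x)" by (rule LIMSEQ_le_const) (use X in auto)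
    then show "l \<in> - Dball"
      using x(1) unfolding Compl_iff Dball_iff by (auto simp: not_less intro!: exI[of _ x])
  qed
  then show ?thesis by (simp add: open_closed)
qed

lemma vec_axis_nth: "(v *v axis j 1) $ i = v $ i $ j" for v :: "'n::finite cmat"
proof -
  have "(v *v axis j 1) $ i = (\<Sum>k\<in>UNIV. if k = j then v $ i $ j else 0)"
    unfolding matrix_vector_mult_def vec_lambda_beta by (rule sum.cong) (auto simp: axis_def)
  then show ?thesis by simp
qed

lemma cmod_nth_le_column: "cmod (v $ i $ j) \<le> norm (v *v axis j 1)" for v :: "'n::finite cmat"
  using Finite_Cartesian_Product.norm_nth_le[of "v *v axis j 1" i] by (simp add: vec_axis_nth)

lemma norm_matrix_le:
  fixes v :: "'n::finite cmat"
  assumes "\<And>i j. cmod (v $ i $ j) \<le> 1" shows "norm v \<le> real CARD('n) * real CARD('n)"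
proof -
  have "norm v \<le> (\<Sum>i\<in>UNIV. norm (v $ i))"
    unfolding norm_vec_def by (rule L2_set_le_sum) simp
  also have "\<dots> \<le> (\<Sum>i\<in>UNIV. \<Sum>j\<in>UNIV. cmod (v $ i $ j))"
    unfolding norm_vec_def[of "v $ _"] by (intro sum_mono L2_set_le_sum) simp
  also have "\<dots> \<le> (\<Sum>i\<in>(UNIV::'n set). \<Sum>j\<in>(UNIV::'n set). 1)"
    by (intro sum_mono assms)
  finally show ?thesis by simp
qed

lemma norm_axis_1: "norm (axis i 1 :: complex ^ 'n::finite) = 1"
  by (simp add: norm_eq_sqrt_cinner cinner_axis)

lemma Dball_entry: "v \<in> Dball \<Longrightarrow> cmod (v $ i $ j) \<le> 1"
  using cmod_nth_le_column[of v i j] norm_axis_1[of j] unfolding Dball_iff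
  by (metis (no_types) less_eq_real_def norm_zero order_trans zero_neq_one)

section \<open>Integrability of the weight\<close>

text \<open>The matrix factors as \<open>s ** (mat 1 - outer z z) ** s\<close>. The eigenvalues
  \<open>d i\<close> of \<open>outer z z\<close> lie in [0, 1] and sum to its trace
  \<open>(norm z)\<^sup>2\<close>; the Weierstrass inequality bounds the product of the
  \<open>1 - d i\<close> below without locating the single nonzero eigenvalue.\<close>

lemma Re_det_outer_ge:
  fixes s :: "'n::finite cmat"
  assumes "psd s" "norm z \<le> 1"
  shows "Re (det (s ** s)) * (1 - (norm z)\<^sup>2) \<le> Re (det (s ** s - outer (s *v z) (s *v z)))"
proof -
  have h: "hermitian (outer z z)" using psd_outer psd_hermitian by blast
  obtain U d where U: "unitary U" "outer z z = U ** cdiag d ** madj U"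
    using hermitian_diagonalization[OF h] by metis
  have d: "0 \<le> d i" for i by (rule psd_eigenvalue_nonneg[OF psd_outer U])
  have tr: "(\<Sum>i\<in>UNIV. d i) = (norm z)\<^sup>2"
  proof -
    have "trace (U ** cdiag d ** madj U) = trace (cdiag d)"
      by (subst trace_mul_sym) (simp add: matrix_mul_assoc unitaryD[OF U(1)])
    also have "\<dots> = of_real (\<Sum>i\<in>UNIV. d i)" by (simp add: trace_def cdiag_def)
    finally have "of_real (\<Sum>i\<in>UNIV. d i) = trace (outer z z)" using U(2) by simp
    also have "\<dots> = cinner z z" by (simp add: trace_def outer_def cinner_def mult.commute)
    also have "\<dots> = of_real ((norm z)\<^sup>2)" by (rule cinner_self)
    finally show ?thesis using of_real_eq_iff by blast
  qed
  have le1: "d i \<le> 1" for i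
  proof -
    have "d i \<le> (\<Sum>i\<in>UNIV. d i)" using d by (intro member_le_sum) auto
    also have "\<dots> \<le> 1" unfolding tr using assms(2) by (simp add: power_le_one)
    finally show ?thesis .
  qed
  have "mat 1 - outer z z = U ** cdiag (\<lambda>i. 1 - d i) ** madj U"
  proof -
    have "cdiag (\<lambda>i. 1 - d i) = mat 1 - cdiag d"
      by (auto simp: cdiag_def mat_def vec_eq_iff)
    then show ?thesis using U by (simp add: matrix_distribs unitaryD)
  qed
  then have det1: "det (mat 1 - outer z z) = of_real (\<Prod>i\<in>UNIV. 1 - d i)"
    using det_diagonalization[OF U(1), of "\<lambda>i. 1 - d i"] by simp
  have "s ** s - outer (s *v z) (s *v z) = s ** (mat 1 - outer z z) ** s"
    using outer_congruence[of s z z s] psd_madj[OF assms(1)] by (simp add: matrix_distribs)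
  then have "det (s ** s - outer (s *v z) (s *v z)) = det (s ** s) * of_real (\<Prod>i\<in>UNIV. 1 - d i)"
    by (simp add: det_mul det1 mult_ac del: of_real_prod)
  then have eq: "Re (det (s ** s - outer (s *v z) (s *v z))) = Re (det (s ** s)) * (\<Prod>i\<in>UNIV. 1 - d i)"
    by (simp del: of_real_prod)
  have "1 - (\<Sum>i\<in>UNIV. d i) \<le> (\<Prod>i\<in>UNIV. 1 - d i)"
    by (rule Weierstrass_prod_ineq) (use d le1 in auto)
  moreover have "0 \<le> Re (det (s ** s))"
  proof -
    obtain U d where U: "unitary U" "s ** s = U ** cdiag d ** madj U"
      using hermitian_diagonalization[OF psd_hermitian[OF psd_square_self[OF assms(1)]]] by metis
    then show ?thesis
      using psd_eigenvalue_nonneg[OF psd_square_self[OF assms(1)] U]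
      by (simp add: det_diagonalization prod_nonneg del: of_real_prod)
  qed
  ultimately show ?thesis unfolding eq tr by (intro mult_left_mono) auto
qed

section \<open>Volume of the set of admissible columns\<close>

lemma prod_Basis_vec:
  "(\<Prod>k\<in>(Basis :: (complex ^ 'n::finite) set). f k) = (\<Prod>i\<in>UNIV. f (axis i 1) * f (axis i \<i>))"
proof -
  have "(\<Prod>k\<in>(Basis :: (complex ^ 'n) set). f k) = (\<Prod>k\<in>(\<Union>i\<in>UNIV. {axis i 1, axis i \<i>}). f k)"
    by (rule prod.cong) (auto simp: Basis_vec_def Basis_complex_def)
  also have "\<dots> = (\<Prod>i\<in>UNIV. \<Prod>k\<in>{axis i 1, axis i \<i>}. f k)"
    by (rule prod.UNION_disjoint) (auto simp: axis_eq_axis)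
  also have "\<dots> = (\<Prod>i\<in>UNIV. f (axis i 1) * f (axis i \<i>))"
    by (rule prod.cong) (auto simp: axis_eq_axis)
  finally show ?thesis .
qed

text \<open>Each complex coordinate contributes a square of side \<open>2 * d i\<close>, that is,
  area \<open>4 * (d i)\<^sup>2\<close>.\<close>

lemma emeasure_cbox_complex_vec:
  fixes d :: "'n::finite \<Rightarrow> real"
  assumes "\<And>i. 0 \<le> d i"
  defines "b \<equiv> (\<chi> i. Complex (d i) (d i))"
  shows "emeasure lborel (cbox (- b) b) = ennreal (4 ^ CARD('n) * (\<Prod>i\<in>UNIV. (d i)\<^sup>2))"
proof -
  have b: "b \<bullet> axis i 1 = d i" "b \<bullet> axis i \<i> = d i" for i
    by (simp_all add: b_def inner_axis inner_complex_def)
  have le: "(- b) \<bullet> k \<le> b \<bullet> k" if "k \<in> Basis" for k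
    using that assms(1) b by (auto simp: Basis_vec_def Basis_complex_def)
  have "emeasure lborel (cbox (- b) b) = ennreal (\<Prod>k\<in>Basis. (b - - b) \<bullet> k)"
    by (rule emeasure_lborel_cbox[OF le])
  also have "(\<Prod>k\<in>Basis. (b - - b) \<bullet> k) = (\<Prod>i\<in>(UNIV::'n set). 4 * (d i)\<^sup>2)"
    unfolding prod_Basis_vec
    by (simp only: inner_diff_left inner_minus_left b power2_eq_square) (simp add: algebra_simps)
  finally show ?thesis by (simp add: prod.distrib)
qed

text \<open>In an eigenbasis of \<open>N\<close>, positivity of \<open>N - outer x x\<close> forces
  the squared modulus of the i-th coordinate of \<open>x\<close> to be at most \<open>d i\<close>,
  so \<open>x\<close> lies in a box of volume proportional to the product of the \<open>d i\<close>.
  The point is the proportionality to \<open>det N\<close>, which later compensates a negative power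
  of \<open>det N\<close>.\<close>

lemma emeasure_posdef_outer_le:
  fixes N :: "'n::finite cmat"
  assumes N: "posdef N"
  shows "emeasure lborel {x. posdef (N - outer x x)} \<le> ennreal (4 ^ CARD('n) * Re (det N))"
proof -
  obtain U d where U: "unitary U" "N = U ** cdiag d ** madj U"
    using hermitian_diagonalization N unfolding posdef_def by metis
  have d: "0 < d i" for i by (rule posdef_eigenvalue_pos[OF N U])
  define b where "b = (\<chi> i. Complex (sqrt (d i)) (sqrt (d i)))"
  have sub: "{x. posdef (N - outer x x)} \<subseteq> (\<lambda>x. madj U *v x) -` cbox (- b) b"
  proof
    fix x assume "x \<in> {x. posdef (N - outer x x)}"
    then have pd: "posdef (N - outer x x)" by simp
    have "cmod ((madj U *v x) $ i) \<le> sqrt (d i)" for i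
    proof -
      let ?u = "U *v axis i 1"
      have u: "N *v ?u = d i *\<^sub>R ?u" "norm ?u = 1"
        using diagonalization_eigenvalue[OF U, of i] by auto
      have "?u \<noteq> 0" using u(2) by auto
      then have "0 < Re (cinner ?u ((N - outer x x) *v ?u))" by (rule posdefD[OF pd])
      also have "\<dots> = d i - (cmod (cinner x ?u))\<^sup>2"
        using u by (simp add: matrix_vector_mult_diff_rdistrib cinner_simps outer_quadratic[of ?u] cinner_self)
      also have "cinner x ?u = cnj ((madj U *v x) $ i)"
        by (metis cinner_adjoint cinner_axis cnj_cinner)
      finally show ?thesis by (simp add: real_le_rsqrt)
    qed
    then have "\<bar>Re ((madj U *v x) $ i)\<bar> \<le> sqrt (d i)" "\<bar>Im ((madj U *v x) $ i)\<bar> \<le> sqrt (d i)" for i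
      using abs_Re_le_cmod abs_Im_le_cmod order_trans by blast+
    then have "madj U *v x \<in> cbox (- b) b"
      by (auto simp: mem_box Basis_vec_def Basis_complex_def b_def inner_axis inner_complex_def abs_le_iff)
        (simp_all add: minus_le_iff)
    then show "x \<in> (\<lambda>x. madj U *v x) -` cbox (- b) b" by simp
  qed
  have meas: "(\<lambda>x. madj U *v x) \<in> borel_measurable borel"
    by (intro borel_measurable_continuous_onI continuous_intros)
  have "emeasure lborel {x. posdef (N - outer x x)} \<le> emeasure lborel ((\<lambda>x. madj U *v x) -` cbox (- b) b)"
    using measurable_sets_borel[OF meas, of "cbox (- b) b"] by (intro emeasure_mono[OF sub]) auto
  also have "\<dots> = emeasure (distr lborel borel (\<lambda>x. madj U *v x)) (cbox (- b) b)"
    using meas by (simp add: emeasure_distr)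
  also have "\<dots> = emeasure lborel (cbox (- b) b)"
    by (simp add: orthogonal_transformation_lborel orthogonal_transformation_unitary_vec unitary_madj U(1))
  also have "\<dots> = ennreal (4 ^ CARD('n) * (\<Prod>i\<in>UNIV. (sqrt (d i))\<^sup>2))"
    unfolding b_def by (rule emeasure_cbox_complex_vec) (simp add: d less_imp_le)
  also have "(\<Prod>i\<in>UNIV. (sqrt (d i))\<^sup>2) = Re (det N)"
    using d by (simp add: U det_diagonalization less_imp_le del: of_real_prod)
  finally show ?thesis .
qed

text \<open>The bound must not depend on \<open>c\<close>, which will be the value of a seminorm.
  For \<open>c \<le> 1/4\<close> the base stays above 1/2 because \<open>t \<le> 2\<close>;
  otherwise the substitution \<open>s = 1 - t c\<close> costs a factor \<open>1 / c < 4\<close> and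
  leaves the convergent integral of \<open>s powr \<alpha>\<close> over [0, 1].\<close>

lemma nn_integral_powr_line_le:
  fixes \<alpha> c :: real
  assumes \<alpha>: "-1 < \<alpha>" "\<alpha> < 0" and c: "0 \<le> c"
  shows "(\<integral>\<^sup>+t\<in>{1..2}. (if t * c < 1 then ennreal ((1 - t * c) powr \<alpha>) else 0) \<partial>lborel)
    \<le> ennreal ((1/2) powr \<alpha> + 4 / (\<alpha> + 1))"
proof (cases "c \<le> 1/4")
  case True
  have "(\<integral>\<^sup>+t\<in>{1..2}. (if t * c < 1 then ennreal ((1 - t * c) powr \<alpha>) else 0) \<partial>lborel)
      \<le> (\<integral>\<^sup>+t. ennreal ((1/2) powr \<alpha>) * indicator {1..2::real} t \<partial>lborel)"
  proof (rule nn_integral_mono)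
    fix t :: real
    have "(1 - t * c) powr \<alpha> \<le> (1/2) powr \<alpha>" if "1 \<le> t" "t \<le> 2"
    proof -
      have "t * c \<le> 2 * (1/4)" using that True c by (intro mult_mono) auto
      then show ?thesis using \<alpha> by (intro powr_mono2') auto
    qed
    then show "(if t * c < 1 then ennreal ((1 - t * c) powr \<alpha>) else 0) * indicator {1..2} t
        \<le> ennreal ((1/2) powr \<alpha>) * indicator {1..2} t"
      by (auto simp: indicator_def ennreal_leI)
  qed
  also have "\<dots> = ennreal ((1/2) powr \<alpha>)" by (simp add: nn_integral_cmult)
  also have "\<dots> \<le> ennreal ((1/2) powr \<alpha> + 4 / (\<alpha> + 1))" using \<alpha> by (intro ennreal_leI) simp
  finally show ?thesis .
next
  case False
  then have c4: "1/4 < c" by simp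
  define F where "F s = ennreal (s powr \<alpha>) * indicator {0..1} s" for s :: real
  have [measurable]: "F \<in> borel_measurable borel" unfolding F_def by measurable
  have F: "(\<integral>\<^sup>+s. F s \<partial>lborel) = ennreal (1 / (\<alpha> + 1))"
    using nn_integral_has_integral_lebesgue'[of "{0..1}" "\<lambda>s. s powr \<alpha>" "1 powr (\<alpha> + 1) / (\<alpha> + 1)"]
      has_integral_powr_from_0[of \<alpha> 1] \<alpha> unfolding F_def by simp
  have "(\<integral>\<^sup>+t\<in>{1..2}. (if t * c < 1 then ennreal ((1 - t * c) powr \<alpha>) else 0) \<partial>lborel)
      \<le> (\<integral>\<^sup>+t. F (1 + (- c) * t) \<partial>lborel)"
    by (intro nn_integral_mono) (use c in \<open>auto simp: F_def indicator_def mult.commute\<close>)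
  also have "\<dots> = ennreal (1 / c) * (ennreal \<bar>- c\<bar> * (\<integral>\<^sup>+t. F (1 + (- c) * t) \<partial>lborel))"
    using c4 by (simp add: mult.assoc[symmetric] ennreal_mult[symmetric])
  also have "\<dots> = ennreal (1 / c) * ennreal (1 / (\<alpha> + 1))"
    using c4 by (subst nn_integral_real_affine[symmetric]) (auto simp: F)
  also have "\<dots> = ennreal ((1 / c) * (1 / (\<alpha> + 1)))"
    using c4 \<alpha> by (simp add: ennreal_mult[symmetric])
  also have "\<dots> \<le> ennreal ((1/2) powr \<alpha> + 4 / (\<alpha> + 1))"
  proof (intro ennreal_leI)
    have "(1 / c) * (1 / (\<alpha> + 1)) \<le> 4 / (\<alpha> + 1)"
      using c4 \<alpha> mult_right_mono[of "1 / c" 4 "1 / (\<alpha> + 1)"] by (simp add: field_simps)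
    then show "(1 / c) * (1 / (\<alpha> + 1)) \<le> (1/2) powr \<alpha> + 4 / (\<alpha> + 1)"
      using powr_ge_zero[of "1/2" \<alpha>] by linarith
  qed
  finally show ?thesis .
qed

text \<open>Averaging \<open>\<integral> h(x) dx = t\<^sup>n \<integral> h(t x) dx\<close> over \<open>t \<in> [1, 2]\<close> reduces the singularity at the
  boundary of the ball of a seminorm to a one-dimensional integral.\<close>

lemma nn_integral_seminorm_ball_powr_le:
  fixes p :: "'a::euclidean_space \<Rightarrow> real"
  assumes \<alpha>: "-1 < \<alpha>" "\<alpha> < 0" and p: "\<And>x. 0 \<le> p x" "\<And>t x. 0 \<le> t \<Longrightarrow> p (t *\<^sub>R x) = t * p x"
    and [measurable]: "p \<in> borel_measurable borel"
  shows "(\<integral>\<^sup>+x. (if p x < 1 then ennreal ((1 - p x) powr \<alpha>) else 0) \<partial>lborel)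
    \<le> ennreal (2 ^ DIM('a) * ((1/2) powr \<alpha> + 4 / (\<alpha> + 1))) * emeasure lborel {x. p x < 1}"
proof -
  define C where "C = (1/2) powr \<alpha> + 4 / (\<alpha> + 1)"
  have C: "0 \<le> C" using \<alpha> by (simp add: C_def)
  define h where "h x = (if p x < 1 then ennreal ((1 - p x) powr \<alpha>) else 0)" for x
  have [measurable]: "h \<in> borel_measurable borel" unfolding h_def by measurable
  have "(\<integral>\<^sup>+x. h x \<partial>lborel) = (\<integral>\<^sup>+t. (\<integral>\<^sup>+x. h x \<partial>lborel) * indicator {1..2::real} t \<partial>lborel)"
    by (simp add: nn_integral_cmult)
  also have "\<dots> \<le> (\<integral>\<^sup>+t. (ennreal (2 ^ DIM('a)) * (\<integral>\<^sup>+x. h (t *\<^sub>R x) \<partial>lborel)) * indicator {1..2::real} t \<partial>lborel)"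
  proof (rule nn_integral_mono)
    fix t :: real
    have "(\<integral>\<^sup>+x. h x \<partial>lborel) \<le> ennreal (2 ^ DIM('a)) * (\<integral>\<^sup>+x. h (t *\<^sub>R x) \<partial>lborel)" if "1 \<le> t" "t \<le> 2"
      using that by (subst nn_integral_lborel_scale[of _ t]) (auto intro!: mult_right_mono ennreal_leI power_mono)
    then show "(\<integral>\<^sup>+x. h x \<partial>lborel) * indicator {1..2} t \<le>
        (ennreal (2 ^ DIM('a)) * (\<integral>\<^sup>+x. h (t *\<^sub>R x) \<partial>lborel)) * indicator {1..2} t"
      by (auto simp: indicator_def)
  qed
  also have "\<dots> = ennreal (2 ^ DIM('a)) * (\<integral>\<^sup>+t. \<integral>\<^sup>+x. h (t *\<^sub>R x) * indicator {1..2::real} t \<partial>lborel \<partial>lborel)"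
    by (simp add: nn_integral_cmult nn_integral_multc mult.assoc)
  also have "(\<integral>\<^sup>+t. \<integral>\<^sup>+x. h (t *\<^sub>R x) * indicator {1..2::real} t \<partial>lborel \<partial>lborel)
      = (\<integral>\<^sup>+x. \<integral>\<^sup>+t. h (t *\<^sub>R x) * indicator {1..2::real} t \<partial>lborel \<partial>lborel)"
    by (rule pair_sigma_finite.Fubini') (unfold_locales, measurable)
  \<comment> \<open>For \<open>p x \<ge> 1\<close> no \<open>t \<ge> 1\<close> contributes, so after
    averaging only the unit ball of \<open>p\<close> remains, with a uniform bound.\<close>
  also have "\<dots> \<le> (\<integral>\<^sup>+x. ennreal C * indicator {x. p x < 1} x \<partial>lborel)"
  proof (rule nn_integral_mono)
    fix x :: 'a
    show "(\<integral>\<^sup>+t. h (t *\<^sub>R x) * indicator {1..2::real} t \<partial>lborel) \<le> ennreal C * indicator {x. p x < 1} x"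
    proof (cases "p x < 1")
      case True
      have "(\<integral>\<^sup>+t. h (t *\<^sub>R x) * indicator {1..2::real} t \<partial>lborel) =
        (\<integral>\<^sup>+t\<in>{1..2}. (if t * p x < 1 then ennreal ((1 - t * p x) powr \<alpha>) else 0) \<partial>lborel)"
        by (intro nn_integral_cong) (auto simp: h_def p indicator_def)
      then show ?thesis
        using nn_integral_powr_line_le[OF \<alpha> p(1)[of x]] True by (simp add: C_def)
    next
      case False
      have "h (t *\<^sub>R x) * indicator {1..2::real} t = 0" for t
      proof (cases "1 \<le> t")
        case True
        have "1 * 1 \<le> t * p x" using True False by (intro mult_mono) auto
        then show ?thesis using True by (simp add: h_def p)
      qed (simp add: indicator_def)
      then have "(\<integral>\<^sup>+t. h (t *\<^sub>R x) * indicator {1..2::real} t \<partial>lborel) = 0" by (simp only: nn_integral_const mult_zero_left)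
      then show ?thesis by simp
    qed
  qed
  also have "\<dots> = ennreal C * emeasure lborel {x. p x < 1}"
    by (simp add: nn_integral_cmult)
  finally show ?thesis
    using C unfolding h_def C_def[symmetric] by (simp add: ennreal_mult mult.assoc mult_left_mono)
qed

lemma posdef_sqrt:
  assumes "posdef N"
  obtains s t where "psd s" "s ** s = N" "s ** t = mat 1" "t ** s = mat 1"
proof -
  define s where "s = psd_sqrt N"
  have s: "psd s" "s ** s = N"
    using posdef_psd[OF assms] by (simp_all add: s_def psd_psd_sqrt psd_sqrt_square)
  have "invertible s"
    unfolding invertible_iff_kernel
  proof (intro allI impI)
    fix x assume "s *v x = 0"
    then have "N *v x = 0" by (simp add: s(2)[symmetric] flip: matrix_vector_mul_assoc)
    then show "x = 0" using posdef_invertible[OF assms] invertible_iff_kernel by blast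
  qed
  with s that show ?thesis by (metis invertibleE)
qed

lemma posdef_congruence_iff:
  fixes s t A :: "'n::finite cmat"
  assumes "madj s = s" "s ** t = mat 1" "t ** s = mat 1"
  shows "posdef (s ** A ** s) \<longleftrightarrow> posdef A"
proof -
  have madjt: "madj t = t"
    by (metis assms madj_mat_1 madj_mult matrix_mul_assoc matrix_mul_lid matrix_mul_rid)
  have *: "posdef (b ** B ** b)" if "posdef B" "madj b = b" "b ** c = mat 1" "c ** b = mat 1" for b c B :: "'n cmat"
    unfolding posdef_def cquad_eq
  proof (intro conjI allI impI)
    show "hermitian (b ** B ** b)"
      using that by (simp add: posdef_def hermitian_def madj_simps matrix_mul_assoc)
    fix x assume "(x :: complex ^ 'n) \<noteq> 0"
    have "b *v x \<noteq> 0"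
    proof
      assume "b *v x = 0"
      then have "c *v (b *v x) = 0" by simp
      then show False using \<open>x \<noteq> 0\<close> that by (simp add: matrix_vector_mul_assoc)
    qed
    then have "0 < Re (cinner (b *v x) (B *v (b *v x)))" using posdefD that by blast
    also have "cinner (b *v x) (B *v (b *v x)) = cinner x ((b ** B ** b) *v x)"
      using that(2) by (simp only: cinner_adjoint matrix_vector_mul_assoc matrix_mul_assoc)
    finally show "0 < Re (cinner x ((b ** B ** b) *v x))" .
  qed
  have "t ** (s ** A ** s) ** t = A"
    using assms by (metis matrix_mul_assoc matrix_mul_lid matrix_mul_rid)
  then show ?thesis
    using *[of A s t] *[of "s ** A ** s" t s] assms madjt by auto
qed

lemma posdef_1_minus_outer: "posdef (mat 1 - outer z z) \<longleftrightarrow> norm z < 1"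
proof
  assume pd: "posdef (mat 1 - outer z z)"
  show "norm z < 1"
  proof (cases "z = 0")
    case False
    have "0 < Re (cinner z ((mat 1 - outer z z) *v z))" by (rule posdefD[OF pd False])
    also have "\<dots> = (norm z)\<^sup>2 * (1 - (norm z)\<^sup>2)"
      by (simp add: matrix_vector_mult_diff_rdistrib cinner_diff_right outer_quadratic)
         (simp add: cinner_self norm_power algebra_simps flip: of_real_power power_mult)
    finally have "(norm z)\<^sup>2 < 1" using False by (simp add: zero_less_mult_iff)
    then show ?thesis by (simp add: power2_less_1_iff)
  qed simp
next
  assume z: "norm z < 1"
  show "posdef (mat 1 - outer z z)"
    unfolding posdef_def cquad_eq
  proof (intro conjI allI impI)
    show "hermitian (mat 1 - outer z z)" by (simp add: hermitian_def madj_simps madj_outer)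
    fix x :: "complex ^ 'a" assume x: "x \<noteq> 0"
    have "cmod (cinner z x) \<le> norm z * norm x" by (rule cinner_Cauchy_Schwarz)
    also have "\<dots> < norm x" using z x by simp
    finally have "(cmod (cinner z x))\<^sup>2 < (norm x)\<^sup>2" by (simp add: power_strict_mono)
    then show "0 < Re (cinner x ((mat 1 - outer z z) *v x))"
      by (simp add: matrix_vector_mult_diff_rdistrib cinner_diff_right outer_quadratic cinner_self)
  qed
qed

text \<open>With \<open>N = s ** s\<close> and \<open>t\<close> inverse to \<open>s\<close>, the
  seminorm \<open>norm (t *v x)\<close> has the domain of integration as its unit ball. The
  determinant contributes a factor \<open>D powr \<alpha>\<close> with
  \<open>D = Re (det N)\<close>, the volume a factor \<open>D\<close>. Since
  \<open>\<alpha> + 1 > 0\<close> and \<open>D \<le> 1\<close>, their product is at most 1 and the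
  bound is uniform in \<open>N\<close>.\<close>

lemma nn_integral_det_outer_le:
  fixes N :: "'n::finite cmat"
  assumes N: "posdef N" "Re (det N) \<le> 1" and \<alpha>: "-1 < \<alpha>" "\<alpha> < 0"
  shows "(\<integral>\<^sup>+x. (if posdef (N - outer x x) then ennreal (Re (det (N - outer x x)) powr \<alpha>) else 0) \<partial>lborel)
    \<le> ennreal (2 ^ DIM(complex ^ 'n) * ((1/2) powr \<alpha> + 4 / (\<alpha> + 1)) * 4 ^ CARD('n))"
proof -
  obtain s t where s: "psd s" "s ** s = N" and st: "s ** t = mat 1" "t ** s = mat 1"
    using posdef_sqrt[OF N(1)] by blast
  define D where "D = Re (det N)"
  have D: "0 < D" "D \<le> 1" using N posdef_det_pos by (auto simp: D_def)
  define C where "C = 2 ^ DIM(complex ^ 'n) * ((1/2) powr \<alpha> + 4 / (\<alpha> + 1))"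
  have C: "0 \<le> C" using \<alpha> by (simp add: C_def)
  define p where "p x = norm (t *v x)" for x
  have sz: "s *v (t *v x) = x" for x by (simp add: matrix_vector_mul_assoc st)
  have Nx: "N - outer x x = s ** (mat 1 - outer (t *v x) (t *v x)) ** s" for x
    using outer_congruence[of s "t *v x" "t *v x" s] psd_madj[OF s(1)] by (simp add: matrix_distribs s(2) sz)
  have pd: "posdef (N - outer x x) \<longleftrightarrow> p x < 1" for x
    unfolding Nx p_def posdef_congruence_iff[OF psd_madj[OF s(1)] st] by (rule posdef_1_minus_outer)
  have meas_p [measurable]: "p \<in> borel_measurable borel"
    unfolding p_def by (intro borel_measurable_continuous_onI continuous_intros)
  have le: "Re (det (N - outer x x)) powr \<alpha> \<le> D powr \<alpha> * (1 - p x) powr \<alpha>" if "p x < 1" for x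
  proof -
    have px: "0 \<le> p x" by (simp add: p_def)
    \<comment> \<open>Weakening \<open>1 - p\<^sup>2\<close> to \<open>1 - p\<close> brings the
      integrand to the form of the seminorm estimate.\<close>
    have "D * (1 - p x) \<le> D * (1 - (p x)\<^sup>2)"
      using D that px by (intro mult_left_mono) (auto simp: power2_eq_square mult_left_le)
    also have "\<dots> \<le> Re (det (N - outer x x))"
      using Re_det_outer_ge[OF s(1), of "t *v x"] that by (simp add: s sz D_def p_def)
    finally have "Re (det (N - outer x x)) powr \<alpha> \<le> (D * (1 - p x)) powr \<alpha>"
      using D that \<alpha> by (intro powr_mono2') auto
    also have "\<dots> = D powr \<alpha> * (1 - p x) powr \<alpha>" using D that by (simp add: powr_mult)
    finally show ?thesis .
  qed
  have "(\<integral>\<^sup>+x. (if posdef (N - outer x x) then ennreal (Re (det (N - outer x x)) powr \<alpha>) else 0) \<partial>lborel)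
    \<le> (\<integral>\<^sup>+x. ennreal (D powr \<alpha>) * (if p x < 1 then ennreal ((1 - p x) powr \<alpha>) else 0) \<partial>lborel)"
    using le by (intro nn_integral_mono) (auto simp: pd ennreal_mult[symmetric] intro!: ennreal_leI)
  also have "\<dots> = ennreal (D powr \<alpha>) * (\<integral>\<^sup>+x. (if p x < 1 then ennreal ((1 - p x) powr \<alpha>) else 0) \<partial>lborel)"
    by (rule nn_integral_cmult) measurable
  also have "\<dots> \<le> ennreal (D powr \<alpha>) * (ennreal C * emeasure lborel {x. p x < 1})"
    unfolding C_def
    by (intro mult_left_mono nn_integral_seminorm_ball_powr_le[OF \<alpha> _ _ meas_p])
       (auto simp: p_def matrix_vector_scaleR)
  also have "\<dots> \<le> ennreal (D powr \<alpha>) * (ennreal C * ennreal (4 ^ CARD('n) * D))"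
    using emeasure_posdef_outer_le[OF N(1)] unfolding pd D_def by (intro mult_left_mono) auto
  also have "\<dots> = ennreal (C * 4 ^ CARD('n) * D powr (\<alpha> + 1))"
    using D C by (simp add: ennreal_mult[symmetric] powr_add mult_ac)
  also have "\<dots> \<le> ennreal (C * 4 ^ CARD('n))"
    using D C \<alpha> by (intro ennreal_leI mult_left_le) (auto intro!: powr_le1)
  finally show ?thesis by (simp add: C_def)
qed

lemma Re_det_le_1:
  fixes N :: "'n::finite cmat"
  assumes "posdef N" "psd (mat 1 - N)" shows "Re (det N) \<le> 1"
proof -
  obtain U d where U: "unitary U" "N = U ** cdiag d ** madj U"
    using hermitian_diagonalization assms(1) unfolding posdef_def by metis
  have d: "0 < d i" for i by (rule posdef_eigenvalue_pos[OF assms(1) U])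
  have "d i \<le> 1" for i
    using psdD[OF assms(2), of "U *v axis i 1"] diagonalization_eigenvalue[OF U, of i]
    by (simp add: matrix_vector_mult_diff_rdistrib cinner_simps cinner_self)
  then have "(\<Prod>i\<in>UNIV. d i) \<le> 1" using d by (intro prod_le_1) (auto intro: less_imp_le)
  then show ?thesis by (simp add: U det_diagonalization del: of_real_prod)
qed

lemma weight_le_1: "v \<in> Dball \<Longrightarrow> weight v \<le> 1"
  unfolding weight_def by (rule Re_det_le_1) (simp_all add: Dball_iff_posdef psd_square)

lemma Dball_subset_cball: "(Dball :: 'n::finite cmat set) \<subseteq> cball 0 (real CARD('n) * real CARD('n))"
  using norm_matrix_le Dball_entry by fastforce

text \<open>Integrating over one column of \<open>v\<close> first: the translates of \<open>F\<close> by matrices supported in the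
  column \<open>k\<close> all have the same integral, which is averaged over the unit ball.\<close>

lemma nn_integral_weight_finite:
  fixes \<alpha> :: real
  assumes "-1 < \<alpha>"
  shows "(\<integral>\<^sup>+v. (if v \<in> (Dball :: 'n::finite cmat set) then ennreal (weight v powr \<alpha>) else 0) \<partial>lborel) < \<infinity>"
proof (cases "0 \<le> \<alpha>")
  case True
  let ?R = "real CARD('n) * real CARD('n)"
  have "(\<integral>\<^sup>+v. (if v \<in> (Dball :: 'n cmat set) then ennreal (weight v powr \<alpha>) else 0) \<partial>lborel)
      \<le> (\<integral>\<^sup>+v. indicator (cball 0 ?R) (v :: 'n cmat) \<partial>lborel)"
  proof (rule nn_integral_mono)
    fix v :: "'n cmat"
    have "weight v powr \<alpha> \<le> 1" "v \<in> cball 0 ?R" if "v \<in> Dball"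
      using that True Dball_subset_cball by (auto intro!: powr_le1 simp: weight_le_1 weight_pos less_imp_le)
    then show "(if v \<in> Dball then ennreal (weight v powr \<alpha>) else 0) \<le> indicator (cball 0 ?R) v"
      by (auto simp: ennreal_le_1)
  qed
  also have "\<dots> < \<infinity>" using emeasure_lborel_cball_finite[of "0 :: 'n cmat" ?R] by simp
  finally show ?thesis .
next
  case False
  then have \<alpha>: "-1 < \<alpha>" "\<alpha> < 0" using assms by auto
  fix k :: 'n
  define F where "F v = (if v \<in> (Dball :: 'n cmat set) then ennreal (weight v powr \<alpha>) else 0)" for v
  have [measurable]: "(Dball :: 'n cmat set) \<in> sets borel" using open_Dball by (rule borel_open)
  have [measurable]: "(weight :: 'n cmat \<Rightarrow> real) \<in> borel_measurable borel"
    by (intro borel_measurable_continuous_onI continuous_on_weight)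
  have [measurable]: "F \<in> borel_measurable borel" unfolding F_def by measurable
  define E where "E x = outer x (axis k 1)" for x :: "complex ^ 'n"
  have E_add: "E (x + y) = E x + E y" for x y by (simp add: E_def outer_add)
  have E_minus: "E (- x) = - E x" for x by (simp add: E_def outer_def vec_eq_iff)
  have E_axis: "E x *v axis k 1 = x" for x
    by (simp add: E_def outer_mult_vec cinner_axis)
  have [measurable]: "E \<in> borel_measurable borel"
    unfolding E_def by (intro borel_measurable_continuous_onI continuous_intros)
  define col where "col v = v *v axis k 1" for v :: "'n cmat"
  have [measurable]: "col \<in> borel_measurable borel"
    unfolding col_def by (intro borel_measurable_continuous_onI continuous_intros)
  define B where "B = cball (0 :: complex ^ 'n) 1"
  have [measurable]: "B \<in> sets borel" by (simp add: B_def)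
  define C where "C = 2 ^ DIM(complex ^ 'n) * ((1/2) powr \<alpha> + 4 / (\<alpha> + 1)) * 4 ^ CARD('n)"
  define R where "R = real CARD('n) * real CARD('n)"
  have inner: "indicator B (col v) * (\<integral>\<^sup>+x. F (v + E x) \<partial>lborel) \<le> ennreal C * indicator (cball 0 R) v" for v
  proof -
    \<comment> \<open>\<open>w\<close> is \<open>v\<close> with column \<open>k\<close> cleared. The
      mixed terms of \<open>w\<close> with \<open>E x\<close> vanish, so restoring a column
      \<open>x\<close> subtracts exactly \<open>outer x x\<close> from \<open>N\<close>.\<close>
    define w where "w = v - E (col v)"
    have w0: "w *v axis k 1 = 0"
      by (simp add: w_def matrix_vector_mult_diff_rdistrib E_axis col_def)
    define N where "N = mat 1 - w ** madj w"
    have eq: "mat 1 - (w + E x) ** madj (w + E x) = N - outer x x" for x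
    proof -
      have "w ** madj (E x) = 0"
        using outer_congruence[of w "axis k 1" x "mat 1"] w0 by (simp add: E_def madj_outer)
      moreover have "E x ** madj w = 0"
        using outer_congruence[of "mat 1" x "axis k 1" w] w0 by (simp add: E_def)
      moreover have "E x ** madj (E x) = outer x x"
        using outer_congruence[of "E x" "axis k 1" x "mat 1"] E_axis by (simp add: E_def madj_outer)
      ultimately show ?thesis by (simp add: N_def madj_add matrix_distribs)
    qed
    have F_eq: "F (w + E x) = (if posdef (N - outer x x) then ennreal (Re (det (N - outer x x)) powr \<alpha>) else 0)" for x
      by (simp add: F_def Dball_iff_posdef weight_def eq)
    have "(\<integral>\<^sup>+x. F (v + E x) \<partial>lborel) = (\<integral>\<^sup>+x. F (v + E (x + - col v)) \<partial>lborel)"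
      by (rule nn_integral_lborel_translate[symmetric]) measurable
    also have "\<dots> = (\<integral>\<^sup>+x. F (w + E x) \<partial>lborel)"
      by (simp only: E_add E_minus w_def) (simp add: algebra_simps)
    finally have int: "(\<integral>\<^sup>+x. F (v + E x) \<partial>lborel) = (\<integral>\<^sup>+x. F (w + E x) \<partial>lborel)" .
    show ?thesis
    proof (cases "posdef N \<and> col v \<in> B")
      case True
      then have N: "posdef N" by simp
      have "Re (det N) \<le> 1"
        by (rule Re_det_le_1[OF N]) (simp add: N_def psd_square)
      then have "(\<integral>\<^sup>+x. F (w + E x) \<partial>lborel) \<le> ennreal C"
        unfolding F_eq C_def by (rule nn_integral_det_outer_le[OF N _ \<alpha>])
      moreover have "norm v \<le> R"
        unfolding R_def
      proof (rule norm_matrix_le)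
        fix i j
        show "cmod (v $ i $ j) \<le> 1"
        proof (cases "j = k")
          case True
          then show ?thesis
            using cmod_nth_le_column[of v i k] \<open>posdef N \<and> col v \<in> B\<close> by (simp add: col_def B_def)
        next
          case False
          have "w \<in> Dball" using N by (simp add: N_def Dball_iff_posdef)
          moreover have "w $ i $ j = v $ i $ j"
            using False by (simp add: w_def E_def outer_def axis_def)
          ultimately show ?thesis using Dball_entry by metis
        qed
      qed
      ultimately show ?thesis unfolding int by (auto simp: indicator_def)
    next
      case False
      \<comment> \<open>Subtracting the positive \<open>outer x x\<close> cannot make a matrix
        positive definite, so no column is admissible over such a \<open>w\<close>.\<close>
      have "F (w + E x) = 0" if "\<not> posdef N" for x
      proof -
        have "\<not> posdef (N - outer x x)"
        proof
          assume pd: "posdef (N - outer x x)"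
          have "posdef N"
            unfolding posdef_def cquad_eq
          proof (intro conjI allI impI)
            show "hermitian N" by (simp add: N_def hermitian_def madj_simps)
            fix y :: "complex ^ 'n" assume "y \<noteq> 0"
            then have "0 < Re (cinner y ((N - outer x x) *v y))" by (rule posdefD[OF pd])
            then show "0 < Re (cinner y (N *v y))"
              using psdD[OF psd_outer, of y x] by (simp add: matrix_vector_mult_diff_rdistrib cinner_diff_right)
          qed
          then show False using that by simp
        qed
        then show ?thesis by (simp add: F_eq)
      qed
      then show ?thesis using False unfolding int by (auto simp: indicator_def)
    qed
  qed
  \<comment> \<open>The column integral is constant along column \<open>k\<close>, so its integral
    over all \<open>v\<close> may diverge. The factor \<open>indicator B\<close> localises that
    column, at the price of a factor \<open>emeasure lborel B\<close>.\<close>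
  have "(\<integral>\<^sup>+v. F v \<partial>lborel) * emeasure lborel B = (\<integral>\<^sup>+v. \<integral>\<^sup>+x. F v * indicator B (col v - x) \<partial>lborel \<partial>lborel)"
  proof -
    have "(\<integral>\<^sup>+x. indicator B (y - x) \<partial>lborel) = emeasure lborel B" for y
    proof -
      have "(\<integral>\<^sup>+x. indicator B (y - x) \<partial>lborel) = (\<integral>\<^sup>+x. indicator B (x + - y) \<partial>lborel)"
        by (intro nn_integral_cong) (auto simp: B_def indicator_def norm_minus_commute)
      also have "\<dots> = emeasure lborel B"
        by (subst nn_integral_lborel_translate) auto
      finally show ?thesis .
    qed
    then show ?thesis by (simp add: nn_integral_cmult nn_integral_multc)
  qed
  also have "\<dots> = (\<integral>\<^sup>+x. \<integral>\<^sup>+v. F v * indicator B (col v - x) \<partial>lborel \<partial>lborel)"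
    by (rule pair_sigma_finite.Fubini') (unfold_locales, measurable)
  also have "\<dots> = (\<integral>\<^sup>+x. \<integral>\<^sup>+v. F (v + E x) * indicator B (col v) \<partial>lborel \<partial>lborel)"
  proof (rule nn_integral_cong)
    fix x
    have "(\<integral>\<^sup>+v. F v * indicator B (col v - x) \<partial>lborel)
      = (\<integral>\<^sup>+v. F (v + E x) * indicator B (col (v + E x) - x) \<partial>lborel)"
      by (rule nn_integral_lborel_translate[symmetric]) measurable
    then show "(\<integral>\<^sup>+v. F v * indicator B (col v - x) \<partial>lborel) = (\<integral>\<^sup>+v. F (v + E x) * indicator B (col v) \<partial>lborel)"
      by (simp add: col_def matrix_vector_mult_add_rdistrib E_axis)
  qed
  also have "\<dots> = (\<integral>\<^sup>+v. \<integral>\<^sup>+x. F (v + E x) * indicator B (col v) \<partial>lborel \<partial>lborel)"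
    by (rule pair_sigma_finite.Fubini') (unfold_locales, measurable)
  also have "\<dots> = (\<integral>\<^sup>+v. indicator B (col v) * (\<integral>\<^sup>+x. F (v + E x) \<partial>lborel) \<partial>lborel)"
    by (simp add: nn_integral_cmult mult.commute[of _ "indicator _ _"])
  also have "\<dots> \<le> (\<integral>\<^sup>+v. ennreal C * indicator (cball 0 R) (v :: 'n cmat) \<partial>lborel)"
    by (intro nn_integral_mono inner)
  also have "\<dots> = ennreal C * emeasure lborel (cball (0 :: 'n cmat) R)"
    by (rule nn_integral_cmult_indicator) simp
  also have "\<dots> < \<infinity>"
    using emeasure_lborel_cball_finite[of "0 :: 'n cmat" R] by (simp add: ennreal_mult_less_top)
  finally have fin: "(\<integral>\<^sup>+v. F v \<partial>lborel) * emeasure lborel B < \<infinity>" .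
  have "emeasure lborel B \<noteq> 0"
    unfolding B_def by (rule emeasure_lborel_cball_nonzero) simp
  then show ?thesis
    using fin unfolding F_def[symmetric] by (auto simp: ennreal_mult_less_top)
qed

lemma weight_powr_integrable:
  assumes "-1 < \<alpha>"
  shows "set_integrable lborel (Dball :: 'n::finite cmat set) (\<lambda>v. weight v powr \<alpha>)"
  unfolding set_integrable_def
proof (rule integrableI_nonneg)
  have [measurable]: "(Dball :: 'n cmat set) \<in> sets borel" using open_Dball by (rule borel_open)
  have [measurable]: "(weight :: 'n cmat \<Rightarrow> real) \<in> borel_measurable borel"
    by (intro borel_measurable_continuous_onI continuous_on_weight)
  show "(\<lambda>v :: 'n cmat. indicat_real Dball v *\<^sub>R weight v powr \<alpha>) \<in> borel_measurable lborel"
    by measurable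
  have "(\<integral>\<^sup>+v. ennreal (indicat_real (Dball :: 'n cmat set) v *\<^sub>R weight v powr \<alpha>) \<partial>lborel)
    = (\<integral>\<^sup>+v. (if v \<in> (Dball :: 'n cmat set) then ennreal (weight v powr \<alpha>) else 0) \<partial>lborel)"
    by (intro nn_integral_cong) (auto simp: indicator_def)
  then show "(\<integral>\<^sup>+v. ennreal (indicat_real (Dball :: 'n cmat set) v *\<^sub>R weight v powr \<alpha>) \<partial>lborel) < \<infinity>"
    using nn_integral_weight_finite[OF assms, where 'n='n] by simp
qed auto

section \<open>The convolution under congruences\<close>

text \<open>The square of the point at which the convolution integral evaluates \<open>f\<close>.
  Unlike the point itself it is real-affine in \<open>v\<close>.\<close>

definition Mconv :: "'n::finite cmat \<Rightarrow> 'n cmat \<Rightarrow> 'n cmat \<Rightarrow> 'n cmat" where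
  "Mconv r s v = r ** r + s ** s + s ** v ** r + r ** madj v ** s"

text \<open>The closed unit ball of the operator norm; its compactness makes supports compact and
  yields limits of parameters.\<close>

definition Dbar :: "'n::finite cmat set" where
  "Dbar = {v. \<forall>x. norm (v *v x) \<le> norm x}"

lemma Dball_subset_Dbar: "Dball \<subseteq> (Dbar :: 'n::finite cmat set)"
proof
  fix v :: "'n cmat" assume "v \<in> Dball"
  then have "norm (v *v x) \<le> norm x" for x
    by (cases "x = 0") (auto simp: Dball_iff less_imp_le)
  then show "v \<in> Dbar" by (simp add: Dbar_def)
qed

lemma Mconv_quadratic:
  assumes "psd r" "psd s"
  shows "Re (cinner x (Mconv r s v *v x)) = (norm (r *v x))\<^sup>2 + (norm (s *v x))\<^sup>2 + 2 * Re (cinner (s *v x) (v *v (r *v x)))"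
proof -
  have r: "cinner x (r *v y) = cinner (r *v x) y" and s: "cinner x (s *v y) = cinner (s *v x) y" for x y
    using assms by (simp_all add: hermitian_cinner psd_hermitian)
  have "cinner x (Mconv r s v *v x) = cinner (r *v x) (r *v x) + cinner (s *v x) (s *v x)
      + cinner (s *v x) (v *v (r *v x)) + cinner (r *v x) (madj v *v (s *v x))"
    by (simp only: Mconv_def matrix_vector_mult_add_rdistrib cinner_add_right matrix_vector_mul_assoc[symmetric] r s)
  moreover have "Re (cinner (r *v x) (madj v *v (s *v x))) = Re (cinner (s *v x) (v *v (r *v x)))"
    by (metis cinner_adjoint Re_cinner_commute)
  ultimately show ?thesis by (simp add: cinner_self)
qed

text \<open>As \<open>v\<close> is a contraction, the mixed term of the quadratic form is at least
  \<open>- 2 * norm (r *v x) * norm (s *v x)\<close>, and a perfect square remains. This makes the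
  square root meaningful on the whole of \<open>Dbar\<close>.\<close>

lemma psd_Mconv:
  assumes "psd r" "psd s" "v \<in> Dbar" shows "psd (Mconv r s v)"
proof (rule psdI)
  show "hermitian (Mconv r s v)"
    by (simp add: Mconv_def hermitian_def madj_simps psd_madj assms matrix_mul_assoc)
  fix x
  have "\<bar>Re (cinner (s *v x) (v *v (r *v x)))\<bar> \<le> norm (s *v x) * norm (v *v (r *v x))"
    using cinner_Cauchy_Schwarz abs_Re_le_cmod order_trans by blast
  also have "\<dots> \<le> norm (s *v x) * norm (r *v x)"
    using assms(3) by (intro mult_left_mono) (auto simp: Dbar_def)
  finally have "- (norm (s *v x) * norm (r *v x)) \<le> Re (cinner (s *v x) (v *v (r *v x)))" by linarith
  moreover have "0 \<le> (norm (r *v x) - norm (s *v x))\<^sup>2" by simp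
  ultimately show "0 \<le> Re (cinner x (Mconv r s v *v x))"
    unfolding Mconv_quadratic[OF assms(1,2)] by (simp add: power2_diff mult_ac)
qed

lemma continuous_on_Mconv [continuous_intros]:
  assumes "continuous_on S f" "continuous_on S g" "continuous_on S h"
  shows "continuous_on S (\<lambda>x. Mconv (f x) (g x) (h x))"
  unfolding Mconv_def by (intro continuous_intros assms)

lemma continuous_on_sqrt_Mconv:
  assumes "psd r" "psd s"
  shows "continuous_on Dbar (\<lambda>v. psd_sqrt (Mconv r s v))"
  by (rule continuous_on_compose2[OF psd_sqrt_continuous])
     (auto intro!: continuous_intros simp: PiCone_def psd_Mconv assms)

lemma continuous_on_conv_integrand:
  assumes "psd r" "psd s" "continuous_on PiCone f"
  shows "continuous_on Dbar (\<lambda>v. f (psd_sqrt (Mconv r s v)))"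
  by (rule continuous_on_compose2[OF assms(3) continuous_on_sqrt_Mconv])
     (auto simp: PiCone_def psd_Mconv psd_psd_sqrt assms)

lemma conv_pt_eq:
  "conv_pt \<mu> r s f = (LINT v:Dball|lborel. f (psd_sqrt (Mconv r s v)) * weight v powr (\<mu> - rho_C TYPE('n)))
     / kappa TYPE('n) \<mu>" for r :: "'n::finite cmat"
  by (simp add: conv_pt_def Mconv_def weight_def)

text \<open>The integrand samples \<open>f\<close> only at points of the cone, so it suffices to
  know an automorphism on \<open>PiCone\<close>.\<close>

lemma conv_pt_cong:
  fixes r s :: "'n::finite cmat"
  assumes "psd r" "psd s" "\<And>x. x \<in> PiCone \<Longrightarrow> f x = g x"
  shows "conv_pt \<mu> r s f = conv_pt \<mu> r s g"
proof -
  have "f (psd_sqrt (Mconv r s v)) = g (psd_sqrt (Mconv r s v))" if "v \<in> Dball" for v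
    using that assms Dball_subset_Dbar by (auto simp: PiCone_def psd_psd_sqrt psd_Mconv)
  then have "(LINT v:Dball|lborel. f (psd_sqrt (Mconv r s v)) * weight v powr (\<mu> - rho_C TYPE('n))) =
      (LINT v:Dball|lborel. g (psd_sqrt (Mconv r s v)) * weight v powr (\<mu> - rho_C TYPE('n)))"
    by (intro set_lebesgue_integral_cong) (auto simp: borel_open open_Dball)
  then show ?thesis by (simp add: conv_pt_eq)
qed

lemma set_integral_Dball_substitution:
  fixes h :: "'n::finite cmat \<Rightarrow> real" and g :: "'n cmat \<Rightarrow> 'n cmat"
  assumes g: "orthogonal_transformation g" "\<And>v. g v \<in> Dball \<longleftrightarrow> v \<in> Dball"
    and h: "continuous_on Dball h"
  shows "(LINT v:Dball|lborel. h (g v)) = (LINT v:Dball|lborel. h v)"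
proof -
  have g_meas: "g \<in> borel_measurable borel"
    using linear_continuous_on[OF linear_conv_bounded_linear[THEN iffD1, OF orthogonal_transformation_linear[OF g(1)]]]
    by (rule borel_measurable_continuous_onI)
  have h_meas: "(\<lambda>v. indicat_real Dball v *\<^sub>R h v) \<in> borel_measurable borel"
    using borel_measurable_continuous_on_indicator[OF borel_open[OF open_Dball] h] .
  have "(LINT v:Dball|lborel. h v) = (LINT v|distr lborel borel g. indicat_real Dball v *\<^sub>R h v)"
    by (simp add: set_lebesgue_integral_def orthogonal_transformation_lborel[OF g(1)])
  also have "\<dots> = (LINT v|lborel. indicat_real Dball (g v) *\<^sub>R h (g v))"
    using g_meas h_meas by (intro integral_distr) auto
  also have "\<dots> = (LINT v:Dball|lborel. h (g v))"
    by (simp add: set_lebesgue_integral_def indicator_def g(2))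
  finally show ?thesis by simp
qed

text \<open>The change of variables shared by congruences and transposition: in both cases the
  effect of \<open>T\<close> is absorbed by a linear isometry \<open>g\<close> of the integration
  variable.\<close>

lemma conv_pt_transform:
  fixes r s r' s' :: "'n::finite cmat" and g T :: "'n cmat \<Rightarrow> 'n cmat"
  assumes rs: "psd r" "psd s" "psd r'" "psd s'" and f: "continuous_on PiCone f"
    and g: "orthogonal_transformation g" "\<And>v. g v \<in> Dball \<longleftrightarrow> v \<in> Dball" "\<And>v. weight (g v) = weight v"
    and T: "\<And>v. v \<in> Dball \<Longrightarrow> T (psd_sqrt (Mconv r s v)) = psd_sqrt (Mconv r' s' (g v))"
  shows "conv_pt \<mu> r s (f \<circ> T) = conv_pt \<mu> r' s' f"
proof -
  define \<alpha> where "\<alpha> = \<mu> - rho_C TYPE('n)"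
  define h where "h v = f (psd_sqrt (Mconv r' s' v)) * weight v powr \<alpha>" for v
  have h: "continuous_on Dball h"
    unfolding h_def
    by (intro continuous_intros continuous_on_weight continuous_on_subset[OF continuous_on_conv_integrand Dball_subset_Dbar] rs f)
       (auto dest: weight_pos)
  have "(LINT v:Dball|lborel. (f \<circ> T) (psd_sqrt (Mconv r s v)) * weight v powr \<alpha>) = (LINT v:Dball|lborel. h (g v))"
    by (rule set_lebesgue_integral_cong) (auto simp: h_def T g(3) borel_open open_Dball)
  also have "\<dots> = (LINT v:Dball|lborel. h v)"
    by (rule set_integral_Dball_substitution[OF g(1,2) h])
  finally show ?thesis by (simp add: conv_pt_eq h_def \<alpha>_def)
qed

section \<open>Polar decomposition and congruences\<close>

lemma Dbar_bounded: "Dbar \<subseteq> cball (0 :: 'n::finite cmat) (real CARD('n) * real CARD('n))"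
proof
  fix v :: "'n cmat" assume "v \<in> Dbar"
  then have "norm (v *v axis j 1) \<le> norm (axis j 1 :: complex ^ 'n)" for j
    unfolding Dbar_def by blast
  then have "cmod (v $ i $ j) \<le> 1" for i j
    using cmod_nth_le_column[of v i j] norm_axis_1[of j] order_trans by metis
  then show "v \<in> cball 0 (real CARD('n) * real CARD('n))"
    using norm_matrix_le[of v] by simp
qed

lemma compact_Dbar: "compact (Dbar :: 'n::finite cmat set)"
proof -
  have eq: "(Dbar :: 'n cmat set) = (\<Inter>x. {v. norm (v *v x) \<le> norm x})"
    by (auto simp: Dbar_def)
  have "closed (Dbar :: 'n cmat set)"
    unfolding eq by (intro closed_INT ballI closed_Collect_le continuous_intros)
  then show ?thesis
    using Dbar_bounded bounded_cball bounded_subset compact_eq_bounded_closed by blast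
qed

lemma unitary_in_Dbar: "unitary U \<Longrightarrow> U \<in> Dbar"
  by (simp add: Dbar_def unitary_norm)

lemma posdef_add_scaleR_1:
  assumes "psd r" "0 < e" shows "posdef (r + e *\<^sub>R mat 1)"
  unfolding posdef_def cquad_eq
proof (intro conjI allI impI)
  show "hermitian (r + e *\<^sub>R mat 1)" using assms by (simp add: hermitian_def madj_simps psd_madj)
  fix x :: "complex ^ 'a" assume "x \<noteq> 0"
  then show "0 < Re (cinner x ((r + e *\<^sub>R mat 1) *v x))"
    using psdD[OF assms(1), of x] assms(2)
    by (simp add: matrix_vector_mult_add_rdistrib matrix_scaleR_vector cinner_simps cinner_self add_nonneg_pos)
qed

lemma T_mat_psd:
  assumes "psd r" shows "psd (a ** r ** r ** madj a)"
  using psd_congruence[OF psd_square_self[OF assms], of a] by (simp add: matrix_mul_assoc)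

lemma psd_T_mat: "psd r \<Longrightarrow> psd (T_mat a r)"
  and T_mat_square: "psd r \<Longrightarrow> T_mat a r ** T_mat a r = a ** r ** r ** madj a"
  by (simp_all add: T_mat_def psd_psd_sqrt psd_sqrt_square T_mat_psd)

lemma continuous_on_T_mat: "continuous_on PiCone (T_mat a)"
  unfolding T_mat_def
  by (rule continuous_on_compose2[OF psd_sqrt_continuous])
     (auto intro!: continuous_intros simp: PiCone_def T_mat_psd)

text \<open>For singular \<open>r\<close> the unitary factor is a limit of the unitary factors for \<open>r + 1/n\<close>.\<close>

lemma polar_decomposition:
  fixes r a :: "'n::finite cmat"
  assumes r: "psd r" and a: "invertible a"
  obtains U where "unitary U" "r ** madj a = U ** T_mat a r"
proof -
  define R where "R n = r + inverse (real (Suc n)) *\<^sub>R mat 1" for n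
  have R: "posdef (R n)" for n unfolding R_def by (rule posdef_add_scaleR_1[OF r]) simp
  have Rp: "psd (R n)" for n by (rule posdef_psd[OF R])
  have R_lim: "R \<longlonglongrightarrow> r"
    unfolding R_def by (rule tendsto_add_inverse_mat_1)
  have "\<exists>U. unitary U \<and> R n ** madj a = U ** T_mat a (R n)" for n
  proof -
    let ?P = "T_mat a (R n)" and ?B = "R n ** madj a"
    have PP: "?P ** ?P = madj ?B ** ?B"
      by (simp add: T_mat_square[OF Rp] madj_simps psd_madj[OF Rp] matrix_mul_assoc)
    have madjP: "madj ?P = ?P" by (rule psd_madj[OF psd_T_mat[OF Rp]])
    obtain b where b: "a ** b = mat 1" "b ** a = mat 1" using a by (rule invertibleE)
    have "invertible ?P"
      unfolding invertible_iff_kernel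
    proof (intro allI impI)
      fix x assume "?P *v x = 0"
      then have "(?P ** ?P) *v x = 0" by (simp flip: matrix_vector_mul_assoc)
      then have "cinner x (madj ?B *v (?B *v x)) = 0" by (simp add: PP matrix_vector_mul_assoc)
      then have "cinner (?B *v x) (?B *v x) = 0" by (simp add: cinner_adjoint)
      then have "R n *v (madj a *v x) = 0" by (simp add: matrix_vector_mul_assoc)
      then have "madj a *v x = 0"
        using posdef_invertible[OF R] unfolding invertible_iff_kernel by blast
      then have "madj b *v (madj a *v x) = 0" by simp
      then show "x = 0" by (simp add: matrix_vector_mul_assoc b flip: madj_mult)
    qed
    then obtain Q where Q: "?P ** Q = mat 1" "Q ** ?P = mat 1" by (rule invertibleE)
    have madjQ: "madj Q = Q"
      by (metis Q madjP madj_mat_1 madj_mult matrix_mul_assoc matrix_mul_lid matrix_mul_rid)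
    \<comment> \<open>For invertible \<open>?P\<close>, with inverse \<open>Q\<close>, the unitary
      factor is \<open>?B ** Q\<close>, because \<open>?P ** ?P = madj ?B ** ?B\<close>.\<close>
    have "madj (?B ** Q) ** (?B ** Q) = Q ** (madj ?B ** ?B) ** Q"
      by (simp only: madj_mult madjQ matrix_mul_assoc)
    also have "\<dots> = Q ** (?P ** ?P) ** Q" by (simp only: PP)
    also have "\<dots> = (Q ** ?P) ** (?P ** Q)" by (simp only: matrix_mul_assoc)
    also have "\<dots> = mat 1" by (simp add: Q)
    finally have "unitary (?B ** Q)" by (simp add: unitary_def)
    moreover have "?B = (?B ** Q) ** ?P" by (metis Q(2) matrix_mul_assoc matrix_mul_rid)
    ultimately show ?thesis by blast
  qed
  then obtain U where U: "\<And>n. unitary (U n)" "\<And>n. R n ** madj a = U n ** T_mat a (R n)" by metis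
  have "\<forall>n. U n \<in> Dbar" using U(1) unitary_in_Dbar by blast
  then obtain V q where V: "strict_mono q" "(U \<circ> q) \<longlonglongrightarrow> V"
    using compact_Dbar unfolding compact_def by metis
  have Rq: "(\<lambda>n. R (q n)) \<longlonglongrightarrow> r" using LIMSEQ_subseq_LIMSEQ[OF R_lim V(1)] by (simp add: o_def)
  have Vq: "(\<lambda>n. U (q n)) \<longlonglongrightarrow> V" using V(2) by (simp add: o_def)
  have T_lim: "(\<lambda>n. T_mat a (R (q n))) \<longlonglongrightarrow> T_mat a r"
    using continuous_on_T_mat[of a, unfolded continuous_on_sequentially, rule_format, of r "\<lambda>n. R (q n)"] Rq r Rp
    by (simp add: PiCone_def o_def)
  have "(\<lambda>n. madj (U (q n)) ** U (q n)) \<longlonglongrightarrow> madj V ** V" by (intro tendsto_intros Vq)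
  then have "unitary V"
    using U(1) LIMSEQ_unique[OF _ tendsto_const] unfolding unitary_def by simp
  moreover have "r ** madj a = V ** T_mat a r"
  proof (rule LIMSEQ_unique)
    show "(\<lambda>n. R (q n) ** madj a) \<longlonglongrightarrow> r ** madj a" by (intro tendsto_intros Rq)
    show "(\<lambda>n. R (q n) ** madj a) \<longlonglongrightarrow> V ** T_mat a r" unfolding U(2) by (intro tendsto_intros Vq T_lim)
  qed
  ultimately show ?thesis by (rule that)
qed

lemma Dball_unitary_iff:
  assumes "unitary U" "unitary V" shows "U ** v ** V \<in> Dball \<longleftrightarrow> v \<in> Dball"
proof -
  have *: "A ** w ** B \<in> Dball" if "unitary A" "unitary B" "w \<in> Dball" for A B w :: "'a cmat"
    unfolding Dball_iff
  proof (intro allI impI)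
    fix x :: "complex ^ 'a" assume "x \<noteq> 0"
    then have "B *v x \<noteq> 0" using unitary_norm[OF that(2), of x] by auto
    then have "norm (w *v (B *v x)) < norm (B *v x)" using that(3) by (simp add: Dball_iff)
    then show "norm ((A ** w ** B) *v x) < norm x"
      by (simp add: unitary_norm that flip: matrix_vector_mul_assoc)
  qed
  have "madj U ** (U ** v ** V) ** madj V = v"
    using unitaryD[OF assms(1)] unitaryD[OF assms(2)] by (metis matrix_mul_assoc matrix_mul_lid matrix_mul_rid)
  then show ?thesis
    using *[OF assms, of v] *[OF unitary_madj[OF assms(1)] unitary_madj[OF assms(2)], of "U ** v ** V"] by auto
qed

lemma weight_unitary:
  assumes "unitary U" "unitary V" shows "weight (U ** v ** V) = weight v"
proof -
  have "(U ** v ** V) ** madj (U ** v ** V) = U ** v ** (V ** madj V) ** madj v ** madj U"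
    by (simp add: madj_simps matrix_mul_assoc)
  then have "mat 1 - (U ** v ** V) ** madj (U ** v ** V) = U ** (mat 1 - v ** madj v) ** madj U"
    using unitaryD[OF assms(1)] unitaryD[OF assms(2)] by (simp add: matrix_distribs)
  moreover have "det U * det (madj U) = 1" using unitaryD(2)[OF assms(1)] by (metis det_I det_mul)
  ultimately have "det (mat 1 - (U ** v ** V) ** madj (U ** v ** V)) = det (mat 1 - v ** madj v)"
    by (simp add: det_mul mult_ac)
  then show ?thesis by (simp add: weight_def)
qed

lemma T_mat_psd_sqrt: "psd A \<Longrightarrow> T_mat a (psd_sqrt A) = psd_sqrt (a ** A ** madj a)"
  unfolding T_mat_def by (metis matrix_mul_assoc psd_sqrt_square)

lemma conv_pt_T_mat:
  assumes rs: "psd r" "psd s" and a: "invertible a" and f: "continuous_on PiCone f"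
  shows "conv_pt \<mu> r s (f \<circ> T_mat a) = conv_pt \<mu> (T_mat a r) (T_mat a s) f"
proof -
  obtain U where U: "unitary U" "r ** madj a = U ** T_mat a r" using polar_decomposition[OF rs(1) a] by metis
  obtain V where V: "unitary V" "s ** madj a = V ** T_mat a s" using polar_decomposition[OF rs(2) a] by metis
  have U': "a ** r = T_mat a r ** madj U"
    using arg_cong[OF U(2), of madj] by (simp add: madj_simps psd_madj rs psd_T_mat)
  have V': "a ** s = T_mat a s ** madj V"
    using arg_cong[OF V(2), of madj] by (simp add: madj_simps psd_madj rs psd_T_mat)
  have "a ** Mconv r s v ** madj a = Mconv (T_mat a r) (T_mat a s) (madj V ** v ** U)" for v
  proof -
    have "a ** Mconv r s v ** madj a
      = a ** r ** r ** madj a + a ** s ** s ** madj a + (a ** s) ** v ** (r ** madj a) + (a ** r) ** madj v ** (s ** madj a)"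
      by (simp add: Mconv_def matrix_distribs)
    also have "\<dots> = Mconv (T_mat a r) (T_mat a s) (madj V ** v ** U)"
      unfolding U V U' V' using T_mat_square[OF rs(1), of a] T_mat_square[OF rs(2), of a]
      by (simp add: Mconv_def madj_simps matrix_mul_assoc U' V')
    finally show ?thesis .
  qed
  then have T: "T_mat a (psd_sqrt (Mconv r s v)) = psd_sqrt (Mconv (T_mat a r) (T_mat a s) (madj V ** v ** U))"
    if "v \<in> Dball" for v
    using that psd_Mconv[OF rs, of v] Dball_subset_Dbar by (auto simp: T_mat_psd_sqrt)
  show ?thesis
    by (rule conv_pt_transform[OF rs psd_T_mat[OF rs(1)] psd_T_mat[OF rs(2)] f
       orthogonal_transformation_unitary_mult[OF unitary_madj[OF V(1)] U(1)]
       Dball_unitary_iff[OF unitary_madj[OF V(1)] U(1)] weight_unitary[OF unitary_madj[OF V(1)] U(1)] T])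
qed

section \<open>Transposition\<close>

lemma mtransp_mtransp [simp]: "mtransp (mtransp A) = A"
  by (simp add: mtransp_def)

lemma mtransp_mult: "mtransp (A ** B) = mtransp B ** mtransp A"
  by (simp add: mtransp_def matrix_transpose_mul)

lemma mtransp_add: "mtransp (A + B) = mtransp A + mtransp B"
  and mtransp_diff: "mtransp (A - B) = mtransp A - mtransp B"
  and mtransp_scaleR: "mtransp (c *\<^sub>R A) = c *\<^sub>R mtransp A"
  and mtransp_mat_1: "mtransp (mat 1) = mat 1"
  and mtransp_madj: "mtransp (madj A) = madj (mtransp A)"
  by (auto simp: mtransp_def transpose_def vec_eq_iff mat_def madj_def)

lemma quadratic_mtransp:
  "cinner x (mtransp A *v x) = cinner (\<chi> i. cnj (x $ i)) (A *v (\<chi> i. cnj (x $ i)))"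
proof -
  have "cinner x (mtransp A *v x) = (\<Sum>i\<in>UNIV. \<Sum>j\<in>UNIV. cnj (x $ i) * (A $ j $ i * x $ j))"
    by (simp add: cinner_def matrix_vector_mult_def mtransp_def transpose_def sum_distrib_left)
  also have "\<dots> = (\<Sum>j\<in>UNIV. \<Sum>i\<in>UNIV. cnj (x $ i) * (A $ j $ i * x $ j))"
    by (rule sum.swap)
  also have "\<dots> = cinner (\<chi> i. cnj (x $ i)) (A *v (\<chi> i. cnj (x $ i)))"
    by (simp add: cinner_def matrix_vector_mult_def sum_distrib_left mult_ac)
  finally show ?thesis .
qed

lemma psd_mtransp: "psd A \<Longrightarrow> psd (mtransp A)"
  unfolding psd_def hermitian_def cquad_eq quadratic_mtransp by (simp flip: mtransp_madj)

lemma posdef_mtransp: "posdef A \<Longrightarrow> posdef (mtransp A)"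
  unfolding posdef_def hermitian_def cquad_eq quadratic_mtransp
proof (elim conjE, intro conjI allI impI)
  fix x :: "complex ^ 'a"
  assume pos: "\<forall>x. x \<noteq> 0 \<longrightarrow> 0 < Re (cinner x (A *v x))" and "x \<noteq> 0"
  from \<open>x \<noteq> 0\<close> have "(\<chi> i. cnj (x $ i)) \<noteq> 0" by (simp add: vec_eq_iff)
  then show "0 < Re (cinner (\<chi> i. cnj (x $ i)) (A *v (\<chi> i. cnj (x $ i))))" using pos by blast
qed (simp flip: mtransp_madj)

lemma psd_sqrt_mtransp: "psd A \<Longrightarrow> psd_sqrt (mtransp A) = mtransp (psd_sqrt A)"
  by (rule psd_sqrt_eqI) (simp_all add: psd_mtransp psd_psd_sqrt psd_sqrt_square flip: mtransp_mult)

lemma orthogonal_transformation_mtransp: "orthogonal_transformation (mtransp :: 'n::finite cmat \<Rightarrow> 'n cmat)"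
  unfolding orthogonal_transformation
proof (intro conjI allI)
  fix v :: "'n cmat"
  have "trace (mtransp A) = trace A" for A :: "'n cmat" by (simp add: mtransp_def trace_def transpose_def)
  then have "trace (madj (mtransp v) ** mtransp v) = trace (v ** madj v)"
    by (simp flip: mtransp_madj mtransp_mult)
  then have "(norm (mtransp v))\<^sup>2 = (norm v)\<^sup>2"
    unfolding norm_matrix_square by (metis trace_mul_sym)
  then show "norm (mtransp v) = norm v" by (simp add: power2_eq_iff_nonneg)
qed (rule linearI; simp add: mtransp_add mtransp_scaleR)

text \<open>Transposition reverses products: \<open>s ** v ** r\<close> becomes a term with the
  transposes of \<open>r\<close> on the left and of \<open>s\<close> on the right, the place of the
  term with \<open>madj v\<close>. The matching substitution is therefore entrywise conjugation,
  \<open>mtransp \<circ> madj\<close>.\<close>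

lemma conv_pt_mtransp:
  fixes r s :: "'n::finite cmat"
  assumes rs: "psd r" "psd s" and f: "continuous_on PiCone f"
  shows "conv_pt \<mu> r s (f \<circ> mtransp) = conv_pt \<mu> (mtransp r) (mtransp s) f"
proof -
  define g where "g = mtransp \<circ> (madj :: 'n cmat \<Rightarrow> 'n cmat)"
  have g: "orthogonal_transformation g"
    unfolding g_def by (intro orthogonal_transformation_compose orthogonal_transformation_mtransp orthogonal_transformation_madj)
  have eq: "mat 1 - g v ** madj (g v) = mtransp (mat 1 - v ** madj v)" for v
    by (simp add: g_def mtransp_diff mtransp_mult mtransp_mat_1 mtransp_madj)
  have T: "mtransp (psd_sqrt (Mconv r s v)) = psd_sqrt (Mconv (mtransp r) (mtransp s) (g v))" if "v \<in> Dball" for v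
  proof -
    have "mtransp (Mconv r s v) = Mconv (mtransp r) (mtransp s) (g v)"
      by (simp add: Mconv_def mtransp_add mtransp_mult g_def mtransp_madj matrix_mul_assoc)
    then show ?thesis using that psd_sqrt_mtransp psd_Mconv[OF rs] Dball_subset_Dbar by fastforce
  qed
  show ?thesis
  proof (rule conv_pt_transform[OF rs psd_mtransp[OF rs(1)] psd_mtransp[OF rs(2)] f g _ _ T])
    show "g v \<in> Dball \<longleftrightarrow> v \<in> Dball" for v
      unfolding Dball_iff_posdef eq using posdef_mtransp by fastforce
    show "weight (g v) = weight v" for v
      unfolding weight_def eq by (simp add: mtransp_def)
  qed
qed

section \<open>The listed maps are automorphisms\<close>

lemma T_mat_T_mat:
  assumes "psd r" shows "T_mat a (T_mat b r) = T_mat (a ** b) r"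
  unfolding T_mat_def[of b] T_mat_psd_sqrt[OF T_mat_psd[OF assms]]
  by (simp add: T_mat_def madj_simps matrix_mul_assoc)

lemma T_mat_1: "psd r \<Longrightarrow> T_mat (mat 1) r = r"
  by (simp add: T_mat_def psd_sqrt_of_square)

lemma homeomorphism_T_mat:
  assumes "a ** b = mat 1" "b ** a = mat 1"
  shows "homeomorphism PiCone PiCone (T_mat a) (T_mat b)"
  by (rule homeomorphismI)
     (auto simp: PiCone_def psd_T_mat T_mat_T_mat T_mat_1 assms continuous_on_T_mat[unfolded PiCone_def])

lemma continuous_on_mtransp: "continuous_on S mtransp"
  unfolding mtransp_def transpose_def by (intro continuous_intros)

lemma homeomorphism_mtransp: "homeomorphism PiCone PiCone mtransp mtransp"
  by (rule homeomorphismI) (auto simp: PiCone_def psd_mtransp continuous_on_mtransp)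

lemma hypergroup_autI:
  fixes T :: "'n::finite cmat \<Rightarrow> 'n cmat"
  assumes a: "invertible a" and \<sigma>: "\<sigma> = id \<or> \<sigma> = mtransp" and T: "\<And>x. x \<in> PiCone \<Longrightarrow> T x = \<sigma> (T_mat a x)"
  shows "hypergroup_aut \<mu> T"
  unfolding hypergroup_aut_def
proof (intro conjI ballI)
  obtain b where b: "a ** b = mat 1" "b ** a = mat 1" using a by (rule invertibleE)
  have "homeomorphism PiCone PiCone \<sigma> \<sigma>"
    using \<sigma> homeomorphism_mtransp homeomorphism_ident by (auto simp: id_def)
  then have "homeomorphism PiCone PiCone (\<sigma> \<circ> T_mat a) (T_mat b \<circ> \<sigma>)"
    by (rule homeomorphism_compose[OF homeomorphism_T_mat[OF b]])
  then have "homeomorphism PiCone PiCone T (T_mat b \<circ> \<sigma>)"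
    by (rule homeomorphism_cong) (auto simp: T)
  then show "\<exists>T'. homeomorphism PiCone PiCone T T'" by blast
  fix x y :: "'n cmat" and f :: "'n cmat \<Rightarrow> real"
  assume xy: "x \<in> PiCone" "y \<in> PiCone" and f: "f \<in> Cc_Pi"
  have f: "continuous_on PiCone f" using f by (simp add: Cc_Pi_def)
  have p: "psd x" "psd y" using xy by (simp_all add: PiCone_def)
  have \<sigma>f: "continuous_on PiCone (f \<circ> \<sigma>)"
    using \<sigma>
  proof
    assume "\<sigma> = mtransp"
    then show ?thesis
      using continuous_on_compose[OF continuous_on_mtransp, of PiCone f] f
      by (metis homeomorphism_image1[OF homeomorphism_mtransp])
  qed (simp add: f)
  have "conv_pt \<mu> x y (f \<circ> T) = conv_pt \<mu> x y ((f \<circ> \<sigma>) \<circ> T_mat a)"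
    by (rule conv_pt_cong[OF p]) (simp add: T)
  also have "\<dots> = conv_pt \<mu> (T_mat a x) (T_mat a y) (f \<circ> \<sigma>)"
    by (rule conv_pt_T_mat[OF p a \<sigma>f])
  also have "\<dots> = conv_pt \<mu> (\<sigma> (T_mat a x)) (\<sigma> (T_mat a y)) f"
    using \<sigma> conv_pt_mtransp[OF psd_T_mat[OF p(1)] psd_T_mat[OF p(2)] f] by auto
  finally show "conv_pt \<mu> x y (f \<circ> T) = conv_pt \<mu> (T x) (T y) f" by (simp add: T xy)
qed

section \<open>Supports of convolutions\<close>

text \<open>\<open>h\<close> is bounded on the compact \<open>Dbar\<close>, so the integrand is
  integrable and a zero integral means that it vanishes almost everywhere. A point with
  \<open>h > 0\<close> would bring along a ball of positive measure, as \<open>Dball\<close> is open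
  and the weight is positive on it.\<close>

lemma weighted_integral_eq_0_iff:
  fixes h :: "'n::finite cmat \<Rightarrow> real"
  assumes \<alpha>: "-1 < \<alpha>" and h: "continuous_on Dbar h" and nonneg: "\<And>v. v \<in> Dball \<Longrightarrow> 0 \<le> h v"
  shows "(LINT v:Dball|lborel. h v * weight v powr \<alpha>) = 0 \<longleftrightarrow> (\<forall>v\<in>Dball. h v = 0)"
proof
  assume 0: "(LINT v:Dball|lborel. h v * weight v powr \<alpha>) = 0"
  define F where "F v = indicat_real Dball v *\<^sub>R (h v * weight v powr \<alpha>)" for v
  have hD: "continuous_on Dball h" by (rule continuous_on_subset[OF h Dball_subset_Dbar])
  have cont: "continuous_on Dball (\<lambda>v. h v * weight v powr \<alpha>)"
    by (intro continuous_intros hD continuous_on_weight) (auto dest: weight_pos)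
  have meas: "F \<in> borel_measurable lborel"
    unfolding F_def using borel_measurable_continuous_on_indicator[OF borel_open[OF open_Dball] cont] by simp
  have "bounded (h ` Dbar)"
    by (intro compact_imp_bounded compact_continuous_image h compact_Dbar)
  then obtain B where B: "\<And>v. v \<in> Dbar \<Longrightarrow> \<bar>h v\<bar> \<le> B"
    unfolding bounded_iff by auto
  have "integrable lborel (\<lambda>v :: 'n cmat. B * (indicat_real Dball v *\<^sub>R weight v powr \<alpha>))"
    using weight_powr_integrable[OF \<alpha>, where 'n='n] unfolding set_integrable_def by simp
  then have int: "integrable lborel F"
  proof (rule Bochner_Integration.integrable_bound[OF _ meas], intro AE_I2)
    fix v
    show "norm (F v) \<le> norm (B * (indicat_real Dball v *\<^sub>R weight v powr \<alpha>))"
    proof (cases "v \<in> Dball")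
      case True
      then have "\<bar>h v\<bar> \<le> \<bar>B\<bar>" using B[of v] Dball_subset_Dbar by force
      then show ?thesis using True by (simp add: F_def abs_mult mult_right_mono)
    qed (simp add: F_def)
  qed
  have F_nonneg: "0 \<le> F v" for v using nonneg by (simp add: F_def indicator_def)
  have "AE v in lborel. F v = 0"
    using integral_nonneg_eq_0_iff_AE[OF int] F_nonneg 0 by (simp add: F_def[abs_def] set_lebesgue_integral_def)
  show "\<forall>v\<in>Dball. h v = 0"
  proof (rule ballI, rule ccontr)
    fix v0 assume v0: "v0 \<in> Dball" "h v0 \<noteq> 0"
    have "open {v \<in> Dball. 0 < h v * weight v powr \<alpha>}"
    proof -
      have "{v \<in> Dball. 0 < h v * weight v powr \<alpha>} = (\<lambda>v. h v * weight v powr \<alpha>) -` {0<..} \<inter> Dball" by auto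
      then show ?thesis using continuous_on_open_vimage[OF open_Dball, THEN iffD1, OF cont] by auto
    qed
    moreover have "v0 \<in> {v \<in> Dball. 0 < h v * weight v powr \<alpha>}"
      using v0 nonneg[OF v0(1)] weight_pos[OF v0(1)] by simp
    ultimately obtain e where e: "0 < e" "ball v0 e \<subseteq> {v \<in> Dball. 0 < h v * weight v powr \<alpha>}"
      by (rule openE)
    have "AE v in lborel. v \<notin> ball v0 e"
      using \<open>AE v in lborel. F v = 0\<close>
    proof eventually_elim
      case (elim v)
      then show ?case using e(2) by (auto simp: F_def)
    qed
    then have "emeasure lborel (ball v0 e) = 0"
      by (subst (asm) AE_iff_measurable[of "ball v0 e"]) auto
    then show False using e(1) by (simp add: emeasure_ball unit_ball_vol_pos less_imp_neq[symmetric])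
  qed
next
  assume "\<forall>v\<in>Dball. h v = 0"
  then have "(LINT v:Dball|lborel. h v * weight v powr \<alpha>) = (LINT v:(Dball :: 'n cmat set)|lborel. 0)"
    by (intro set_lebesgue_integral_cong) (auto simp: borel_open open_Dball)
  then show "(LINT v:Dball|lborel. h v * weight v powr \<alpha>) = 0" by simp
qed

lemma zero_in_Dball: "0 \<in> Dball"
  by (simp add: Dball_iff)

text \<open>With \<open>kappa = 0\<close> the division would make every convolution 0. Substituting
  the adjoint turns \<open>madj v ** v\<close> in the definition of \<open>kappa\<close> into the
  argument of \<open>weight\<close>.\<close>

lemma kappa_nonzero:
  assumes "\<mu> > rho_C TYPE('n::finite) - 1"
  shows "kappa TYPE('n) \<mu> \<noteq> 0"
proof -
  let ?\<alpha> = "\<mu> - rho_C TYPE('n)"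
  have "continuous_on Dball (\<lambda>v :: 'n cmat. weight v powr ?\<alpha>)"
    by (intro continuous_intros continuous_on_weight) (auto dest: weight_pos)
  then have "kappa TYPE('n) \<mu> = (LINT v:(Dball :: 'n cmat set)|lborel. 1 * weight v powr ?\<alpha>)"
    using set_integral_Dball_substitution[OF orthogonal_transformation_madj, of "\<lambda>v :: 'n cmat. weight v powr ?\<alpha>"]
    by (simp add: kappa_def weight_def)
  then show ?thesis
    using weighted_integral_eq_0_iff[of ?\<alpha> "\<lambda>v :: 'n cmat. 1"] assms zero_in_Dball by force
qed

lemma conv_pt_eq_0_iff:
  fixes r s :: "'n::finite cmat"
  assumes \<mu>: "\<mu> > rho_C TYPE('n) - 1" and rs: "psd r" "psd s"
    and f: "continuous_on PiCone f" "\<And>x. x \<in> PiCone \<Longrightarrow> 0 \<le> f x"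
  shows "conv_pt \<mu> r s f = 0 \<longleftrightarrow> (\<forall>v\<in>Dball. f (psd_sqrt (Mconv r s v)) = 0)"
proof -
  have "0 \<le> f (psd_sqrt (Mconv r s v))" if "v \<in> Dball" for v
    using that Dball_subset_Dbar by (intro f(2)) (auto simp: PiCone_def psd_psd_sqrt psd_Mconv rs)
  then show ?thesis
    unfolding conv_pt_eq using kappa_nonzero[OF \<mu>] \<mu>
    by (simp add: weighted_integral_eq_0_iff[OF _ continuous_on_conv_integrand[OF rs f(1)]])
qed

section \<open>Supports as images of the closed ball\<close>

lemma closure_Dball: "closure Dball = (Dbar :: 'n::finite cmat set)"
proof
  show "closure Dball \<subseteq> (Dbar :: 'n cmat set)"
    by (simp add: closure_minimal Dball_subset_Dbar compact_imp_closed compact_Dbar)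
  show "(Dbar :: 'n cmat set) \<subseteq> closure Dball"
  proof
    fix v :: "'n cmat" assume v: "v \<in> Dbar"
    have "(\<lambda>n. (1 - inverse (real (Suc n))) *\<^sub>R v) \<longlonglongrightarrow> (1 - 0) *\<^sub>R v"
      by (intro tendsto_intros LIMSEQ_inverse_real_of_nat)
    moreover have "(1 - inverse (real (Suc n))) *\<^sub>R v \<in> Dball" for n
      unfolding Dball_iff
    proof (intro allI impI)
      fix x :: "complex ^ 'n" assume x: "x \<noteq> 0"
      define t where "t = 1 - inverse (real (Suc n))"
      have t: "0 \<le> t" "t < 1" by (auto simp: t_def field_simps)
      have "norm ((t *\<^sub>R v) *v x) = t * norm (v *v x)" using t by (simp add: matrix_scaleR_vector)
      also have "\<dots> \<le> t * norm x" using v t by (intro mult_left_mono) (auto simp: Dbar_def)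
      also have "\<dots> < norm x" using t x by simp
      finally show "norm ((1 - inverse (real (Suc n))) *\<^sub>R v *v x) < norm x" by (simp add: t_def)
    qed
    ultimately show "v \<in> closure Dball" unfolding closure_sequential by force
  qed
qed

definition conv_supp :: "'n::finite cmat \<Rightarrow> 'n cmat \<Rightarrow> 'n cmat set" where
  "conv_supp r s = (\<lambda>v. psd_sqrt (Mconv r s v)) ` Dbar"

lemma compact_conv_supp: "psd r \<Longrightarrow> psd s \<Longrightarrow> compact (conv_supp r s)"
  unfolding conv_supp_def by (intro compact_continuous_image continuous_on_sqrt_Mconv compact_Dbar)

lemma conv_supp_psd: "psd r \<Longrightarrow> psd s \<Longrightarrow> conv_supp r s \<subseteq> PiCone"
  by (auto simp: conv_supp_def PiCone_def psd_psd_sqrt psd_Mconv)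

lemma bump_function_exists:
  fixes p :: "'n::finite cmat"
  assumes "closed Z" "p \<notin> Z"
  obtains f where "f \<in> Cc_Pi" "\<And>x. 0 \<le> f x" "\<And>x. x \<in> Z \<Longrightarrow> f x = 0" "f p \<noteq> 0"
proof -
  obtain e where e: "0 < e" "ball p e \<subseteq> - Z"
    using assms open_contains_ball[of "- Z"] by (auto simp: open_Compl)
  define f where "f x = max 0 (e - dist x p)" for x
  have "f \<in> Cc_Pi"
    unfolding Cc_Pi_def
  proof (intro CollectI conjI exI[of _ "PiCone \<inter> cball p e"] ballI)
    show "continuous_on PiCone f" unfolding f_def by (intro continuous_intros)
    show "compact (PiCone \<inter> cball p e)" by (intro closed_Int_compact closed_PiCone compact_cball)
    show "f x = 0" if "x \<in> PiCone - PiCone \<inter> cball p e" for x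
      using that by (auto simp: f_def dist_commute)
  qed simp
  moreover have "f x = 0" if "x \<in> Z" for x
  proof -
    have "x \<notin> ball p e" using that e(2) by blast
    then show ?thesis by (simp add: f_def dist_commute)
  qed
  ultimately show ?thesis using e(1) by (intro that[of f]) (auto simp: f_def)
qed

text \<open>A nonnegative test function has convolution integral 0 exactly when it vanishes at all
  points with parameter in \<open>Dball\<close>, and this is preserved by \<open>T\<close>. A bump
  at a point outside the other, closed set gives each inclusion on \<open>Dball\<close>; continuity
  extends it to the closure \<open>Dbar\<close>.\<close>

lemma hypergroup_aut_conv_supp:
  fixes T :: "'n::finite cmat \<Rightarrow> 'n cmat"
  assumes \<mu>: "\<mu> > rho_C TYPE('n) - 1" and T: "hypergroup_aut \<mu> T" and rs: "psd r" "psd s"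
  shows "T ` conv_supp r s = conv_supp (T r) (T s)"
proof -
  obtain T' where hom: "homeomorphism PiCone PiCone T T'"
    and conv: "\<And>x y f. x \<in> PiCone \<Longrightarrow> y \<in> PiCone \<Longrightarrow> f \<in> Cc_Pi \<Longrightarrow> conv_pt \<mu> x y (f \<circ> T) = conv_pt \<mu> (T x) (T y) f"
    using T unfolding hypergroup_aut_def by blast
  have T_cont: "continuous_on PiCone T" and T_img: "T ` PiCone = PiCone"
    using hom by (auto simp: homeomorphism_def)
  have Trs: "psd (T r)" "psd (T s)" using T_img rs by (auto simp: PiCone_def)
  have zero_iff: "(\<forall>v\<in>Dball. f (T (psd_sqrt (Mconv r s v))) = 0) \<longleftrightarrow> (\<forall>v\<in>Dball. f (psd_sqrt (Mconv (T r) (T s) v)) = 0)"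
    if f: "f \<in> Cc_Pi" "\<And>x. 0 \<le> f x" for f
  proof -
    have fc: "continuous_on PiCone f" using f by (simp add: Cc_Pi_def)
    then have "continuous_on PiCone (f \<circ> T)" using T_cont T_img by (metis continuous_on_compose)
    then show ?thesis
      using conv_pt_eq_0_iff[OF \<mu> rs, of "f \<circ> T"] conv_pt_eq_0_iff[OF \<mu> Trs fc] f conv[of r s f] rs
      by (simp add: PiCone_def)
  qed
  have T_supp: "continuous_on (conv_supp r s) T"
    by (rule continuous_on_subset[OF T_cont conv_supp_psd[OF rs]])
  have cl1: "closed (T ` conv_supp r s)"
    by (intro compact_imp_closed compact_continuous_image T_supp compact_conv_supp rs)
  have cl2: "closed (conv_supp (T r) (T s))"
    by (intro compact_imp_closed compact_conv_supp Trs)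
  have "psd_sqrt (Mconv (T r) (T s) v) \<in> T ` conv_supp r s" if v: "v \<in> Dball" for v
  proof (rule ccontr)
    assume "psd_sqrt (Mconv (T r) (T s) v) \<notin> T ` conv_supp r s"
    then obtain f where f: "f \<in> Cc_Pi" "\<And>x. 0 \<le> f x" "\<And>x. x \<in> T ` conv_supp r s \<Longrightarrow> f x = 0"
        "f (psd_sqrt (Mconv (T r) (T s) v)) \<noteq> 0"
      using bump_function_exists[OF cl1] by metis
    have "\<forall>v\<in>Dball. f (T (psd_sqrt (Mconv r s v))) = 0"
      using Dball_subset_Dbar by (auto intro!: f(3) simp: conv_supp_def)
    then show False using zero_iff[OF f(1,2)] f(4) v by blast
  qed
  then have sub1: "(\<lambda>v. psd_sqrt (Mconv (T r) (T s) v)) ` closure Dball \<subseteq> T ` conv_supp r s"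
    by (intro image_closure_subset cl1) (auto simp: closure_Dball continuous_on_sqrt_Mconv Trs)
  have "T (psd_sqrt (Mconv r s v)) \<in> conv_supp (T r) (T s)" if v: "v \<in> Dball" for v
  proof (rule ccontr)
    assume "T (psd_sqrt (Mconv r s v)) \<notin> conv_supp (T r) (T s)"
    then obtain f where f: "f \<in> Cc_Pi" "\<And>x. 0 \<le> f x" "\<And>x. x \<in> conv_supp (T r) (T s) \<Longrightarrow> f x = 0"
        "f (T (psd_sqrt (Mconv r s v))) \<noteq> 0"
      using bump_function_exists[OF cl2] by metis
    have "\<forall>v\<in>Dball. f (psd_sqrt (Mconv (T r) (T s) v)) = 0"
      using Dball_subset_Dbar by (auto intro!: f(3) simp: conv_supp_def)
    then show False using zero_iff[OF f(1,2)] f(4) v by blast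
  qed
  moreover have "continuous_on Dbar (\<lambda>v. T (psd_sqrt (Mconv r s v)))"
    by (rule continuous_on_conv_integrand[OF rs T_cont])
  ultimately have sub2: "(\<lambda>v. T (psd_sqrt (Mconv r s v))) ` closure Dball \<subseteq> conv_supp (T r) (T s)"
    by (intro image_closure_subset cl2) (auto simp: closure_Dball)
  show ?thesis
    using sub1 sub2 by (auto simp: closure_Dball conv_supp_def image_image)
qed

section \<open>Maps of rays\<close>

text \<open>The distances to 0 and 1 determine \<open>Re (g z)\<close>, and \<open>Im (g z)\<close>
  up to sign. The distance to \<open>\<i>\<close> shows that this sign is the same for all
  \<open>z\<close>.\<close>

lemma isometry_complex_cases:
  fixes g :: "complex \<Rightarrow> complex"
  assumes iso: "\<And>z w. cmod (g z - g w) = cmod (z - w)" and g: "g 0 = 0" "g 1 = 1"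
  shows "(\<forall>z. g z = z) \<or> (\<forall>z. g z = cnj z)"
proof -
  have sq: "(Re (g z) - Re (g w))\<^sup>2 + (Im (g z) - Im (g w))\<^sup>2 = (Re z - Re w)\<^sup>2 + (Im z - Im w)\<^sup>2" for z w
    using arg_cong[OF iso[of z w], of "\<lambda>x. x\<^sup>2"] by (simp add: cmod_power2)
  have Re: "Re (g z) = Re z" and Im: "(Im (g z))\<^sup>2 = (Im z)\<^sup>2" for z
  proof -
    have 0: "(Re (g z))\<^sup>2 + (Im (g z))\<^sup>2 = (Re z)\<^sup>2 + (Im z)\<^sup>2" using sq[of z 0] g by simp
    moreover have "(Re (g z) - 1)\<^sup>2 + (Im (g z))\<^sup>2 = (Re z - 1)\<^sup>2 + (Im z)\<^sup>2" using sq[of z 1] g by simp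
    ultimately show "Re (g z) = Re z" by (simp add: power2_diff)
    with 0 show "(Im (g z))\<^sup>2 = (Im z)\<^sup>2" by simp
  qed
  have cross: "Im (g z) * Im (g \<i>) = Im z" for z
    using sq[of z \<i>] Re[of z] Re[of \<i>] Im[of z] Im[of \<i>] by (simp add: power2_diff)
  have "Im (g \<i>) = 1 \<or> Im (g \<i>) = - 1" using Im[of \<i>] by (simp add: power2_eq_1_iff)
  then show ?thesis
  proof
    assume "Im (g \<i>) = 1"
    then have "g z = z" for z using cross[of z] Re[of z] by (simp add: complex_eq_iff)
    then show ?thesis by blast
  next
    assume "Im (g \<i>) = - 1"
    then have "g z = cnj z" for z using cross[of z] Re[of z] by (simp add: complex_eq_iff)
    then show ?thesis by blast
  qed
qed

text \<open>Stated for the pair rather than for the set of the two vectors, so that equal vectors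
  count as dependent.\<close>

definition indep2 :: "complex ^ 'n \<Rightarrow> complex ^ 'n \<Rightarrow> bool" where
  "indep2 x y \<longleftrightarrow> (\<forall>a b. a *s x + b *s y = 0 \<longrightarrow> a = 0 \<and> b = 0)"

lemma indep2_scale: "indep2 x y \<Longrightarrow> a \<noteq> 0 \<Longrightarrow> b \<noteq> 0 \<Longrightarrow> indep2 (a *s x) (b *s y)"
  unfolding indep2_def vector_smult_assoc by (metis mult_eq_0_iff)

lemma indep2_sym: "indep2 x y \<Longrightarrow> indep2 y x"
  unfolding indep2_def by (metis add.commute)

lemma not_indep2E:
  assumes "\<not> indep2 x y" "y \<noteq> 0" obtains c where "x = c *s y"
proof -
  obtain a b where ab: "a *s x + b *s y = 0" "a \<noteq> 0 \<or> b \<noteq> 0" using assms(1) unfolding indep2_def by auto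
  have "a \<noteq> 0"
  proof
    assume "a = 0"
    then show False using ab assms(2) by (simp add: vec.scale_eq_0_iff)
  qed
  have "a *s x = (- b) *s y" using ab(1) by (simp add: eq_neg_iff_add_eq_0)
  then have "(1 / a) *s (a *s x) = (1 / a) *s ((- b) *s y)" by simp
  then have "x = (- b / a) *s y" using \<open>a \<noteq> 0\<close> by (simp add: vector_smult_assoc)
  then show ?thesis by (rule that)
qed

lemma indep2_nonzero: "indep2 x y \<Longrightarrow> x \<noteq> 0" "indep2 x y \<Longrightarrow> y \<noteq> 0"
  unfolding indep2_def by (metis add_0 vec.scale_zero_right zero_neq_one add.right_neutral vec.scale_zero_left)+

lemma cmod_1_nonzero: "cmod c = 1 \<Longrightarrow> c \<noteq> 0" by auto

lemma unimodular_scale_cancel: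
  assumes "cmod d = 1" "x = d *s y" shows "y = (1 / d) *s (x :: complex ^ 'n)"
  using assms by (auto simp: vector_smult_assoc)

text \<open>A vector \<open>x\<close> stands for the matrix \<open>x x\<^sup>*\<close>, so \<open>\<phi>\<close> is meaningful only up to phases.\<close>

locale ray_map =
  fixes \<phi> :: "complex ^ 'n::finite \<Rightarrow> complex ^ 'n"
  assumes scale: "\<exists>c. cmod c = 1 \<and> \<phi> (a *s x) = c *s (a *s \<phi> x)"
    and inj: "cmod c = 1 \<Longrightarrow> \<phi> y = c *s \<phi> x \<Longrightarrow> \<exists>d. cmod d = 1 \<and> y = d *s x"
    and add: "indep2 x y \<Longrightarrow> indep2 (\<phi> x) (\<phi> y) \<Longrightarrow> \<exists>c d. cmod c = 1 \<and> cmod d = 1 \<and> \<phi> (x + y) = c *s \<phi> x + d *s \<phi> y"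
    and add_inv: "indep2 x y \<Longrightarrow> cmod c = 1 \<Longrightarrow> cmod d = 1 \<Longrightarrow> \<phi> z = c *s \<phi> x + d *s \<phi> y \<Longrightarrow> \<exists>a b. z = a *s x + b *s y"
begin

lemma zero: "\<phi> 0 = 0"
  using scale[of 0 0] by auto

lemma multiple_inv:
  assumes "\<phi> y = b *s \<phi> x" shows "\<exists>d. y = d *s x"
proof -
  obtain c where c: "cmod c = 1" "\<phi> (b *s x) = c *s (b *s \<phi> x)" using scale by blast
  have "cmod (1 / c) = 1" using c(1) by (simp add: norm_divide)
  moreover have "\<phi> y = (1 / c) *s \<phi> (b *s x)" using unimodular_scale_cancel[OF c] assms by simp
  ultimately obtain d where "y = d *s (b *s x)" using inj by blast
  then show ?thesis by (auto simp: vector_smult_assoc)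
qed

lemma eq_0_iff: "\<phi> x = 0 \<longleftrightarrow> x = 0"
proof
  assume "\<phi> x = 0"
  then have "\<phi> x = 1 *s \<phi> 0" by (simp add: zero)
  then show "x = 0" using multiple_inv by fastforce
qed (simp add: zero)

text \<open>Discharges the second premise of \<open>add\<close>: a dependence between the images
  pulls back along \<open>multiple_inv\<close>.\<close>

lemma indep: "indep2 x y \<Longrightarrow> indep2 (\<phi> x) (\<phi> y)"
proof (rule ccontr)
  assume xy: "indep2 x y" and "\<not> indep2 (\<phi> x) (\<phi> y)"
  moreover have "\<phi> y \<noteq> 0" using indep2_nonzero[OF xy] eq_0_iff by simp
  ultimately obtain c where "\<phi> x = c *s \<phi> y" using not_indep2E by metis
  then obtain d where "x = d *s y" using multiple_inv by blast
  then have "1 *s x + (- d) *s y = 0" by simp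
  then show False using xy unfolding indep2_def by fastforce
qed

lemma combination:
  assumes "indep2 x y"
  shows "\<exists>c d. cmod c = 1 \<and> cmod d = 1 \<and> \<phi> (a *s x + b *s y) = c *s (a *s \<phi> x) + d *s (b *s \<phi> y)"
proof -
  obtain c where c: "cmod c = 1" "\<phi> (a *s x) = c *s (a *s \<phi> x)" using scale by blast
  obtain d where d: "cmod d = 1" "\<phi> (b *s y) = d *s (b *s \<phi> y)" using scale by blast
  show ?thesis
  proof (cases "a = 0 \<or> b = 0")
    case True
    then show ?thesis using c d by (intro exI[of _ c] exI[of _ d]) auto
  next
    case False
    then have i: "indep2 (a *s x) (b *s y)" using indep2_scale[OF assms] by simp
    obtain c' d' where cd: "cmod c' = 1" "cmod d' = 1" "\<phi> (a *s x + b *s y) = c' *s \<phi> (a *s x) + d' *s \<phi> (b *s y)"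
      using add[OF i indep[OF i]] by blast
    then have "\<phi> (a *s x + b *s y) = (c' * c) *s (a *s \<phi> x) + (d' * d) *s (b *s \<phi> y)"
      unfolding cd c d by (simp add: vector_smult_assoc mult.assoc)
    moreover have "cmod (c' * c) = 1" "cmod (d' * d) = 1" using c d cd by (simp_all add: norm_mult)
    ultimately show ?thesis by blast
  qed
qed

text \<open>Nonzero coefficients are absorbed into the vectors by \<open>scale\<close>, which leaves
  the unimodular coefficients required by \<open>add_inv\<close>.\<close>

lemma combination_inv:
  assumes xy: "indep2 x y" and z: "\<phi> z = a *s \<phi> x + b *s \<phi> y"
  shows "\<exists>a b. z = a *s x + b *s y"
proof (cases "a = 0 \<or> b = 0")
  case True
  then consider "\<phi> z = b *s \<phi> y" | "\<phi> z = a *s \<phi> x" using z by auto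
  then show ?thesis
  proof cases
    case 1
    then obtain d where "z = d *s y" using multiple_inv by blast
    then have "z = 0 *s x + d *s y" by simp
    then show ?thesis by blast
  next
    case 2
    then obtain d where "z = d *s x" using multiple_inv by blast
    then have "z = d *s x + 0 *s y" by simp
    then show ?thesis by blast
  qed
next
  case False
  obtain c where c: "cmod c = 1" "\<phi> (a *s x) = c *s (a *s \<phi> x)" using scale by blast
  obtain d where d: "cmod d = 1" "\<phi> (b *s y) = d *s (b *s \<phi> y)" using scale by blast
  have i: "indep2 (a *s x) (b *s y)" using False indep2_scale[OF xy] by simp
  have "\<phi> z = (1 / c) *s \<phi> (a *s x) + (1 / d) *s \<phi> (b *s y)"
    using z unimodular_scale_cancel[OF c] unimodular_scale_cancel[OF d] by simp
  then obtain a' b' where "z = a' *s (a *s x) + b' *s (b *s y)"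
    using add_inv[OF i] c(1) d(1) by (metis norm_divide norm_one div_by_1)
  then show ?thesis by (auto simp: vector_smult_assoc)
qed

text \<open>Dividing \<open>\<phi> (e + w) = c *s \<phi> e + d *s \<phi> w\<close> by
  \<open>c\<close> gives \<open>\<phi> e\<close> the coefficient 1. The vector \<open>v\<close> is
  thereby a representative of the ray of \<open>\<phi> w\<close> with its phase fixed relative to
  \<open>\<phi> e\<close>.\<close>

lemma affine_part:
  fixes k :: 'n
  defines "e \<equiv> axis k 1" and "W \<equiv> {w. w $ k = 0}"
  assumes "w \<in> W"
  shows "\<exists>v. (\<exists>g. cmod g = 1 \<and> v = g *s \<phi> w) \<and> (\<exists>d. cmod d = 1 \<and> \<phi> (e + w) = d *s (\<phi> e + v))"
proof (cases "w = 0")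
  case True
  then show ?thesis by (intro exI[of _ 0] conjI exI[of _ 1]) (auto simp: zero)
next
  case False
  have "indep2 e w"
    unfolding indep2_def
  proof (intro allI impI)
    fix a b assume ab: "a *s e + b *s w = 0"
    then have "(a *s e + b *s w) $ k = 0" by simp
    then have "a = 0" using \<open>w \<in> W\<close> by (simp add: W_def e_def axis_def)
    then show "a = 0 \<and> b = 0" using ab False by (simp add: vec.scale_eq_0_iff)
  qed
  then obtain c d where cd: "cmod c = 1" "cmod d = 1" "\<phi> (e + w) = c *s \<phi> e + d *s \<phi> w"
    using combination[of e w 1 1] by auto
  then have "\<phi> (e + w) = c *s (\<phi> e + (d / c) *s \<phi> w)" "cmod (d / c) = 1"
    by (auto simp: vector_smult_assoc norm_divide vec.scale_right_distrib)
  then show ?thesis using cd(1) by blast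
qed

text \<open>A Wigner-type theorem. The normalised representatives \<open>G w\<close> on the
  hyperplane \<open>W\<close> satisfy addition with a single phase; they turn out to be additive and
  to commute with scalars up to one global \<open>\<kappa>\<close>, and \<open>\<phi> e\<close>
  supplies the remaining column.\<close>

theorem linear_or_conjugate_linear:
  obtains a :: "'n cmat" and \<kappa> :: "complex \<Rightarrow> complex" where "\<kappa> = id \<or> \<kappa> = cnj"
    and "\<And>x. \<exists>c. cmod c = 1 \<and> \<phi> x = c *s (a *v (\<chi> i. \<kappa> (x $ i)))"
proof -
  fix k :: 'n
  define e where "e = (axis k 1 :: complex ^ 'n)"
  define W where "W = {w :: complex ^ 'n. w $ k = 0}"
  have W: "u + w \<in> W" "u - w \<in> W" "c *s w \<in> W" "0 \<in> W" if "u \<in> W" "w \<in> W" for u w c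
    using that by (auto simp: W_def)
  have ek: "e $ k = 1" by (simp add: e_def)
  have "\<forall>w\<in>W. \<exists>v. (\<exists>g. cmod g = 1 \<and> v = g *s \<phi> w) \<and> (\<exists>d. cmod d = 1 \<and> \<phi> (e + w) = d *s (\<phi> e + v))"
    using affine_part[of _ k] by (auto simp: W_def e_def)
  then obtain G where G1: "\<And>w. w \<in> W \<Longrightarrow> \<exists>g. cmod g = 1 \<and> G w = g *s \<phi> w"
    and G2: "\<And>w. w \<in> W \<Longrightarrow> \<exists>d. cmod d = 1 \<and> \<phi> (e + w) = d *s (\<phi> e + G w)"
    by metis
  have G0: "G 0 = 0" using G1[of 0] zero by (auto simp: W_def)
  have G_nonzero: "G w \<noteq> 0" if "w \<in> W" "w \<noteq> 0" for w
    using G1[OF that(1)] that(2) eq_0_iff[of w] by (auto simp: vec.scale_eq_0_iff)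

  have G_add: "\<exists>c. cmod c = 1 \<and> G (u + w) = G u + c *s G w" if u: "u \<in> W" and w: "w \<in> W" "w \<noteq> 0" for u w
  proof -
    have "indep2 (e + u) w"
      unfolding indep2_def
    proof (intro allI impI)
      fix a b assume ab: "a *s (e + u) + b *s w = 0"
      then have "(a *s (e + u) + b *s w) $ k = 0" by simp
      then have "a = 0" using u w by (simp add: W_def ek)
      then show "a = 0 \<and> b = 0" using ab w by (simp add: vec.scale_eq_0_iff)
    qed
    then obtain c1 c2 where c: "cmod c1 = 1" "cmod c2 = 1" "\<phi> (e + u + w) = c1 *s \<phi> (e + u) + c2 *s \<phi> w"
      using combination[of "e + u" w 1 1] by auto
    obtain d where d: "cmod d = 1" "\<phi> (e + (u + w)) = d *s (\<phi> e + G (u + w))" using G2[OF W(1)[OF u w(1)]] by blast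
    obtain d' where d': "cmod d' = 1" "\<phi> (e + u) = d' *s (\<phi> e + G u)" using G2[OF u] by blast
    obtain g where g: "cmod g = 1" "G w = g *s \<phi> w" using G1[OF w(1)] by blast
    define k1 where "k1 = c1 * d' / d"
    define k2 where "k2 = c2 / (g * d)"
    have k: "cmod k1 = 1" "cmod k2 = 1" using c d d' g by (auto simp: k1_def k2_def norm_mult norm_divide)
    have "\<phi> e + G (u + w) = (1 / d) *s \<phi> (e + u + w)"
      using unimodular_scale_cancel[OF d] by (simp add: add.assoc)
    also have "\<dots> = k1 *s (\<phi> e + G u) + k2 *s G w"
      using g(1) unfolding c(3) d'(2) g(2) k1_def k2_def
      by (auto simp: vector_smult_assoc vec.scale_right_distrib mult_ac)
    finally have eq: "\<phi> e + G (u + w) = k1 *s (\<phi> e + G u) + k2 *s G w" .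
    obtain g' where g': "G u = g' *s \<phi> u" using G1[OF u] by blast
    obtain g'' where g'': "G (u + w) = g'' *s \<phi> (u + w)" using G1[OF W(1)[OF u w(1)]] by blast
    \<comment> \<open>Otherwise \<open>\<phi> e\<close> could be solved for in terms of
      \<open>\<phi> u\<close> and \<open>\<phi> w\<close>; pulling this back would put
      \<open>e\<close> into \<open>W\<close>.\<close>
    have "k1 = 1"
    proof (rule ccontr)
      assume k1: "k1 \<noteq> 1"
      have e_eq: "(1 - k1) *s \<phi> e = k1 *s G u + k2 *s G w - G (u + w)"
        using eq by (simp add: algebra_simps vec.scale_left_diff_distrib vec.scale_right_distrib)
      have e_eq': "\<phi> e = (1 / (1 - k1)) *s (k1 *s G u + k2 *s G w - G (u + w))"
        unfolding e_eq[symmetric] vector_smult_assoc using k1 by simp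
      show False
      proof (cases "indep2 u w")
        case True
        obtain a b where ab: "\<phi> (u + w) = a *s \<phi> u + b *s \<phi> w"
          using combination[OF True, of 1 1] by auto
        have "\<phi> e = ((1 / (1 - k1)) * (k1 * g' - g'' * a)) *s \<phi> u + ((1 / (1 - k1)) * (k2 * g - g'' * b)) *s \<phi> w"
          unfolding e_eq' g' g'' g(2) ab
          by (simp add: vec_eq_iff algebra_simps)
        then obtain a' b' where "e = a' *s u + b' *s w" using combination_inv[OF True] by blast
        then have "e $ k = (a' *s u + b' *s w) $ k" by simp
        then show False using u w ek by (simp add: W_def)
      next
        case False
        then obtain \<gamma> where \<gamma>: "u = \<gamma> *s w" using not_indep2E w(2) by metis
        obtain a where a: "\<phi> u = a *s \<phi> w" using scale[of \<gamma> w] unfolding \<gamma> by (auto simp: vector_smult_assoc)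
        have "u + w = (\<gamma> + 1) *s w" by (simp add: \<gamma> vec.scale_left_distrib)
        then obtain b where b: "\<phi> (u + w) = b *s \<phi> w" using scale[of "\<gamma> + 1" w] by (metis vector_smult_assoc)
        have "\<phi> e = ((1 / (1 - k1)) * (k1 * g' * a + k2 * g - g'' * b)) *s \<phi> w"
          unfolding e_eq' g' g'' g(2) a b
          by (simp add: vec_eq_iff algebra_simps)
        then obtain b' where "e = b' *s w" using multiple_inv by blast
        then have "e $ k = (b' *s w) $ k" by simp
        then show False using w ek by (simp add: W_def)
      qed
    qed
    then show ?thesis using eq k(2) by auto
  qed

  have G_line: "(\<forall>z. G (z *s y) = z *s G y) \<or> (\<forall>z. G (z *s y) = cnj z *s G y)" if y: "y \<in> W" "y \<noteq> 0" for y
  proof -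
    have "\<exists>b. cmod b = cmod z \<and> G (z *s y) = b *s G y" for z
    proof -
      obtain g where g: "cmod g = 1" "G (z *s y) = g *s \<phi> (z *s y)" using G1[OF W(3)[OF y(1) y(1)]] by blast
      obtain g' where g': "cmod g' = 1" "G y = g' *s \<phi> y" using G1 y by blast
      obtain c where c: "cmod c = 1" "\<phi> (z *s y) = c *s (z *s \<phi> y)" using scale by blast
      have "G (z *s y) = (g * c * z / g') *s G y"
        using g'(1) unfolding g(2) c(2) g'(2) by (auto simp: vector_smult_assoc)
      moreover have "cmod (g * c * z / g') = cmod z" using g g' c by (simp add: norm_mult norm_divide)
      ultimately show ?thesis by blast
    qed
    then obtain g where g: "\<And>z. cmod (g z) = cmod z" "\<And>z. G (z *s y) = g z *s G y" by metis
    have Gy: "G y \<noteq> 0" using G_nonzero y by blast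
    have cancel: "a = b" if "a *s G y = b *s G y" for a b
      using that Gy by (simp add: vec.scale_cancel_right)
    have g01: "g 0 = 0" "g 1 = 1"
      using g(1)[of 0] g(2)[of 1] cancel[of "g 1" 1] by auto
    \<comment> \<open>Moving from \<open>w *s y\<close> to \<open>z *s y\<close> adds
      \<open>(z - w) *s y\<close>; by \<open>G_add\<close> its image enters with a unimodular
      factor, so the displacement keeps its length.\<close>
    have "cmod (g z - g w) = cmod (z - w)" for z w
    proof (cases "z = w")
      case False
      then have "(z - w) *s y \<noteq> 0" using y by (simp add: vec.scale_eq_0_iff)
      then obtain c where c: "cmod c = 1" "G (w *s y + (z - w) *s y) = G (w *s y) + c *s G ((z - w) *s y)"
        using G_add[OF W(3)[OF y(1) y(1)] W(3)[OF y(1) y(1)], of "z - w" w] by blast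
      have zy: "w *s y + (z - w) *s y = z *s y" by (simp add: vec_eq_iff algebra_simps)
      have "g z *s G y = (g w + c * g (z - w)) *s G y"
        using c(2)[unfolded zy g(2)] by (simp add: vector_smult_assoc vec.scale_left_distrib)
      from cancel[OF this] have "g z - g w = c * g (z - w)" by simp
      then show ?thesis using c(1) g(1) by (simp add: norm_mult)
    qed simp
    then have "(\<forall>z. g z = z) \<or> (\<forall>z. g z = cnj z)" using isometry_complex_cases g01 by blast
    then show ?thesis using g(2) by auto
  qed

  have G_indep: "indep2 (G u) (G w)" if uw: "u \<in> W" "w \<in> W" "indep2 u w" for u w
  proof -
    obtain g where "cmod g = 1" "G u = g *s \<phi> u" using G1[OF uw(1)] by blast
    moreover obtain h where "cmod h = 1" "G w = h *s \<phi> w" using G1[OF uw(2)] by blast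
    ultimately show ?thesis using indep2_scale[OF indep[OF uw(3)], of g h] cmod_1_nonzero by simp
  qed
  have G_add_indep: "G (u + w) = G u + G w" if uw: "u \<in> W" "w \<in> W" "indep2 u w" for u w
  proof -
    have nz: "u \<noteq> 0" "w \<noteq> 0" using indep2_nonzero[OF uw(3)] by auto
    obtain c where c: "G (u + w) = G u + c *s G w" using G_add[OF uw(1,2) nz(2)] by blast
    obtain d where d: "G (w + u) = G w + d *s G u" using G_add[OF uw(2,1) nz(1)] by blast
    \<comment> \<open>Adding in either order gives two expansions of one vector; independence of
      \<open>G u\<close> and \<open>G w\<close> forces equal coefficients.\<close>
    have "(1 - d) *s G u + (c - 1) *s G w = (G u + c *s G w) - (G w + d *s G u)"
      by (simp add: vec_eq_iff algebra_simps)
    also have "\<dots> = 0" using c d by (simp add: add.commute)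
    finally have "c - 1 = 0" using G_indep[OF uw] unfolding indep2_def by blast
    then show ?thesis using c by simp
  qed

  have "\<exists>\<kappa>. (\<kappa> = id \<or> \<kappa> = cnj) \<and> (\<forall>y\<in>W. \<forall>z. G (z *s y) = \<kappa> z *s G y)"
  proof (rule ccontr)
    assume neg: "\<not> ?thesis"
    then obtain y1 z1 where y1: "y1 \<in> W" "G (z1 *s y1) \<noteq> z1 *s G y1" by (metis id_apply)
    from neg obtain y2 z2 where y2: "y2 \<in> W" "G (z2 *s y2) \<noteq> cnj z2 *s G y2" by metis
    have nz: "y1 \<noteq> 0" "y2 \<noteq> 0" using y1 y2 G0 by auto
    have conj: "G (z *s y1) = cnj z *s G y1" for z using G_line[of y1] y1 nz by blast
    have lin: "G (z *s y2) = z *s G y2" for z using G_line[of y2] y2 nz by blast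
    show False
    proof (cases "indep2 y1 y2")
      case False
      then have "\<not> indep2 y2 y1" using indep2_sym by blast
      then obtain \<gamma> where "y2 = \<gamma> *s y1" using not_indep2E nz by metis
      then have "G (z2 *s y2) = cnj z2 *s G y2"
        by (simp add: vector_smult_assoc conj)
      then show False using y2 by simp
    next
      case True
      have y12: "y1 + y2 \<in> W" "y1 + y2 \<noteq> 0"
      proof -
        show "y1 + y2 \<in> W" by (rule W(1)[OF y1(1) y2(1)])
        have "1 *s y1 + 1 *s y2 \<noteq> 0" using True unfolding indep2_def by (metis zero_neq_one)
        then show "y1 + y2 \<noteq> 0" by simp
      qed
      have sum: "G (y1 + y2) = G y1 + G y2" using G_add_indep y1 y2 True by blast
      have i: "indep2 (\<i> *s y1) (\<i> *s y2)" using indep2_scale[OF True] by simp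
      \<comment> \<open>On the two lines \<open>\<i>\<close> acts as \<open>- \<i>\<close> and as
        \<open>\<i>\<close>, while on the line of \<open>y1 + y2\<close> it must multiply both
        summands by the same factor.\<close>
      have "G (\<i> *s (y1 + y2)) = G (\<i> *s y1) + G (\<i> *s y2)"
        using G_add_indep[OF _ _ i] W y1 y2 by (simp add: vec.scale_right_distrib)
      then have sumi: "G (\<i> *s (y1 + y2)) = (- \<i>) *s G y1 + \<i> *s G y2" by (simp only: conj lin complex_cnj_i)
      have Gi: "indep2 (G y1) (G y2)" using G_indep y1 y2 True by blast
      from G_line[OF y12] show False
      proof
        assume "\<forall>z. G (z *s (y1 + y2)) = z *s G (y1 + y2)"
        then have "(- \<i>) *s G y1 + \<i> *s G y2 = \<i> *s (G y1 + G y2)" using sumi sum by simp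
        then have "(- 2 * \<i>) *s G y1 + 0 *s G y2 = 0" by (simp add: vec_eq_iff algebra_simps)
        then show False using Gi unfolding indep2_def by fastforce
      next
        assume "\<forall>z. G (z *s (y1 + y2)) = cnj z *s G (y1 + y2)"
        then have "(- \<i>) *s G y1 + \<i> *s G y2 = (- \<i>) *s (G y1 + G y2)" using sumi sum by simp
        then have "0 *s G y1 + (2 * \<i>) *s G y2 = 0" by (simp add: vec_eq_iff algebra_simps)
        then show False using Gi unfolding indep2_def by fastforce
      qed
    qed
  qed
  then obtain \<kappa> where \<kappa>: "\<kappa> = id \<or> \<kappa> = cnj" and G_scale: "\<And>y z. y \<in> W \<Longrightarrow> G (z *s y) = \<kappa> z *s G y"
    by blast
  have \<kappa>_add: "\<kappa> (z + w) = \<kappa> z + \<kappa> w" and \<kappa>_mult: "\<kappa> (z * w) = \<kappa> z * \<kappa> w" and \<kappa>_1: "\<kappa> 1 = 1" "\<kappa> 0 = 0"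
    and \<kappa>_norm: "cmod (\<kappa> z) = cmod z" for z w
    using \<kappa> by auto
  have G_additive: "G (u + w) = G u + G w" if "u \<in> W" "w \<in> W" for u w
  proof (cases "w = 0 \<or> indep2 u w")
    case True
    then show ?thesis using G_add_indep that G0 by auto
  next
    case False
    then obtain \<gamma> where \<gamma>: "u = \<gamma> *s w" using not_indep2E by metis
    have uw: "u + w = (\<gamma> + 1) *s w" by (simp add: \<gamma> vec.scale_left_distrib)
    have "G (u + w) = \<kappa> (\<gamma> + 1) *s G w" unfolding uw by (rule G_scale[OF that(2)])
    also have "\<dots> = G u + G w" using that by (simp add: \<kappa>_add \<kappa>_1 \<gamma> G_scale vec.scale_left_distrib)
    finally show ?thesis .
  qed
  have G_sum: "(\<Sum>j\<in>S. w $ j *s axis j 1) \<in> W \<and> G (\<Sum>j\<in>S. w $ j *s axis j 1) = (\<Sum>j\<in>S. \<kappa> (w $ j) *s G (axis j 1))"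
    if "k \<notin> S" for S and w :: "complex ^ 'n"
    using finite[of S] that
  proof (induction S rule: finite_induct)
    case empty
    then show ?case by (simp add: G0 W_def)
  next
    case (insert j S)
    then have "axis j 1 \<in> W" by (simp add: W_def axis_def)
    then show ?case using insert W by (simp add: G_additive G_scale)
  qed
  define a :: "'n cmat" where "a = (\<chi> i j. if j = k then \<phi> e $ i else G (axis j 1) $ i)"
  have a_eq: "a *v (\<chi> i. \<kappa> (x $ i)) = \<kappa> (x $ k) *s \<phi> e + G (x - x $ k *s e)" for x
  proof -
    have "x - x $ k *s e = (\<Sum>j\<in>UNIV - {k}. x $ j *s axis j 1)"
    proof -
      have "(\<Sum>j\<in>UNIV. x $ j *s axis j 1) = x" by (rule basis_expansion)
      then show ?thesis by (simp add: sum.remove[of UNIV k] e_def algebra_simps)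
    qed
    then have "G (x - x $ k *s e) = (\<Sum>j\<in>UNIV - {k}. \<kappa> (x $ j) *s G (axis j 1))"
      using G_sum[of "UNIV - {k}" x] by simp
    moreover have "(a *v (\<chi> i. \<kappa> (x $ i))) $ i = \<kappa> (x $ k) * \<phi> e $ i + (\<Sum>j\<in>UNIV - {k}. \<kappa> (x $ j) * G (axis j 1) $ i)" for i
      unfolding matrix_vector_mult_def by (simp add: sum.remove[of UNIV k] a_def mult.commute)
    ultimately show ?thesis by (simp add: vec_eq_iff sum_component)
  qed
  show ?thesis
  proof (rule that[OF \<kappa>])
    fix x :: "complex ^ 'n"
    define t where "t = x $ k"
    define w where "w = x - t *s e"
    have w: "w \<in> W" by (simp add: W_def w_def t_def ek)
    have ax: "a *v (\<chi> i. \<kappa> (x $ i)) = \<kappa> t *s \<phi> e + G w" using a_eq[of x] by (simp add: t_def w_def)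
    show "\<exists>c. cmod c = 1 \<and> \<phi> x = c *s (a *v (\<chi> i. \<kappa> (x $ i)))"
    proof (cases "t = 0")
      case True
      then have "x = w" by (simp add: w_def)
      moreover obtain g where g: "cmod g = 1" "G w = g *s \<phi> w" using G1[OF w] by blast
      ultimately have "\<phi> x = (1 / g) *s (a *v (\<chi> i. \<kappa> (x $ i)))"
        unfolding ax using unimodular_scale_cancel[OF g] True \<kappa>_1 by simp
      then show ?thesis using g(1) by (intro exI[of _ "1 / g"]) (simp add: norm_divide)
    next
      case False
      \<comment> \<open>Rescaling moves \<open>x\<close> into the affine hyperplane
        \<open>e + W\<close>, where the normalisation of \<open>G\<close> applies.\<close>
      have x: "x = t *s (e + (1 / t) *s w)" using False by (simp add: w_def vector_smult_assoc vec.scale_right_distrib)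
      obtain c where c: "cmod c = 1" "\<phi> x = c *s (t *s \<phi> (e + (1 / t) *s w))" using scale[of t] x by metis
      obtain d where d: "cmod d = 1" "\<phi> (e + (1 / t) *s w) = d *s (\<phi> e + G ((1 / t) *s w))" using G2[OF W(3)[OF w w]] by blast
      have \<kappa>t: "\<kappa> t \<noteq> 0" using False \<kappa>_norm[of t] by auto
      have "\<kappa> (1 / t) * \<kappa> t = 1" using False \<kappa>_1 by (simp flip: \<kappa>_mult)
      then have inv: "\<kappa> (1 / t) = 1 / \<kappa> t" using \<kappa>t by (simp add: field_simps)
      have "\<phi> x = (c * t * d / \<kappa> t) *s (\<kappa> t *s \<phi> e + G w)"
        unfolding c(2) d(2) using w \<kappa>t by (simp add: G_scale inv vec_eq_iff field_simps)
      moreover have "cmod (c * t * d / \<kappa> t) = 1" using c d False by (simp add: norm_mult norm_divide \<kappa>_norm)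
      ultimately show ?thesis unfolding ax by blast
    qed
  qed
qed

end

section \<open>Automorphisms of the support relation\<close>

lemma outer_mult_outer: "outer x y ** outer z w = outer (cinner y z *s x) w"
  using outer_congruence[of "outer x y" z w "mat 1"] by (simp add: outer_mult_vec)

lemma outer_scale_left: "outer (c *s x) y = outer x (cnj c *s y)"
  by (simp add: outer_def vec_eq_iff mult_ac)

lemma outer_phase: "cmod c = 1 \<Longrightarrow> outer (c *s x) (c *s x) = outer x x"
proof -
  assume "cmod c = 1"
  then have "cnj c * c = 1" by (metis complex_norm_square mult.commute of_real_1 power_one)
  then show ?thesis by (simp add: outer_scale_left vector_smult_assoc)
qed

text \<open>Applying both matrices to \<open>y\<close> exhibits \<open>y\<close> as a multiple of
  \<open>x\<close>; comparing the quadratic forms at \<open>x\<close> shows that the factor has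
  modulus 1.\<close>

lemma outer_eq_imp_phase:
  assumes "outer x x = outer y y" obtains c where "cmod c = 1" "y = c *s x"
proof (cases "y = 0")
  case True
  then have "x = 0" using assms by simp
  then show ?thesis using that[of 1] True by simp
next
  case False
  have "cinner x y *s x = cinner y y *s y"
    using arg_cong[OF assms, of "\<lambda>A. A *v y"] by (simp add: outer_mult_vec)
  then have "(1 / cinner y y) *s (cinner x y *s x) = (1 / cinner y y) *s (cinner y y *s y)" by simp
  then have y: "y = (cinner x y / cinner y y) *s x" using False by (simp add: vector_smult_assoc)
  define c where "c = cinner x y / cinner y y"
  have yc: "y = c *s x" using y by (simp add: c_def)
  have x: "x \<noteq> 0" using yc False by auto
  have "Re (cinner x (outer x x *v x)) = Re (cinner x (outer y y *v x))" using assms by simp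
  then have "(cmod (cinner x x))\<^sup>2 = (cmod (cinner y x))\<^sup>2" by (simp only: outer_quadratic)
  then have "cmod (cinner x x) = cmod c * cmod (cinner x x)"
    by (simp add: yc cinner_simps norm_mult power2_eq_iff_nonneg)
  then have "cmod c = 1" using x by simp
  then show ?thesis using yc that by blast
qed

text \<open>Squaring \<open>outer x x\<close> multiplies it by \<open>(norm x)\<^sup>2\<close>. For
  \<open>x = 0\<close> the convention \<open>1 / 0 = 0\<close> is harmless.\<close>

lemma psd_sqrt_outer: "psd_sqrt (outer x x) = (1 / norm x) *\<^sub>R outer x x"
proof (rule psd_sqrt_eqI)
  show "psd ((1 / norm x) *\<^sub>R outer x x)" by (intro psd_scaleR) auto
  have "outer x x ** outer x x = ((norm x)\<^sup>2) *\<^sub>R outer x x"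
    unfolding outer_mult_outer cinner_self
    by (simp add: outer_def vec_eq_iff scaleR_conv_of_real[where 'a=complex])
  then show "(1 / norm x) *\<^sub>R outer x x ** (1 / norm x) *\<^sub>R outer x x = outer x x"
    by (cases "x = 0") (simp_all add: matrix_scaleR_left matrix_scaleR_right power2_eq_square)
qed

text \<open>Membership in the support of \<open>\<delta>\<^sub>r * \<delta>\<^sub>s\<close>, expressed in the squared variables \<open>r\<^sup>2\<close>, \<open>s\<^sup>2\<close>.\<close>

definition supp_rel :: "'n::finite cmat \<Rightarrow> 'n cmat \<Rightarrow> 'n cmat \<Rightarrow> bool" where
  "supp_rel A B C \<longleftrightarrow> (\<exists>v\<in>Dbar. C = Mconv (psd_sqrt A) (psd_sqrt B) v)"

text \<open>The roots are rank one, so \<open>v\<close> enters only through the scalar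
  \<open>c = \<langle>y, v x\<rangle> / (norm y * norm x)\<close>, which has modulus at most 1 for a
  contraction \<open>v\<close>.\<close>

lemma supp_rel_outer:
  "supp_rel (outer x x) (outer y y) C \<longleftrightarrow>
    (\<exists>c. cmod c \<le> 1 \<and> C = outer x x + outer y y + outer (c *s y) x + outer x (c *s y))"
proof
  have sq: "psd_sqrt (outer x x) ** psd_sqrt (outer x x) = outer x x" for x :: "complex ^ 'n"
    by (simp add: psd_sqrt_square)
  have cross: "psd_sqrt (outer y y) ** v ** psd_sqrt (outer x x)
      = outer ((cinner y (v *v x) / of_real (norm y * norm x)) *s y) x" for v
  proof -
    have "outer y y ** v ** outer x x = outer (cinner y (v *v x) *s y) x"
      using outer_congruence[of "outer y y ** v" x x "mat 1"]
      by (simp add: outer_mult_outer flip: matrix_vector_mul_assoc)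
         (metis (no_types) madj_mat_1 matrix_mul_assoc matrix_mul_rid matrix_vector_mul_assoc matrix_vector_mul_lid outer_congruence outer_mult_vec)
    then show ?thesis
      by (simp add: psd_sqrt_outer matrix_scaleR_left matrix_scaleR_right)
         (simp add: outer_def vec_eq_iff scaleR_conv_of_real[where 'a=complex])
  qed
  have Mconv_eq: "Mconv (psd_sqrt (outer x x)) (psd_sqrt (outer y y)) v =
      outer x x + outer y y + outer (c *s y) x + outer x (c *s y)"
    if "c = cinner y (v *v x) / of_real (norm y * norm x)" for v c
  proof -
    have "psd_sqrt (outer x x) ** madj v ** psd_sqrt (outer y y) = madj (psd_sqrt (outer y y) ** v ** psd_sqrt (outer x x))"
      by (simp add: madj_simps psd_madj psd_psd_sqrt matrix_mul_assoc)
    also have "\<dots> = outer x (c *s y)" by (simp add: cross madj_outer that)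
    finally show ?thesis by (simp add: Mconv_def sq cross that)
  qed
  {
    assume "supp_rel (outer x x) (outer y y) C"
    then obtain v where v: "v \<in> Dbar" "C = Mconv (psd_sqrt (outer x x)) (psd_sqrt (outer y y)) v"
      unfolding supp_rel_def by blast
    define c where "c = cinner y (v *v x) / of_real (norm y * norm x)"
    have "cmod (cinner y (v *v x)) \<le> norm y * norm (v *v x)" by (rule cinner_Cauchy_Schwarz)
    also have "\<dots> \<le> norm y * norm x" using v(1) by (intro mult_left_mono) (auto simp: Dbar_def)
    finally have "cmod c \<le> 1" by (simp add: c_def norm_divide norm_mult divide_le_eq_1)
         (metis mult_eq_0_iff norm_ge_zero norm_le_zero_iff not_less mult_nonneg_nonneg order_le_less)
    then show "\<exists>c. cmod c \<le> 1 \<and> C = outer x x + outer y y + outer (c *s y) x + outer x (c *s y)"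
      using Mconv_eq[OF c_def] v(2) by blast
  }
  assume "\<exists>c. cmod c \<le> 1 \<and> C = outer x x + outer y y + outer (c *s y) x + outer x (c *s y)"
  then obtain c where c: "cmod c \<le> 1" "C = outer x x + outer y y + outer (c *s y) x + outer x (c *s y)" by blast
  show "supp_rel (outer x x) (outer y y) C"
  proof (cases "x = 0 \<or> y = 0")
    case True
    have "0 \<in> Dbar" by (simp add: Dbar_def)
    moreover have "C = Mconv (psd_sqrt (outer x x)) (psd_sqrt (outer y y)) 0"
      using True c(2) Mconv_eq[of 0 0] by auto
    ultimately show ?thesis unfolding supp_rel_def by blast
  next
    case False
    \<comment> \<open>A rank-one matrix sending the direction of \<open>x\<close> to
      \<open>c\<close> times the direction of \<open>y\<close>; its operator norm is
      \<open>cmod c\<close>.\<close>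
    define v where "v = outer ((c / of_real (norm y * norm x)) *s y) x"
    have vz: "v *v z = (cinner x z * (c / of_real (norm y * norm x))) *s y" for z
      by (simp add: v_def outer_mult_vec vector_smult_assoc)
    have "norm (v *v z) \<le> norm z" for z
    proof -
      have "norm (v *v z) = cmod (cinner x z) * cmod c / norm x"
        using False by (simp add: vz norm_scale_vec norm_mult norm_divide)
      also have "\<dots> \<le> (norm x * norm z) * 1 / norm x"
        using c(1) cinner_Cauchy_Schwarz[of x z] by (intro divide_right_mono mult_mono) auto
      also have "\<dots> = norm z" using False by simp
      finally show ?thesis .
    qed
    then have "v \<in> Dbar" by (simp add: Dbar_def)
    moreover have "c = cinner y (v *v x) / of_real (norm y * norm x)"
      using False by (simp add: vz cinner_simps cinner_self power2_eq_square)
    ultimately show ?thesis unfolding supp_rel_def c(2) by (intro bexI[of _ v] Mconv_eq[symmetric])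
  qed
qed

lemma outer_sum_decomposition:
  "outer x x + outer y y + outer (c *s y) x + outer x (c *s y) =
    outer (x + c *s y) (x + c *s y) + (1 - (cmod c)\<^sup>2) *\<^sub>R outer y y"
proof -
  have "outer (c *s y) (c *s y) = ((cmod c)\<^sup>2) *\<^sub>R outer y y"
    by (simp add: outer_def vec_eq_iff scaleR_conv_of_real[where 'a=complex] complex_norm_square mult_ac del: of_real_power)
  then show ?thesis by (simp add: outer_add scaleR_left_diff_distrib)
qed

lemma supp_rel_outer_sum:
  assumes "cmod c = 1" "cmod d = 1"
  shows "supp_rel (outer x x) (outer y y) (outer (c *s x + d *s y) (c *s x + d *s y))"
proof -
  have eq: "c *s x + d *s y = c *s (x + (d / c) *s y)"
    using cmod_1_nonzero[OF assms(1)] by (simp add: vector_smult_assoc vec.scale_right_distrib)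
  have "outer (c *s x + d *s y) (c *s x + d *s y) = outer (x + (d / c) *s y) (x + (d / c) *s y)"
    unfolding eq by (rule outer_phase[OF assms(1)])
  also have "\<dots> = outer x x + outer y y + outer ((d / c) *s y) x + outer x ((d / c) *s y)"
    using assms by (simp add: outer_sum_decomposition norm_divide)
  finally show ?thesis
    using assms unfolding supp_rel_outer by (intro exI[of _ "d / c"]) (simp add: norm_divide)
qed

section \<open>The support relation, the order and rank one\<close>

lemma psd_le_outer:
  assumes B: "psd B" and le: "psd (outer x x - B)"
  obtains t where "0 \<le> t" "t \<le> 1" "B = t *\<^sub>R outer x x"
proof (cases "x = 0")
  case True
  then have "psd (- B)" using le by simp
  then have "B = 0" using psd_antisym[of B 0] B by simp
  then show ?thesis using that[of 0] by simp
next
  case False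
  \<comment> \<open>On the orthogonal complement of \<open>x\<close> the form of \<open>B\<close> is
    squeezed between 0 and 0. Hence \<open>B\<close> is determined by \<open>B *v x\<close>, and by
    symmetry this is a multiple of \<open>x\<close>.\<close>
  have orth: "B *v y = 0" if "cinner x y = 0" for y
  proof (rule psd_kernel[OF B])
    have "0 \<le> Re (cinner y ((outer x x - B) *v y))" by (rule psdD[OF le])
    also have "\<dots> = - Re (cinner y (B *v y))"
      using that by (simp add: matrix_vector_mult_diff_rdistrib cinner_diff_right outer_quadratic)
    finally show "Re (cinner y (B *v y)) = 0" using psdD[OF B, of y] by simp
  qed
  have decomp: "B *v y = (cinner x y / cinner x x) *s (B *v x)" for y
  proof -
    have "cinner x (y - (cinner x y / cinner x x) *s x) = 0" using False by (simp add: cinner_simps)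
    then have "B *v (y - (cinner x y / cinner x x) *s x) = 0" by (rule orth)
    then show ?thesis by (simp add: matrix_vector_mult_diff_distrib matrix_vector_scale)
  qed
  have Bx: "B *v x = (cinner x (B *v x) / cinner x x) *s x"
  proof (rule cinner_extensional)
    fix z
    have "cinner z (B *v x) = cnj (cinner x (B *v z))"
      by (simp add: cnj_cinner hermitian_cinner[OF psd_hermitian[OF B]])
    also have "\<dots> = cinner z x * cnj (cinner x (B *v x)) / cinner x x"
      unfolding decomp[of z] by (simp add: cinner_simps cnj_cinner cinner_self)
    also have "cnj (cinner x (B *v x)) = cinner x (B *v x)"
      by (simp add: cnj_cinner hermitian_cinner[OF psd_hermitian[OF B]])
    finally show "cinner z (B *v x) = cinner z ((cinner x (B *v x) / cinner x x) *s x)"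
      by (simp add: cinner_simps)
  qed
  define t where "t = Re (cinner x (B *v x)) / (norm x) ^ 4"
  have t: "of_real t = cinner x (B *v x) / (cinner x x * cinner x x)"
    using cquad_hermitian_real[OF psd_hermitian[OF B], of x]
    by (simp add: t_def cinner_self power2_eq_square power4_eq_xxxx mult.assoc)
  have B_eq: "B = t *\<^sub>R outer x x"
    unfolding matrix_eq
  proof
    fix y
    have "B *v y = (cinner x y * of_real t) *s x"
      unfolding decomp[of y] by (subst Bx) (simp add: vector_smult_assoc t)
    then show "B *v y = t *\<^sub>R outer x x *v y"
      by (simp add: matrix_scaleR_vector outer_mult_vec vec_eq_iff scaleR_conv_of_real[where 'a=complex])
  qed
  have "0 \<le> t" using psdD[OF B, of x] by (simp add: t_def)
  moreover have "t \<le> 1"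
  proof -
    have "0 \<le> Re (cinner x ((outer x x - t *\<^sub>R outer x x) *v x))" using psdD[OF le, of x] B_eq by simp
    also have "\<dots> = (1 - t) * (cmod (cinner x x))\<^sup>2"
      by (simp add: matrix_vector_mult_diff_rdistrib cinner_diff_right matrix_scaleR_vector cinner_scaleR_right
           outer_quadratic algebra_simps)
    finally show ?thesis using False by (simp add: zero_le_mult_iff)
  qed
  ultimately show ?thesis using that B_eq by blast
qed

lemma scaled_outer_le_imp_multiple:
  assumes "0 < k" "psd (outer z z - k *\<^sub>R outer y y)" shows "\<exists>c. y = c *s z"
proof (cases "y = 0")
  case True
  then have "y = 0 *s z" by simp
  then show ?thesis by blast
next
  case False
  have "psd (k *\<^sub>R outer y y)" using assms by (intro psd_scaleR) auto
  then obtain t where "k *\<^sub>R outer y y = t *\<^sub>R outer z z" using psd_le_outer assms(2) by metis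
  then have "(k *\<^sub>R outer y y) *v y = (t *\<^sub>R outer z z) *v y" by simp
  then have "(of_real k * cinner y y) *s y = (of_real t * cinner z y) *s z"
    by (simp add: matrix_scaleR_vector outer_mult_vec vec_eq_iff scaleR_conv_of_real[where 'a=complex] mult.assoc)
  then have "(1 / (of_real k * cinner y y)) *s ((of_real k * cinner y y) *s y)
      = (1 / (of_real k * cinner y y)) *s ((of_real t * cinner z y) *s z)" by simp
  then have "y = (of_real t * cinner z y / (of_real k * cinner y y)) *s z"
    using False assms(1) by (simp add: vector_smult_assoc)
  then show ?thesis by blast
qed

text \<open>For \<open>cmod c < 1\<close> the matrix \<open>outer z z\<close> dominates positive
  multiples of both \<open>outer y y\<close> and the square of \<open>x + c *s y\<close>. Both
  vectors would be multiples of \<open>z\<close>, against independence; so \<open>c\<close> is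
  unimodular.\<close>

lemma supp_rel_outer_rank_one:
  assumes ind: "indep2 x y" and rel: "supp_rel (outer x x) (outer y y) (outer z z)"
  obtains c d where "cmod c = 1" "cmod d = 1" "z = c *s x + d *s y"
proof -
  obtain c where c: "cmod c \<le> 1" "outer z z = outer (x + c *s y) (x + c *s y) + (1 - (cmod c)\<^sup>2) *\<^sub>R outer y y"
    using rel unfolding supp_rel_outer outer_sum_decomposition by blast
  have "cmod c = 1"
  proof (rule ccontr)
    assume "cmod c \<noteq> 1"
    then have "cmod c < 1" using c(1) by simp
    then have pos: "0 < 1 - (cmod c)\<^sup>2" by (simp add: power_less_one_iff)
    have "psd (outer z z - (1 - (cmod c)\<^sup>2) *\<^sub>R outer y y)" unfolding c(2) by simp
    then obtain b where b: "y = b *s z" using scaled_outer_le_imp_multiple[OF pos] by blast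
    have "psd (outer z z - 1 *\<^sub>R outer (x + c *s y) (x + c *s y))"
      unfolding c(2) using pos by (simp add: psd_scaleR)
    then obtain a where a: "x + c *s y = a *s z" using scaled_outer_le_imp_multiple[of 1] by auto
    have "b *s x + (b * c - a) *s y = b *s (x + c *s y) - a *s y"
      by (simp add: vec_eq_iff algebra_simps)
    also have "\<dots> = 0" unfolding a by (simp add: b vector_smult_assoc mult.commute)
    finally have "b = 0" using ind unfolding indep2_def by blast
    then show False using b indep2_nonzero(2)[OF ind] by simp
  qed
  then have "outer (x + c *s y) (x + c *s y) = outer z z" using c(2) by simp
  then obtain d where d: "cmod d = 1" "z = d *s (x + c *s y)" by (rule outer_eq_imp_phase)
  show ?thesis
    by (rule that[of d "d * c"]) (use d \<open>cmod c = 1\<close> in \<open>simp_all add: norm_mult vec.scale_right_distrib vector_smult_assoc\<close>)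
qed

text \<open>Congruences of \<open>1 + v\<close> by \<open>1 - v\<close> and of \<open>1 - v\<close>
  by \<open>1 + v\<close> are positive, and their sum is \<open>2 (1 - v\<^sup>2)\<close>.\<close>

lemma hermitian_contraction:
  assumes "psd (mat 1 - v)" "psd (mat 1 + v)" shows "v \<in> Dbar"
proof -
  have h: "madj v = v"
    using psd_madj[OF assms(2)] by (simp add: madj_simps)
  have "psd ((mat 1 - v) ** (mat 1 + v) ** madj (mat 1 - v) + (mat 1 + v) ** (mat 1 - v) ** madj (mat 1 + v))"
    by (intro psd_add psd_congruence assms)
  also have "(mat 1 - v) ** (mat 1 + v) ** madj (mat 1 - v) + (mat 1 + v) ** (mat 1 - v) ** madj (mat 1 + v) =
      2 *\<^sub>R (mat 1 - madj v ** v)"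
    by (simp add: madj_simps h matrix_distribs scaleR_2)
  finally have "psd (2 *\<^sub>R (mat 1 - madj v ** v))" .
  then have "0 \<le> Re (cinner x ((2 *\<^sub>R (mat 1 - madj v ** v)) *v x))" for x by (rule psdD)
  then have "0 \<le> 2 * ((norm x)\<^sup>2 - (norm (v *v x))\<^sup>2)" for x
    by (simp only: matrix_scaleR_vector cinner_scaleR_right quadratic_1_minus of_real_mult[symmetric] Re_complex_of_real)
  then have "norm (v *v x) \<le> norm x" for x
    by (metis diff_ge_0_iff_ge norm_ge_zero power2_le_imp_le zero_le_mult_iff not_numeral_le_zero)
  then show ?thesis by (simp add: Dbar_def)
qed

lemma Mconv_self: "Mconv s s v = 2 *\<^sub>R (s ** s) + s ** (v + madj v) ** s"
  by (simp add: Mconv_def matrix_distribs scaleR_2)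

text \<open>From left to right this is \<open>v + madj v \<le> 2\<close> conjugated by the root.
  Conversely, for an invertible root \<open>s\<close> with inverse \<open>t\<close> the Hermitian
  solution is \<open>v = (1/2) t C t - 1\<close>, a contraction because
  \<open>0 \<le> C \<le> 4 A\<close>. For singular \<open>A\<close> such solutions for
  \<open>A + 1/n\<close> accumulate in \<open>Dbar\<close>.\<close>

lemma supp_rel_self:
  fixes A C :: "'n::finite cmat"
  assumes A: "psd A" and C: "psd C"
  shows "supp_rel A A C \<longleftrightarrow> psd (4 *\<^sub>R A - C)"
proof
  assume "supp_rel A A C"
  then obtain v where v: "v \<in> Dbar" "C = Mconv (psd_sqrt A) (psd_sqrt A) v" unfolding supp_rel_def by blast
  define s where "s = psd_sqrt A"
  have s: "psd s" "s ** s = A" using A by (simp_all add: s_def psd_psd_sqrt psd_sqrt_square)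
  have "psd (2 *\<^sub>R mat 1 - (v + madj v))"
  proof (rule psdI)
    show "hermitian (2 *\<^sub>R mat 1 - (v + madj v))" by (simp add: hermitian_def madj_simps add.commute)
    fix x
    have "Re (cinner x (v *v x)) \<le> norm x * norm (v *v x)"
      using cinner_Cauchy_Schwarz[of x "v *v x"] complex_Re_le_cmod order_trans by blast
    also have "\<dots> \<le> norm x * norm x" using v(1) by (intro mult_left_mono) (auto simp: Dbar_def)
    finally have "Re (cinner x (v *v x)) \<le> (norm x)\<^sup>2" by (simp add: power2_eq_square)
    moreover have "Re (cinner x (madj v *v x)) = Re (cinner x (v *v x))"
      by (metis cinner_adjoint Re_cinner_commute)
    ultimately show "0 \<le> Re (cinner x ((2 *\<^sub>R mat 1 - (v + madj v)) *v x))"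
      by (simp add: matrix_vector_mult_diff_rdistrib matrix_vector_mult_add_rdistrib matrix_scaleR_vector cinner_simps cinner_self)
  qed
  then have "psd (s ** (2 *\<^sub>R mat 1 - (v + madj v)) ** madj s)" by (rule psd_congruence)
  also have "s ** (2 *\<^sub>R mat 1 - (v + madj v)) ** madj s = 4 *\<^sub>R A - C"
  proof -
    have "4 *\<^sub>R A = 2 *\<^sub>R A + 2 *\<^sub>R A" unfolding scaleR_left_distrib[symmetric] by simp
    then show ?thesis
      unfolding v(2) s_def[symmetric] Mconv_self by (simp add: psd_madj[OF s(1)] matrix_distribs s(2))
  qed
  finally show "psd (4 *\<^sub>R A - C)" .
next
  assume le: "psd (4 *\<^sub>R A - C)"
  define An where "An n = A + inverse (real (Suc n)) *\<^sub>R mat 1" for n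
  have An: "posdef (An n)" for n unfolding An_def by (rule posdef_add_scaleR_1[OF A]) simp
  have An_lim: "An \<longlonglongrightarrow> A"
    unfolding An_def by (rule tendsto_add_inverse_mat_1)
  have "\<exists>v\<in>Dbar. C = Mconv (psd_sqrt (An n)) (psd_sqrt (An n)) v" for n
  proof -
    obtain s t where s: "psd s" "s ** s = An n" and st: "s ** t = mat 1" "t ** s = mat 1"
      using posdef_sqrt[OF An] by metis
    have madjt: "madj t = t"
      by (metis st psd_madj[OF s(1)] madj_mat_1 madj_mult matrix_mul_assoc matrix_mul_lid matrix_mul_rid)
    have sq: "psd_sqrt (An n) = s" using s by (rule psd_sqrt_eqI)
    have tAt: "t ** An n ** t = mat 1"
      unfolding s(2)[symmetric] using st by (metis matrix_mul_assoc matrix_mul_lid)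
    define v where "v = (1/2) *\<^sub>R (t ** C ** t) - mat 1"
    have "psd (t ** C ** madj t)" by (rule psd_congruence[OF C])
    then have "psd ((1/2) *\<^sub>R (t ** C ** t))" using madjt by (intro psd_scaleR) auto
    then have 1: "psd (mat 1 + v)" by (simp add: v_def)
    have "psd (4 *\<^sub>R An n - C)"
      using psd_add[OF le, of "(4 * inverse (real (Suc n))) *\<^sub>R mat 1"]
      by (simp add: An_def psd_scaleR scaleR_right_distrib algebra_simps)
    then have "psd (t ** (4 *\<^sub>R An n - C) ** madj t)" by (rule psd_congruence)
    moreover have "t ** (4 *\<^sub>R An n - C) ** madj t = 4 *\<^sub>R mat 1 - t ** C ** t"
      by (simp add: madjt matrix_distribs tAt)
    ultimately have "psd ((1/2) *\<^sub>R (4 *\<^sub>R mat 1 - t ** C ** t))" by (intro psd_scaleR) auto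
    moreover have "(1/2) *\<^sub>R (4 *\<^sub>R mat 1 - t ** C ** t) = mat 1 - v"
      by (simp add: v_def vec_eq_iff scaleR_conv_of_real[where 'a=complex] algebra_simps)
    ultimately have 2: "psd (mat 1 - v)" by simp
    have "v \<in> Dbar" by (rule hermitian_contraction[OF 2 1])
    moreover have "C = Mconv s s v"
    proof -
      have "madj v = v" by (simp add: v_def madj_simps madjt psd_madj[OF C] matrix_mul_assoc)
      then have "s ** (v + madj v) ** s = 2 *\<^sub>R (s ** v ** s)" by (simp only: matrix_distribs scaleR_2)
      also have "s ** v ** s = (1/2) *\<^sub>R ((s ** t) ** C ** (t ** s)) - s ** s"
        by (simp add: v_def matrix_distribs)
      finally show ?thesis by (simp add: Mconv_self st scaleR_right_diff_distrib)
    qed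
    ultimately show ?thesis unfolding sq by blast
  qed
  then obtain V where V: "\<And>n. V n \<in> Dbar" "\<And>n. C = Mconv (psd_sqrt (An n)) (psd_sqrt (An n)) (V n)" by metis
  obtain v q where v: "v \<in> Dbar" "strict_mono q" "(V \<circ> q) \<longlonglongrightarrow> v"
    using compact_Dbar V(1) unfolding compact_def by metis
  have sq_lim: "(\<lambda>n. psd_sqrt (An (q n))) \<longlonglongrightarrow> psd_sqrt A"
    using psd_sqrt_continuous[unfolded continuous_on_sequentially, rule_format, of A "\<lambda>n. An (q n)"]
      LIMSEQ_subseq_LIMSEQ[OF An_lim v(2)] A posdef_psd[OF An]
    by (simp add: PiCone_def o_def)
  have V_lim: "(\<lambda>n. V (q n)) \<longlonglongrightarrow> v" using v(3) by (simp add: o_def)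
  have "(\<lambda>n. Mconv (psd_sqrt (An (q n))) (psd_sqrt (An (q n))) (V (q n))) \<longlonglongrightarrow> Mconv (psd_sqrt A) (psd_sqrt A) v"
    unfolding Mconv_def by (intro tendsto_intros sq_lim V_lim)
  then have "C = Mconv (psd_sqrt A) (psd_sqrt A) v"
    unfolding V(2)[symmetric] by (rule LIMSEQ_unique[OF tendsto_const])
  then show "supp_rel A A C" unfolding supp_rel_def using v(1) by blast
qed

lemma psd_le_by_rank_one:
  assumes A: "psd A" and B: "psd B" and le: "\<And>x. psd (A - outer x x) \<Longrightarrow> psd (B - outer x x)"
  shows "psd (B - A)"
proof (rule psdI)
  show "hermitian (B - A)" using A B by (simp add: hermitian_def madj_simps psd_madj)
  fix z
  define q where "q = Re (cinner z (A *v z))"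
  have q0: "0 \<le> q" unfolding q_def by (rule psdD[OF A])
  have "q \<le> Re (cinner z (B *v z))"
  proof (cases "q = 0")
    case True
    then show ?thesis using psdD[OF B] by simp
  next
    case False
    \<comment> \<open>By the Cauchy-Schwarz inequality for \<open>A\<close> this
      \<open>outer x x\<close> lies below \<open>A\<close>, and its form attains that of
      \<open>A\<close> at \<open>z\<close>.\<close>
    define x where "x = (1 / sqrt q) *\<^sub>R (A *v z)"
    have xw: "(cmod (cinner x w))\<^sup>2 = (cmod (cinner z (A *v w)))\<^sup>2 / q" for w
      using q0 by (simp add: x_def cinner_scaleR_left norm_mult power_mult_distrib power_divide
          hermitian_cinner[OF psd_hermitian[OF A]] norm_divide)
    have "psd (A - outer x x)"
    proof (rule psdI)
      show "hermitian (A - outer x x)" using A by (simp add: hermitian_def madj_simps psd_madj madj_outer)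
      fix w
      have "(cmod (cinner z (A *v w)))\<^sup>2 \<le> q * Re (cinner w (A *v w))"
        unfolding q_def by (rule psd_Cauchy_Schwarz[OF A])
      then have "(cmod (cinner x w))\<^sup>2 \<le> Re (cinner w (A *v w))"
        using False q0 by (simp add: xw divide_le_eq mult.commute)
      then show "0 \<le> Re (cinner w ((A - outer x x) *v w))"
        by (simp add: matrix_vector_mult_diff_rdistrib cinner_diff_right outer_quadratic)
    qed
    then have "0 \<le> Re (cinner z ((B - outer x x) *v z))" using psdD le by blast
    then have "(cmod (cinner x z))\<^sup>2 \<le> Re (cinner z (B *v z))"
      by (simp add: matrix_vector_mult_diff_rdistrib cinner_diff_right outer_quadratic)
    moreover have "(cmod (cinner x z))\<^sup>2 = q"
    proof -
      have "cmod (cinner z (A *v z)) = q"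
        using cquad_hermitian_real[OF psd_hermitian[OF A], of z] q0 unfolding q_def by (metis abs_of_nonneg norm_of_real)
      then show ?thesis unfolding xw using False by (simp add: power2_eq_square)
    qed
    ultimately show ?thesis by simp
  qed
  then show "0 \<le> Re (cinner z ((B - A) *v z))"
    by (simp add: q_def matrix_vector_mult_diff_rdistrib cinner_diff_right)
qed

text \<open>Two nonzero eigenvalues would give incomparable spectral parts \<open>P i\<close> and
  \<open>P j\<close> below \<open>A\<close>. The zero matrix is included, with
  \<open>x = 0\<close>.\<close>

lemma rank_one_if_chain:
  fixes A :: "'n::finite cmat"
  assumes A: "psd A"
    and chain: "\<And>B C. psd B \<Longrightarrow> psd C \<Longrightarrow> psd (A - B) \<Longrightarrow> psd (A - C) \<Longrightarrow> psd (B - C) \<or> psd (C - B)"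
  shows "\<exists>x. A = outer x x"
proof -
  obtain U d where U: "unitary U" "A = U ** cdiag d ** madj U"
    using hermitian_diagonalization[OF psd_hermitian[OF A]] by metis
  have d: "0 \<le> d i" for i by (rule psd_eigenvalue_nonneg[OF A U])
  define P where "P i = U ** cdiag (\<lambda>j. if j = i then d i else 0) ** madj U" for i
  have diff: "U ** cdiag c ** madj U - U ** cdiag c' ** madj U = U ** cdiag (\<lambda>i. c i - c' i) ** madj U" for c c'
  proof -
    have "cdiag (\<lambda>i. c i - c' i) = cdiag c - cdiag c'" by (simp add: cdiag_def vec_eq_iff)
    then show ?thesis by (simp add: matrix_distribs)
  qed
  have P: "psd (P i)" "psd (A - P i)" for i
    unfolding P_def U(2) diff by (intro psd_congruence psd_cdiag; simp add: d)+
  have unique: "j = i" if ij: "d i \<noteq> 0" "d j \<noteq> 0" for i j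
  proof (rule ccontr)
    assume ne: "j \<noteq> i"
    have "\<not> psd (P i' - P j')" if "d j' \<noteq> 0" "i' \<noteq> j'" for i' j'
    proof
      assume p: "psd (P i' - P j')"
      have "P i' - P j' = U ** cdiag (\<lambda>j. (if j = i' then d i' else 0) - (if j = j' then d j' else 0)) ** madj U"
        unfolding P_def by (rule diff)
      from psd_eigenvalue_nonneg[OF p U(1) this, of j'] show False
        using that d[of j'] by simp
    qed
    then show False using chain[OF P(1) P(1) P(2) P(2), of i j] ij ne by metis
  qed
  show ?thesis
  proof (cases "\<exists>i. d i \<noteq> 0")
    case True
    then obtain i where i: "d i \<noteq> 0" by blast
    define x where "x = (sqrt (d i)) *\<^sub>R axis i (1 :: complex)"
    have "cdiag d = outer x x"
    proof -
      have "cdiag d $ j $ l = outer x x $ j $ l" for j l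
      proof (cases "j = i \<and> l = i")
        case True
        then show ?thesis using d[of i] by (simp add: cdiag_def outer_def x_def axis_def scaleR_conv_of_real[where 'a=complex] flip: of_real_mult)
      next
        case False
        then have "outer x x $ j $ l = 0" by (auto simp: outer_def x_def axis_def)
        moreover have "cdiag d $ j $ l = 0" using False unique[OF i, of j] by (auto simp: cdiag_def)
        ultimately show ?thesis by simp
      qed
      then show ?thesis by (simp add: vec_eq_iff)
    qed
    then have "A = outer (U *v x) (U *v x)" by (simp add: U(2) outer_congruence)
    then show ?thesis by blast
  next
    case False
    then have "cdiag d = 0" by (simp add: cdiag_def vec_eq_iff)
    then have "A = 0" using U(2) by (simp add: matrix_matrix_mult_def vec_eq_iff)
    then show ?thesis by (intro exI[of _ 0]) simp
  qed
qed

text \<open>Cauchy's functional equation: if \<open>m \<le> n t \<le> m + 1\<close> with integers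
  \<open>m\<close> and \<open>n\<close>, monotonicity places \<open>n * h t\<close> in the same unit
  interval, which bounds \<open>n * \<bar>h t - t\<bar>\<close> by 1 for every
  \<open>n\<close>.\<close>

lemma additive_mono_real_eq:
  fixes h :: "real \<Rightarrow> real"
  assumes add: "\<And>s t. 0 \<le> s \<Longrightarrow> 0 \<le> t \<Longrightarrow> h (s + t) = h s + h t"
    and mono: "\<And>s t. 0 \<le> s \<Longrightarrow> s \<le> t \<Longrightarrow> h s \<le> h t" and h1: "h 1 = 1" and t: "0 \<le> t"
  shows "h t = t"
proof (rule ccontr)
  assume ne: "h t \<noteq> t"
  have h0: "h 0 = 0" using add[of 0 0] by simp
  have mult: "h (real n * s) = real n * h s" if "0 \<le> s" for n s
    by (induction n) (use that in \<open>auto simp: h0 add algebra_simps\<close>)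
  obtain n where n: "1 < real n * \<bar>h t - t\<bar>"
    using ex_less_of_nat_mult[of "\<bar>h t - t\<bar>" 1] ne by auto
  define m where "m = nat \<lfloor>real n * t\<rfloor>"
  have m: "real m \<le> real n * t" "real n * t \<le> real (m + 1)"
    using t by (auto simp: m_def) linarith+
  have "h (real m) = real m" "h (real (m + 1)) = real (m + 1)" using mult[of 1 m] mult[of 1 "m + 1"] h1 by simp_all
  then have "real m \<le> real n * h t" "real n * h t \<le> real (m + 1)"
    using mono[OF _ m(1)] mono[OF _ m(2)] mult[OF t, of n] t by simp_all
  then have "\<bar>real n * h t - real n * t\<bar> \<le> 1" using m by linarith
  then have "real n * \<bar>h t - t\<bar> \<le> 1" by (simp add: abs_mult flip: right_diff_distrib)
  then show False using n by simp
qed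

section \<open>From the support relation to a congruence\<close>

locale supp_rel_aut =
  fixes \<tau> :: "'n::finite cmat \<Rightarrow> 'n cmat"
  assumes psd: "psd A \<Longrightarrow> psd (\<tau> A)"
    and surj: "psd B \<Longrightarrow> \<exists>A. psd A \<and> \<tau> A = B"
    and inj: "psd A \<Longrightarrow> psd B \<Longrightarrow> \<tau> A = \<tau> B \<Longrightarrow> A = B"
    and rel: "psd A \<Longrightarrow> psd B \<Longrightarrow> psd C \<Longrightarrow> supp_rel (\<tau> A) (\<tau> B) (\<tau> C) \<longleftrightarrow> supp_rel A B C"
begin

lemma rel_self: "psd A \<Longrightarrow> psd C \<Longrightarrow> psd (4 *\<^sub>R \<tau> A - \<tau> C) \<longleftrightarrow> psd (4 *\<^sub>R A - C)"
  using rel[of A A C] by (simp add: supp_rel_self psd)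

text \<open>\<open>D\<close> is the top of the support of \<open>D/4\<close> with itself. As
  \<open>\<tau>\<close> is not yet known to commute with the factor 1/4, one direction uses
  \<open>D/4\<close> and the other a preimage of \<open>\<tau> D / 4\<close>.\<close>

lemma order_iff:
  assumes C: "psd C" and D: "psd D" shows "psd (\<tau> D - \<tau> C) \<longleftrightarrow> psd (D - C)"
proof
  assume le: "psd (D - C)"
  have "psd ((1/4) *\<^sub>R \<tau> D)" by (intro psd_scaleR psd D) simp
  then obtain A where A: "psd A" "\<tau> A = (1/4) *\<^sub>R \<tau> D" using surj by blast
  have "psd (4 *\<^sub>R \<tau> A - \<tau> D)" by (simp add: A)
  then have "psd (4 *\<^sub>R A - D)" using rel_self A D by blast
  then have "psd (4 *\<^sub>R A - C)" using le psd_trans by blast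
  then have "psd (4 *\<^sub>R \<tau> A - \<tau> C)" using rel_self A C by blast
  then show "psd (\<tau> D - \<tau> C)" by (simp add: A)
next
  assume le: "psd (\<tau> D - \<tau> C)"
  define A where "A = (1/4) *\<^sub>R D"
  have A: "psd A" unfolding A_def by (intro psd_scaleR D) simp
  have "psd (4 *\<^sub>R A - D)" by (simp add: A_def)
  then have "psd (4 *\<^sub>R \<tau> A - \<tau> D)" using rel_self A D by blast
  then have "psd (4 *\<^sub>R \<tau> A - \<tau> C)" using le psd_trans by blast
  then have "psd (4 *\<^sub>R A - C)" using rel_self A C by blast
  then show "psd (D - C)" by (simp add: A_def)
qed

lemma zero: "\<tau> 0 = 0"
proof -
  obtain A where A: "psd A" "\<tau> A = 0" using surj[of 0] by auto
  have "psd (\<tau> A - \<tau> 0)" using order_iff[of 0 A] A(1) by simp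
  then show ?thesis using psd_antisym[of "\<tau> 0" 0] psd[of 0] A(2) by simp
qed

lemma rank_one: "\<exists>y. \<tau> (outer x x) = outer y y"
proof (rule rank_one_if_chain)
  show "psd (\<tau> (outer x x))" by (simp add: psd)
  fix B' C' assume "psd B'" "psd C'" and le': "psd (\<tau> (outer x x) - B')" "psd (\<tau> (outer x x) - C')"
  then obtain B C where BC: "psd B" "\<tau> B = B'" "psd C" "\<tau> C = C'" using surj by metis
  have "psd (outer x x - B)" "psd (outer x x - C)"
    using order_iff[of B "outer x x"] order_iff[of C "outer x x"] le' BC by simp_all
  then obtain s t where st: "B = s *\<^sub>R outer x x" "C = t *\<^sub>R outer x x"
    using psd_le_outer[OF BC(1), of x] psd_le_outer[OF BC(3), of x] by metis
  have "psd (B - C) \<or> psd (C - B)"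
    unfolding st scaleR_left_diff_distrib[symmetric]
    using psd_scaleR[OF psd_outer, of "s - t" x] psd_scaleR[OF psd_outer, of "t - s" x] by linarith
  then show "psd (B' - C') \<or> psd (C' - B')" using order_iff BC by blast
qed

definition \<phi> :: "complex ^ 'n \<Rightarrow> complex ^ 'n" where
  "\<phi> x = (SOME y. \<tau> (outer x x) = outer y y)"

lemma \<phi>: "\<tau> (outer x x) = outer (\<phi> x) (\<phi> x)"
  unfolding \<phi>_def using rank_one by (rule someI_ex)

lemma \<phi>_phase_iff: "outer (\<phi> x) (\<phi> x) = outer (\<phi> y) (\<phi> y) \<longleftrightarrow> outer x x = outer y y"
  using inj[of "outer x x" "outer y y"] by (auto simp flip: \<phi>)

lemma \<phi>_eq_0_iff: "\<phi> x = 0 \<longleftrightarrow> x = 0"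
  using \<phi>_phase_iff[of x 0] \<phi>[of 0] zero by simp

text \<open>On a ray, the relation is the triangle inequality, so \<open>\<tau>\<close> acts additively on the parameter.\<close>

lemma outer_homogeneous:
  assumes "0 \<le> t" shows "\<tau> ((t\<^sup>2) *\<^sub>R outer x x) = (t\<^sup>2) *\<^sub>R outer (\<phi> x) (\<phi> x)"
proof (cases "x = 0")
  case True
  then show ?thesis using zero \<phi>_eq_0_iff[of 0] by simp
next
  case False
  let ?X = "outer x x" and ?Y = "outer (\<phi> x) (\<phi> x)"
  have y: "\<phi> x \<noteq> 0" using False \<phi>_eq_0_iff by simp
  have le_iff: "psd (b *\<^sub>R outer z z - a *\<^sub>R outer z z) \<longleftrightarrow> a \<le> b" if "z \<noteq> 0" for a b and z :: "complex ^ 'n"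
  proof
    assume "psd (b *\<^sub>R outer z z - a *\<^sub>R outer z z)"
    then have "0 \<le> Re (cinner z ((b *\<^sub>R outer z z - a *\<^sub>R outer z z) *v z))" by (rule psdD)
    then have "0 \<le> (b - a) * (cmod (cinner z z))\<^sup>2"
      by (simp add: matrix_vector_mult_diff_rdistrib cinner_diff_right matrix_scaleR_vector cinner_scaleR_right
           outer_quadratic algebra_simps)
    then show "a \<le> b" using that by (simp add: zero_le_mult_iff)
  next
    assume "a \<le> b"
    then show "psd (b *\<^sub>R outer z z - a *\<^sub>R outer z z)"
      unfolding scaleR_left_diff_distrib[symmetric] by (intro psd_scaleR) auto
  qed
  have X2: "psd ((s\<^sup>2) *\<^sub>R ?X)" for s :: real by (intro psd_scaleR) auto
  have "\<exists>h. 0 \<le> h \<and> \<tau> ((s\<^sup>2) *\<^sub>R ?X) = (h\<^sup>2) *\<^sub>R ?Y" for s :: real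
  proof (cases "s\<^sup>2 \<le> 1")
    case True
    then have "psd (1 *\<^sub>R ?X - (s\<^sup>2) *\<^sub>R ?X)" using le_iff[OF False] by blast
    then have "psd (?Y - \<tau> ((s\<^sup>2) *\<^sub>R ?X))" using order_iff[OF X2, of ?X s] by (simp add: \<phi>)
    then obtain u where "0 \<le> u" "\<tau> ((s\<^sup>2) *\<^sub>R ?X) = u *\<^sub>R ?Y" using psd_le_outer[OF psd[OF X2]] by metis
    then show ?thesis by (intro exI[of _ "sqrt u"]) simp
  next
    case s: False
    then have "1 \<le> s\<^sup>2" by simp
    then have "psd ((s\<^sup>2) *\<^sub>R ?X - 1 *\<^sub>R ?X)" using le_iff[OF False] by blast
    then have le: "psd (\<tau> ((s\<^sup>2) *\<^sub>R ?X) - ?Y)" using order_iff[OF _ X2, of ?X s] by (simp add: \<phi>)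
    have "(s\<^sup>2) *\<^sub>R ?X = outer (s *\<^sub>R x) (s *\<^sub>R x)" by (simp add: outer_scaleR power2_eq_square)
    then have *: "\<tau> ((s\<^sup>2) *\<^sub>R ?X) = outer (\<phi> (s *\<^sub>R x)) (\<phi> (s *\<^sub>R x))" by (simp add: \<phi>)
    obtain u where u: "0 \<le> u" "?Y = u *\<^sub>R \<tau> ((s\<^sup>2) *\<^sub>R ?X)"
      using psd_le_outer[OF psd_outer le[unfolded *]] unfolding * by metis
    then have "u \<noteq> 0" using y by auto
    then have "\<tau> ((s\<^sup>2) *\<^sub>R ?X) = (1 / u) *\<^sub>R ?Y" using u(2) by simp
    then show ?thesis using u(1) by (intro exI[of _ "sqrt (1 / u)"]) simp
  qed
  \<comment> \<open>\<open>h\<close> is \<open>\<tau>\<close> along the ray, in the parameter whose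
    square scales the matrix; in this parameter the top of a support is the sum of the
    arguments.\<close>
  then obtain h where h: "\<And>s. 0 \<le> h s" "\<And>s. \<tau> ((s\<^sup>2) *\<^sub>R ?X) = ((h s)\<^sup>2) *\<^sub>R ?Y" by metis
  have rel_iff: "supp_rel ((s\<^sup>2) *\<^sub>R outer z z) ((t\<^sup>2) *\<^sub>R outer z z) C \<longleftrightarrow>
      (\<exists>c. cmod c \<le> 1 \<and> C = (s\<^sup>2 + t\<^sup>2 + 2 * s * t * Re c) *\<^sub>R outer z z)" for s t C and z :: "complex ^ 'n"
  proof -
    have "(s\<^sup>2) *\<^sub>R outer z z = outer (s *\<^sub>R z) (s *\<^sub>R z)" "(t\<^sup>2) *\<^sub>R outer z z = outer (t *\<^sub>R z) (t *\<^sub>R z)"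
      by (simp_all add: outer_scaleR power2_eq_square)
    moreover have "outer (s *\<^sub>R z) (s *\<^sub>R z) + outer (t *\<^sub>R z) (t *\<^sub>R z) + outer (c *s t *\<^sub>R z) (s *\<^sub>R z)
        + outer (s *\<^sub>R z) (c *s t *\<^sub>R z) = (s\<^sup>2 + t\<^sup>2 + 2 * s * t * Re c) *\<^sub>R outer z z" for c
      by (simp add: outer_def vec_eq_iff complex_eq_iff power2_eq_square algebra_simps)
    ultimately show ?thesis by (simp add: supp_rel_outer)
  qed
  have bound: "s\<^sup>2 + t\<^sup>2 + 2 * s * t * Re c \<le> (s + t)\<^sup>2" if "cmod c \<le> 1" "0 \<le> s" "0 \<le> t" for s t :: real and c
  proof -
    have "Re c \<le> 1" using that(1) complex_Re_le_cmod order_trans by blast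
    then have "2 * s * t * Re c \<le> 2 * s * t" using that by (simp add: mult_left_le)
    then show ?thesis by (simp add: power2_sum)
  qed
  have sum_rel: "supp_rel ((s\<^sup>2) *\<^sub>R outer z z) ((t\<^sup>2) *\<^sub>R outer z z) (((s + t)\<^sup>2) *\<^sub>R outer z z)"
    for s t :: real and z :: "complex ^ 'n"
    unfolding rel_iff by (intro exI[of _ 1]) (simp add: power2_sum)
  have add: "h (s + t) = h s + h t" if st: "0 \<le> s" "0 \<le> t" for s t
  proof (rule antisym)
    have "supp_rel (\<tau> ((s\<^sup>2) *\<^sub>R ?X)) (\<tau> ((t\<^sup>2) *\<^sub>R ?X)) (\<tau> (((s + t)\<^sup>2) *\<^sub>R ?X))"
      using rel[OF X2 X2 X2] sum_rel by blast
    then obtain c where c: "cmod c \<le> 1" "((h (s + t))\<^sup>2) *\<^sub>R ?Y = ((h s)\<^sup>2 + (h t)\<^sup>2 + 2 * h s * h t * Re c) *\<^sub>R ?Y"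
      unfolding h(2) rel_iff by (elim exE conjE)
    then have "(h (s + t))\<^sup>2 = (h s)\<^sup>2 + (h t)\<^sup>2 + 2 * h s * h t * Re c" using y by simp
    then have "(h (s + t))\<^sup>2 \<le> (h s + h t)\<^sup>2" using bound[OF c(1) h(1) h(1)] by simp
    then show "h (s + t) \<le> h s + h t" by (rule power2_le_imp_le) (intro add_nonneg_nonneg h(1))
  next
    \<comment> \<open>The top of the image support has a preimage \<open>B\<close> in the original
      support, hence below \<open>(s + t)\<^sup>2\<close> times \<open>?X\<close>; monotonicity
      gives the reverse inequality.\<close>
    have "psd (((h s + h t)\<^sup>2) *\<^sub>R ?Y)" by (intro psd_scaleR) auto
    then obtain B where B: "psd B" "\<tau> B = ((h s + h t)\<^sup>2) *\<^sub>R ?Y" using surj by blast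
    have "supp_rel (\<tau> ((s\<^sup>2) *\<^sub>R ?X)) (\<tau> ((t\<^sup>2) *\<^sub>R ?X)) (\<tau> B)"
      unfolding h(2) B(2) by (rule sum_rel)
    then have "supp_rel ((s\<^sup>2) *\<^sub>R ?X) ((t\<^sup>2) *\<^sub>R ?X) B" using rel[OF X2 X2 B(1)] by blast
    then obtain c where c: "cmod c \<le> 1" "B = (s\<^sup>2 + t\<^sup>2 + 2 * s * t * Re c) *\<^sub>R ?X"
      unfolding rel_iff by (elim exE conjE)
    then have "psd (((s + t)\<^sup>2) *\<^sub>R ?X - B)" using le_iff[OF False] bound[OF c(1) st] by simp
    then have "psd (((h (s + t))\<^sup>2) *\<^sub>R ?Y - ((h s + h t)\<^sup>2) *\<^sub>R ?Y)"
      using order_iff[OF B(1) X2] B(2) h(2) by metis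
    then have "(h s + h t)\<^sup>2 \<le> (h (s + t))\<^sup>2" using le_iff[OF y] by blast
    then show "h s + h t \<le> h (s + t)" by (rule power2_le_imp_le) (intro add_nonneg_nonneg h(1))
  qed
  have mono: "h s \<le> h t" if "0 \<le> s" "s \<le> t" for s t
    using add[of s "t - s"] h(1)[of "t - s"] that by simp
  have "((h 1)\<^sup>2) *\<^sub>R ?Y = 1 *\<^sub>R ?Y" using h(2)[of 1] by (simp add: \<phi>)
  then have "(h 1)\<^sup>2 = 1" using y by (simp del: scaleR_one)
  then have "h 1 = 1" using h(1)[of 1] by (simp add: power2_eq_1_iff)
  then have "h t = t" using additive_mono_real_eq[of h, OF add mono] assms by blast
  then show ?thesis using h(2)[of t] by simp
qed

lemma \<phi>_scale: "\<exists>c. cmod c = 1 \<and> \<phi> (a *s x) = c *s (a *s \<phi> x)"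
proof -
  have sc: "outer (a *s z) (a *s z) = ((cmod a)\<^sup>2) *\<^sub>R outer z z" for z :: "complex ^ 'n"
    by (simp add: outer_def vec_eq_iff scaleR_conv_of_real[where 'a=complex] complex_norm_square mult_ac del: of_real_power)
  have "outer (\<phi> (a *s x)) (\<phi> (a *s x)) = \<tau> (((cmod a)\<^sup>2) *\<^sub>R outer x x)" by (simp add: sc flip: \<phi>)
  also have "\<dots> = outer (a *s \<phi> x) (a *s \<phi> x)" by (simp add: outer_homogeneous sc)
  finally show ?thesis using outer_eq_imp_phase by metis
qed

lemma ray_map: "ray_map \<phi>"
proof
  fix a x
  show "\<exists>c. cmod c = 1 \<and> \<phi> (a *s x) = c *s (a *s \<phi> x)" by (rule \<phi>_scale)
next
  fix c x y assume "cmod c = 1" "\<phi> y = c *s \<phi> x"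
  then have "outer x x = outer y y" using outer_phase[of c "\<phi> x"] \<phi>_phase_iff[of x y] by simp
  then show "\<exists>d. cmod d = 1 \<and> y = d *s x" using outer_eq_imp_phase by metis
next
  fix x y assume "indep2 x y" and i: "indep2 (\<phi> x) (\<phi> y)"
  have "supp_rel (outer x x) (outer y y) (outer (x + y) (x + y))"
    using supp_rel_outer_sum[of 1 1 x y] by simp
  then have "supp_rel (outer (\<phi> x) (\<phi> x)) (outer (\<phi> y) (\<phi> y)) (outer (\<phi> (x + y)) (\<phi> (x + y)))"
    using rel[of "outer x x" "outer y y" "outer (x + y) (x + y)"] by (simp add: \<phi>)
  then show "\<exists>c d. cmod c = 1 \<and> cmod d = 1 \<and> \<phi> (x + y) = c *s \<phi> x + d *s \<phi> y"
    using supp_rel_outer_rank_one[OF i] by metis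
next
  fix x y z c d assume i: "indep2 x y" and cd: "cmod c = 1" "cmod d = 1" and z: "\<phi> z = c *s \<phi> x + d *s \<phi> y"
  have "supp_rel (outer (\<phi> x) (\<phi> x)) (outer (\<phi> y) (\<phi> y)) (outer (\<phi> z) (\<phi> z))"
    unfolding z by (rule supp_rel_outer_sum[OF cd])
  then have "supp_rel (outer x x) (outer y y) (outer z z)"
    using rel[of "outer x x" "outer y y" "outer z z"] by (simp add: \<phi>)
  then show "\<exists>a b. z = a *s x + b *s y" using supp_rel_outer_rank_one[OF i] by metis
qed

theorem congruence_or_transposed:
  obtains a \<sigma> where "invertible a" "\<sigma> = id \<or> \<sigma> = mtransp" "\<And>A. psd A \<Longrightarrow> \<tau> A = a ** \<sigma> A ** madj a"
proof -
  obtain a :: "'n cmat" and \<kappa> where \<kappa>: "\<kappa> = id \<or> \<kappa> = cnj"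
    and a: "\<And>x. \<exists>c. cmod c = 1 \<and> \<phi> x = c *s (a *v (\<chi> i. \<kappa> (x $ i)))"
    by (rule ray_map.linear_or_conjugate_linear[OF ray_map]) (rule that)
  define \<sigma> :: "'n cmat \<Rightarrow> 'n cmat" where "\<sigma> = (if \<kappa> = id then id else mtransp)"
  have \<sigma>: "\<sigma> = id \<or> \<sigma> = mtransp" by (simp add: \<sigma>_def)
  have \<kappa>\<kappa>: "\<kappa> (\<kappa> z) = z" for z using \<kappa> by auto
  have inv: "invertible a"
    unfolding invertible_iff_kernel
  proof (intro allI impI)
    fix x assume "a *v x = 0"
    moreover obtain c where "\<phi> (\<chi> i. \<kappa> (x $ i)) = c *s (a *v x)"
      using a[of "\<chi> i. \<kappa> (x $ i)"] by (auto simp: \<kappa>\<kappa>)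
    ultimately have "(\<chi> i. \<kappa> (x $ i)) = 0" using \<phi>_eq_0_iff by simp
    then have "\<kappa> (x $ i) = 0" for i by (simp add: vec_eq_iff)
    then have "x $ i = 0" for i using \<kappa> by auto
    then show "x = 0" by (simp add: vec_eq_iff)
  qed
  \<comment> \<open>Conjugating \<open>x\<close> transposes its rank-one matrix. Evaluation at
    \<open>\<i>\<close> shows \<open>cnj \<noteq> id\<close>, so the case distinction in
    \<open>\<sigma>\<close> is the right one.\<close>
  have \<sigma>_outer: "\<sigma> (outer x x) = outer (\<chi> i. \<kappa> (x $ i)) (\<chi> i. \<kappa> (x $ i))" for x
    using \<kappa> by (auto simp: \<sigma>_def mtransp_def transpose_def outer_def vec_eq_iff mult.commute dest: fun_cong[where x="\<i>"])
  define \<Psi> where "\<Psi> A = a ** \<sigma> A ** madj a" for A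
  have rank1: "\<tau> (outer x x) = \<Psi> (outer x x)" for x
  proof -
    obtain c where c: "cmod c = 1" "\<phi> x = c *s (a *v (\<chi> i. \<kappa> (x $ i)))" using a by blast
    then have "\<tau> (outer x x) = outer (a *v (\<chi> i. \<kappa> (x $ i))) (a *v (\<chi> i. \<kappa> (x $ i)))"
      by (simp add: \<phi> outer_phase)
    then show ?thesis by (simp add: \<Psi>_def \<sigma>_outer outer_congruence)
  qed
  have \<sigma>_psd: "psd (\<sigma> A) \<longleftrightarrow> psd A" for A
    using \<sigma> psd_mtransp[of A] psd_mtransp[of "mtransp A"] by auto
  have \<sigma>_diff: "\<sigma> (A - B) = \<sigma> A - \<sigma> B" for A B using \<sigma> by (auto simp: mtransp_diff)
  obtain b where b: "a ** b = mat 1" "b ** a = mat 1" using inv by (rule invertibleE)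
  have b_cancel: "b ** (a ** X ** madj a) ** madj b = X" "a ** (b ** X ** madj b) ** madj a = X" for X
  proof -
    have "b ** (a ** X ** madj a) ** madj b = (b ** a) ** X ** madj (b ** a)"
      "a ** (b ** X ** madj b) ** madj a = (a ** b) ** X ** madj (a ** b)"
      by (simp_all add: madj_mult matrix_mul_assoc)
    then show "b ** (a ** X ** madj a) ** madj b = X" "a ** (b ** X ** madj b) ** madj a = X" by (simp_all add: b)
  qed
  have cong_psd: "psd (a ** X ** madj a) \<longleftrightarrow> psd X" for X
    using psd_congruence[of X a] psd_congruence[of "a ** X ** madj a" b] by (auto simp: b_cancel)
  have \<Psi>_psd: "psd (\<Psi> A) \<longleftrightarrow> psd A" for A by (simp add: \<Psi>_def cong_psd \<sigma>_psd)
  have \<Psi>_diff: "\<Psi> (A - B) = \<Psi> A - \<Psi> B" for A B by (simp add: \<Psi>_def \<sigma>_diff matrix_distribs)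
  have \<Psi>_surj: "\<exists>x. \<Psi> (outer x x) = outer y y" for y
  proof -
    have "\<Psi> (outer (\<chi> i. \<kappa> ((b *v y) $ i)) (\<chi> i. \<kappa> ((b *v y) $ i))) = outer (a *v (b *v y)) (a *v (b *v y))"
      by (simp add: \<Psi>_def \<sigma>_outer \<kappa>\<kappa> outer_congruence)
    then show ?thesis by (auto simp: matrix_vector_mul_assoc b)
  qed
  have dominated: "psd (\<tau> A - outer y y) \<longleftrightarrow> psd (\<Psi> A - outer y y)" if "psd A" for A y
  proof -
    obtain x where x: "\<Psi> (outer x x) = outer y y" using \<Psi>_surj by blast
    have "psd (\<tau> A - outer y y) \<longleftrightarrow> psd (A - outer x x)"
      using order_iff[OF psd_outer that, of x] rank1 x by simp
    also have "\<dots> \<longleftrightarrow> psd (\<Psi> A - outer y y)" using \<Psi>_psd[of "A - outer x x"] by (simp add: \<Psi>_diff x)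
    finally show ?thesis .
  qed
  have "\<tau> A = \<Psi> A" if A: "psd A" for A
    using psd_le_by_rank_one[of "\<tau> A" "\<Psi> A"] psd_le_by_rank_one[of "\<Psi> A" "\<tau> A"] dominated[OF A]
      psd[OF A] \<Psi>_psd[of A] A psd_antisym by blast
  then show ?thesis using that inv \<sigma> unfolding \<Psi>_def by blast
qed

end

section \<open>Passage to squared variables and conclusion\<close>

lemma hypergroup_aut_supp_rel:
  fixes T :: "'n::finite cmat \<Rightarrow> 'n cmat"
  assumes \<mu>: "\<mu> > rho_C TYPE('n) - 1" and T: "hypergroup_aut \<mu> T"
  shows "supp_rel_aut (\<lambda>A. T (psd_sqrt A) ** T (psd_sqrt A))"
proof -
  obtain T' where hom: "homeomorphism PiCone PiCone T T'" using T unfolding hypergroup_aut_def by blast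
  have T_psd: "psd (T r)" if "psd r" for r
    using homeomorphism_image1[OF hom] that by (auto simp: PiCone_def)
  have T'_psd: "psd (T' r)" and TT': "T (T' r) = r" if "psd r" for r
    using homeomorphism_image2[OF hom] homeomorphism_apply2[OF hom] that by (auto simp: PiCone_def)
  have T'T: "T' (T r) = r" if "psd r" for r
    using homeomorphism_apply1[OF hom] that by (auto simp: PiCone_def)
  have T_inj: "r = s" if "psd r" "psd s" "T r = T s" for r s using T'T that by metis
  define \<tau> where "\<tau> A = T (psd_sqrt A) ** T (psd_sqrt A)" for A
  have sqrt_\<tau>: "psd_sqrt (\<tau> A) = T (psd_sqrt A)" if "psd A" for A
    unfolding \<tau>_def using that by (simp add: psd_sqrt_of_square T_psd psd_psd_sqrt)
  have \<tau>_psd: "psd (\<tau> A)" if "psd A" for A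
    unfolding \<tau>_def using that by (intro psd_square_self T_psd psd_psd_sqrt)
  have supp_iff: "supp_rel A B C \<longleftrightarrow> psd_sqrt C \<in> conv_supp (psd_sqrt A) (psd_sqrt B)"
    if "psd A" "psd B" "psd C" for A B C :: "'n cmat"
  proof -
    have "psd (Mconv (psd_sqrt A) (psd_sqrt B) v)" if "v \<in> Dbar" for v
      using that \<open>psd A\<close> \<open>psd B\<close> by (intro psd_Mconv psd_psd_sqrt)
    then show ?thesis
      unfolding supp_rel_def conv_supp_def image_iff using psd_sqrt_square \<open>psd C\<close> by metis
  qed
  have "supp_rel_aut \<tau>"
  proof
    fix A B C :: "'n cmat"
    show "psd A \<Longrightarrow> psd (\<tau> A)" by (rule \<tau>_psd)
    show "\<exists>A. psd A \<and> \<tau> A = B" if "psd B"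
      using that by (intro exI[of _ "T' (psd_sqrt B) ** T' (psd_sqrt B)"])
        (simp add: psd_square_self T'_psd psd_psd_sqrt \<tau>_def psd_sqrt_of_square TT' psd_sqrt_square)
    show "A = B" if "psd A" "psd B" "\<tau> A = \<tau> B"
      using that sqrt_\<tau> T_inj[of "psd_sqrt A" "psd_sqrt B"] psd_psd_sqrt psd_sqrt_square by metis
    show "supp_rel (\<tau> A) (\<tau> B) (\<tau> C) \<longleftrightarrow> supp_rel A B C" if "psd A" "psd B" "psd C"
    proof -
      have "supp_rel (\<tau> A) (\<tau> B) (\<tau> C) \<longleftrightarrow> T (psd_sqrt C) \<in> T ` conv_supp (psd_sqrt A) (psd_sqrt B)"
        using that by (simp add: supp_iff \<tau>_psd sqrt_\<tau> hypergroup_aut_conv_supp[OF \<mu> T] psd_psd_sqrt)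
      also have "\<dots> \<longleftrightarrow> psd_sqrt C \<in> conv_supp (psd_sqrt A) (psd_sqrt B)"
        using T_inj that conv_supp_psd[of "psd_sqrt A" "psd_sqrt B"] psd_psd_sqrt
        unfolding PiCone_def image_iff by (metis mem_Collect_eq subsetD)
      finally show ?thesis using supp_iff that by simp
    qed
  qed
  then show ?thesis by (simp add: \<tau>_def[abs_def])
qed

theorem mainTheorem2:
  fixes \<mu> :: real and T :: "complex ^ 'q::finite ^ 'q \<Rightarrow> complex ^ 'q ^ 'q"
  assumes "\<mu> > rho_C TYPE('q) - 1"
  shows "hypergroup_aut \<mu> T \<longleftrightarrow>
    (\<exists>a \<sigma>. invertible a \<and> (\<sigma> = id \<or> \<sigma> = mtransp) \<and>
       (\<forall>x\<in>PiCone. T x = \<sigma> (T_mat a x)))"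
proof
  assume T: "hypergroup_aut \<mu> T"
  interpret supp_rel_aut "\<lambda>A. T (psd_sqrt A) ** T (psd_sqrt A)"
    by (rule hypergroup_aut_supp_rel[OF assms T])
  obtain a \<sigma> where a: "invertible a" and \<sigma>: "\<sigma> = id \<or> \<sigma> = mtransp"
    and eq: "\<And>A. psd A \<Longrightarrow> T (psd_sqrt A) ** T (psd_sqrt A) = a ** \<sigma> A ** madj a"
    using congruence_or_transposed by blast
  obtain T' where hom: "homeomorphism PiCone PiCone T T'" using T unfolding hypergroup_aut_def by blast
  have Tx: "T x = psd_sqrt (a ** \<sigma> (x ** x) ** madj a)" if "psd x" for x
  proof -
    have "psd (T x)" using homeomorphism_image1[OF hom] that by (auto simp: PiCone_def)
    moreover have "T x ** T x = a ** \<sigma> (x ** x) ** madj a"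
      using eq[OF psd_square_self[OF that]] that by (simp add: psd_sqrt_of_square)
    ultimately show ?thesis using psd_sqrt_eqI by metis
  qed
  from \<sigma> show "\<exists>a \<sigma>. invertible a \<and> (\<sigma> = id \<or> \<sigma> = mtransp) \<and> (\<forall>x\<in>PiCone. T x = \<sigma> (T_mat a x))"
  proof
    assume "\<sigma> = id"
    then have "\<forall>x\<in>PiCone. T x = id (T_mat a x)"
      using Tx by (auto simp: PiCone_def T_mat_def matrix_mul_assoc)
    then show ?thesis using a by blast
  next
    assume s: "\<sigma> = mtransp"
    \<comment> \<open>The entrywise conjugate of \<open>a\<close>; it lets the transposition be
      taken after the congruence instead of before it.\<close>
    define b where "b = mtransp (madj a)"
    have "T x = mtransp (T_mat b x)" if "psd x" for x
    proof -
      have "a ** mtransp (x ** x) ** madj a = mtransp (b ** x ** x ** madj b)"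
        by (simp add: b_def mtransp_mult mtransp_madj matrix_mul_assoc)
      then show ?thesis using Tx[OF that] s by (simp add: T_mat_def psd_sqrt_mtransp T_mat_psd that)
    qed
    moreover have "invertible b"
    proof -
      obtain c where "a ** c = mat 1" using a by (rule invertibleE)
      then have "mtransp (madj (a ** c)) = mat 1" by (simp add: mtransp_mat_1)
      then have "b ** mtransp (madj c) = mat 1" by (simp add: b_def madj_mult mtransp_mult)
      then show ?thesis unfolding invertible_right_inverse by blast
    qed
    ultimately show ?thesis by (intro exI[of _ b] exI[of _ mtransp]) (auto simp: PiCone_def)
  qed
next
  assume "\<exists>a \<sigma>. invertible a \<and> (\<sigma> = id \<or> \<sigma> = mtransp) \<and> (\<forall>x\<in>PiCone. T x = \<sigma> (T_mat a x))"
  then show "hypergroup_aut \<mu> T" using hypergroup_autI by blast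
qed

end
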